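(* Let $\alpha\in(0,1/2)$ be irrational, let $\mathsf f$ be an orientation preserving $C^\infty$-diffeomorphism of $\mathbb T$ with rotation number $2\alpha$, and let $D^\sigma=\bigoplus_{n\in\mathbb Z}D^\sigma_n$ be the associated deformed Dirac operator (see context). Then $D^\sigma$ has compact resolvent if and only if $$\lim_{|n|\to\infty}\big\|(D^\sigma_n)^{-1}\big\|=0,$$ and $D^\sigma$ has compact resolvent if $\Gamma_n(\mathsf f)=o(n)$.
   Context: $\mathbb T$ is the unit circle, $m$ its normalised Lebesgue measure, $D=\frac{\mathrm d}{\mathrm dz}$ acting on functions on $\mathbb T$, $H^1(\mathbb T)=\{u\text{ absolutely continuous on }\mathbb T: u'\in L^2(\mathbb T,m)\}$, $M_g$ denotes multiplication by $g$. Growth sequence: $\Gamma_n(\mathsf f):=\max\{\|D\mathsf f^n\|_\infty,\|D\mathsf f^{-n}\|_\infty\}$. For $n\in\mathbb Z$ put $\delta_n(z)=\frac{z(D\mathsf f^{n})(z)}{\mathsf f^{n}(z)}$, $z\in\mathbb T$ (a strictly positive smooth function, equal to the Radon–Nikodym derivative $\frac{\mathrm d(m\circ\mathsf f^n)}{\mathrm dm}$), $L_n:=\imath z\frac{\mathrm d}{\mathrm dz}-nI$ on $H^1(\mathbb T)$, so that $L_n^*=-\imath z\frac{\mathrm d}{\mathrm dz}-nI$, and $$D^\sigma_n:=\begin{pmatrix}0&M_{\delta_n^{-1}}L_n\\ L_n^*M_{\delta_n^{-1}}&0\end{pmatrix}$$ on $L^2(\mathbb T,m)\oplus L^2(\mathbb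 T,m)$ with domain $H^1(\mathbb T)\oplus H^1(\mathbb T)$. $D^\sigma:=\bigoplus_nD^\sigma_n$ acts on $\bigoplus_{n\in\mathbb Z}\big(L^2(\mathbb T,m)\oplus L^2(\mathbb T,m)\big)$ with domain $\{\xi=(\xi_n): \xi_n\in H^1(\mathbb T)\oplus H^1(\mathbb T),\ \sum_n\|D^\sigma_n\xi_n\|^2<+\infty\}$; it is selfadjoint. For $n\neq0$, $D^\sigma_n$ is invertible with bounded inverse; for $n=0$, $(D_0^\sigma)^{-1}$ means the inverse on the orthogonal complement of the kernel, extended by $0$ on the kernel. *)

theory Defs
  imports "HOL-Analysis.Analysis" "HOL-Library.Landau_Symbols"
begin

section \<open>Complex inner product spaces\<close>

class complex_inner = real_inner +
  fixes scaleC :: "complex \<Rightarrow> 'a \<Rightarrow> 'a" (infixr \<open>*\<^sub>C\<close> 75)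
    and cinner :: "'a \<Rightarrow> 'a \<Rightarrow> complex"
  assumes scaleC_add_right: "c *\<^sub>C (x + y) = c *\<^sub>C x + c *\<^sub>C y"
    and scaleC_add_left: "(c + d) *\<^sub>C x = c *\<^sub>C x + d *\<^sub>C x"
    and scaleC_scaleC: "c *\<^sub>C d *\<^sub>C x = (c * d) *\<^sub>C x"
    and scaleR_scaleC: "r *\<^sub>R x = of_real r *\<^sub>C x"
    and cinner_commute: "cinner x y = cnj (cinner y x)"
    and cinner_add_left: "cinner (x + y) z = cinner x z + cinner y z"
    and cinner_scaleC_left: "cinner (c *\<^sub>C x) y = c * cinner x y"
    and inner_eq_Re_cinner: "inner x y = Re (cinner x y)"

lemma norm_scaleC: "norm (c *\<^sub>C x) = cmod c * norm (x::'a::complex_inner)"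
proof -
  have "cinner (c *\<^sub>C x) (c *\<^sub>C x) = (c * cnj c) * cinner x x"
    by (metis cinner_commute cinner_scaleC_left complex_cnj_mult mult.assoc mult.left_commute)
  also have "c * cnj c = of_real ((cmod c)\<^sup>2)"
    by (rule complex_norm_square[symmetric])
  finally have "inner (c *\<^sub>C x) (c *\<^sub>C x) = (cmod c)\<^sup>2 * inner x x"
    by (simp add: inner_eq_Re_cinner del: of_real_power)
  then show ?thesis
    by (simp add: norm_eq_sqrt_inner real_sqrt_mult)
qed

lemma norm_cinner_le: "cmod (cinner x y) \<le> norm x * norm (y::'a::complex_inner)"
proof -
  obtain u where u: "cmod u = 1" "u * cinner x y = of_real (cmod (cinner x y))"
  proof (cases "cinner x y = 0")
    case True
    then show ?thesis using that[of 1] by simp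
  next
    case False
    have "cnj (sgn (cinner x y)) * cinner x y = of_real (cmod (cinner x y))"
      using False complex_norm_square[of "cinner x y"]
      by (simp add: sgn_eq field_simps power2_eq_square)
    then show ?thesis using that[of "cnj (sgn (cinner x y))"] False by (simp add: norm_sgn)
  qed
  have "cmod (cinner x y) = Re (cinner (u *\<^sub>C x) y)"
    by (simp add: cinner_scaleC_left u)
  also have "\<dots> = inner (u *\<^sub>C x) y"
    by (simp add: inner_eq_Re_cinner)
  also have "\<dots> \<le> norm (u *\<^sub>C x) * norm y"
    by (rule norm_cauchy_schwarz)
  finally show ?thesis by (simp add: norm_scaleC u)
qed

instantiation prod :: (complex_inner, complex_inner) complex_inner
begin
definition scaleC_prod_def: "c *\<^sub>C x = (c *\<^sub>C fst x, c *\<^sub>C snd x)"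
definition cinner_prod_def: "cinner x y = cinner (fst x) (fst y) + cinner (snd x) (snd y)"
instance
proof
  fix x y :: "'a \<times> 'b"
  show "cinner x y = cnj (cinner y x)"
    unfolding cinner_prod_def by (metis cinner_commute complex_cnj_add)
qed (simp_all add: scaleC_prod_def cinner_prod_def scaleC_add_right scaleC_add_left
    scaleC_scaleC scaleR_scaleC cinner_add_left cinner_scaleC_left inner_eq_Re_cinner
    inner_prod_def prod_eq_iff algebra_simps)
end


section \<open>Hilbert space direct sums\<close>

typedef (overloaded) ('i, 'a) hilbert_sum =
  "{x :: 'i \<Rightarrow> 'a::complex_inner. (\<lambda>i. (norm (x i))\<^sup>2) summable_on UNIV}"
  morphisms component Abs_hilbert_sum
  by (rule exI[of _ "\<lambda>_. 0"]) simp

setup_lifting type_definition_hilbert_sum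

lemma square_summable_add:
  fixes f g :: "'i \<Rightarrow> 'a::complex_inner"
  assumes "(\<lambda>i. (norm (f i))\<^sup>2) summable_on UNIV" "(\<lambda>i. (norm (g i))\<^sup>2) summable_on UNIV"
  shows "(\<lambda>i. (norm (f i + g i))\<^sup>2) summable_on UNIV"
proof (rule summable_on_comparison_test)
  show "(\<lambda>i. 2 * (norm (f i))\<^sup>2 + 2 * (norm (g i))\<^sup>2) summable_on UNIV"
    by (intro summable_on_add summable_on_cmult_right assms)
  fix i
  have "(norm (f i + g i))\<^sup>2 \<le> (norm (f i) + norm (g i))\<^sup>2"
    by (intro power_mono norm_triangle_ineq) simp
  also have "\<dots> \<le> 2 * (norm (f i))\<^sup>2 + 2 * (norm (g i))\<^sup>2"
    using sum_squares_bound[of "norm (f i)" "norm (g i)"] by (simp add: power2_sum)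
  finally show "(norm (f i + g i))\<^sup>2 \<le> 2 * (norm (f i))\<^sup>2 + 2 * (norm (g i))\<^sup>2" .
qed simp

lemma square_summable_scaleC:
  fixes f :: "'i \<Rightarrow> 'a::complex_inner"
  assumes "(\<lambda>i. (norm (f i))\<^sup>2) summable_on UNIV"
  shows "(\<lambda>i. (norm (c *\<^sub>C f i))\<^sup>2) summable_on UNIV"
  using summable_on_cmult_right[OF assms, of "(cmod c)\<^sup>2"]
  by (simp add: norm_scaleC power_mult_distrib)

lemma square_summable_cinner:
  fixes f g :: "'i \<Rightarrow> 'a::complex_inner"
  assumes "(\<lambda>i. (norm (f i))\<^sup>2) summable_on UNIV" "(\<lambda>i. (norm (g i))\<^sup>2) summable_on UNIV"
  shows "(\<lambda>i. cinner (f i) (g i)) summable_on UNIV"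
proof (rule abs_summable_summable, rule summable_on_comparison_test)
  show "(\<lambda>i. (norm (f i))\<^sup>2 + (norm (g i))\<^sup>2) summable_on UNIV"
    by (intro summable_on_add assms)
  fix i
  have "2 * (norm (f i) * norm (g i)) \<le> (norm (f i))\<^sup>2 + (norm (g i))\<^sup>2"
    using sum_squares_bound[of "norm (f i)" "norm (g i)"] by simp
  moreover have "0 \<le> norm (f i) * norm (g i)" by simp
  ultimately show "norm (cinner (f i) (g i)) \<le> (norm (f i))\<^sup>2 + (norm (g i))\<^sup>2"
    using norm_cinner_le[of "f i" "g i"] by linarith
qed simp

instantiation hilbert_sum :: (type, complex_inner) complex_inner
begin

lift_definition zero_hilbert_sum :: "('a, 'b) hilbert_sum" is "\<lambda>_. 0" by simp
lift_definition plus_hilbert_sum ::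
    "('a, 'b) hilbert_sum \<Rightarrow> ('a, 'b) hilbert_sum \<Rightarrow> ('a, 'b) hilbert_sum"
  is "\<lambda>x y i. x i + y i" by (rule square_summable_add)
lift_definition uminus_hilbert_sum :: "('a, 'b) hilbert_sum \<Rightarrow> ('a, 'b) hilbert_sum"
  is "\<lambda>x i. - x i" by simp
lift_definition minus_hilbert_sum ::
    "('a, 'b) hilbert_sum \<Rightarrow> ('a, 'b) hilbert_sum \<Rightarrow> ('a, 'b) hilbert_sum"
  is "\<lambda>x y i. x i - y i"
  subgoal for f g using square_summable_add[of f "\<lambda>i. - g i"] by simp
  done
lift_definition scaleC_hilbert_sum ::
    "complex \<Rightarrow> ('a, 'b) hilbert_sum \<Rightarrow> ('a, 'b) hilbert_sum"
  is "\<lambda>c x i. c *\<^sub>C x i" by (rule square_summable_scaleC)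
lift_definition cinner_hilbert_sum ::
    "('a, 'b) hilbert_sum \<Rightarrow> ('a, 'b) hilbert_sum \<Rightarrow> complex"
  is "\<lambda>x y. \<Sum>\<^sub>\<infinity>i. cinner (x i) (y i)" .

definition "r *\<^sub>R (x::('a, 'b) hilbert_sum) = of_real r *\<^sub>C x"
definition "inner (x::('a, 'b) hilbert_sum) y = Re (cinner x y)"
definition "norm (x::('a, 'b) hilbert_sum) = sqrt (inner x x)"
definition "dist (x::('a, 'b) hilbert_sum) y = norm (x - y)"
definition "sgn (x::('a, 'b) hilbert_sum) = inverse (norm x) *\<^sub>R x"
definition [code del]:
  "(uniformity :: (('a, 'b) hilbert_sum \<times> ('a, 'b) hilbert_sum) filter) =
    (INF e\<in>{0 <..}. principal {(x, y). dist x y < e})"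
definition [code del]:
  "open (U :: ('a, 'b) hilbert_sum set) \<longleftrightarrow>
    (\<forall>x\<in>U. eventually (\<lambda>(x', y). x' = x \<longrightarrow> y \<in> U) uniformity)"

instance
proof
  fix x y z :: "('a, 'b) hilbert_sum" and r s :: real and c d :: complex
  show "x + y + z = x + (y + z)" by transfer (simp add: add.assoc)
  show "x + y = y + x" by transfer (simp add: add.commute)
  show "0 + x = x" by transfer simp
  show "- x + x = 0" by transfer simp
  show "x - y = x + - y" by transfer simp
  show add_right: "c *\<^sub>C (x + y) = c *\<^sub>C x + c *\<^sub>C y" for c and x y :: "('a, 'b) hilbert_sum"
    by transfer (simp add: scaleC_add_right)
  show add_left: "(c + d) *\<^sub>C x = c *\<^sub>C x + d *\<^sub>C x" for c d and x :: "('a, 'b) hilbert_sum"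
    by transfer (simp add: scaleC_add_left)
  show assoc: "c *\<^sub>C d *\<^sub>C x = (c * d) *\<^sub>C x" for c d and x :: "('a, 'b) hilbert_sum"
    by transfer (simp add: scaleC_scaleC)
  show "r *\<^sub>R x = of_real r *\<^sub>C x" by (fact scaleR_hilbert_sum_def)
  show "r *\<^sub>R (x + y) = r *\<^sub>R x + r *\<^sub>R y" "(r + s) *\<^sub>R x = r *\<^sub>R x + s *\<^sub>R x"
    "r *\<^sub>R s *\<^sub>R x = (r * s) *\<^sub>R x"
    by (simp_all add: scaleR_hilbert_sum_def add_right add_left assoc)
  show "1 *\<^sub>R x = x"
    unfolding scaleR_hilbert_sum_def
    by transfer (simp add: scaleR_scaleC[of 1, symmetric, simplified])
  show comm: "cinner x y = cnj (cinner y x)" for x y :: "('a, 'b) hilbert_sum"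
  proof transfer
    fix x y :: "'a \<Rightarrow> 'b"
    have "(\<Sum>\<^sub>\<infinity>i. cinner (x i) (y i)) = (\<Sum>\<^sub>\<infinity>i. cnj (cinner (y i) (x i)))"
      by (intro infsum_cong) (rule cinner_commute)
    then show "(\<Sum>\<^sub>\<infinity>i. cinner (x i) (y i)) = cnj (\<Sum>\<^sub>\<infinity>i. cinner (y i) (x i))"
      by simp
  qed
  show cadd: "cinner (x + y) z = cinner x z + cinner y z"
    by transfer (simp add: cinner_add_left infsum_add square_summable_cinner)
  show cscale: "cinner (c *\<^sub>C x) y = c * cinner x y" for c
    by transfer (simp add: cinner_scaleC_left infsum_cmult_right')
  show "inner x y = Re (cinner x y)" by (fact inner_hilbert_sum_def)
  show "inner x y = inner y x"
    using comm[of x y] by (simp add: inner_hilbert_sum_def)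
  show "inner (x + y) z = inner x z + inner y z"
    by (simp add: inner_hilbert_sum_def cadd)
  show "inner (r *\<^sub>R x) y = r * inner x y"
    by (simp add: inner_hilbert_sum_def scaleR_hilbert_sum_def cscale)
  have inner_self: "inner x x = (\<Sum>\<^sub>\<infinity>i. (norm (component x i))\<^sup>2)"
    unfolding inner_hilbert_sum_def
  proof transfer
    fix x :: "'a \<Rightarrow> 'b" assume x: "(\<lambda>i. (norm (x i))\<^sup>2) summable_on UNIV"
    have "Re (\<Sum>\<^sub>\<infinity>i. cinner (x i) (x i)) = (\<Sum>\<^sub>\<infinity>i. Re (cinner (x i) (x i)))"
      by (rule infsum_Re[symmetric]) (rule square_summable_cinner[OF x x])
    also have "\<dots> = (\<Sum>\<^sub>\<infinity>i. (norm (x i))\<^sup>2)"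
      by (simp add: inner_eq_Re_cinner[symmetric] power2_norm_eq_inner)
    finally show "Re (\<Sum>\<^sub>\<infinity>i. cinner (x i) (x i)) = (\<Sum>\<^sub>\<infinity>i. (norm (x i))\<^sup>2)" .
  qed
  show "0 \<le> inner x x" by (simp add: inner_self infsum_nonneg)
  show "inner x x = 0 \<longleftrightarrow> x = 0"
  proof
    assume *: "inner x x = 0"
    have "(norm (component x i))\<^sup>2 = 0" for i
      by (rule nonneg_infsum_le_0D[where A = UNIV and f = "\<lambda>i. (norm (component x i))\<^sup>2"])
        (use * component[of x] in \<open>simp_all add: inner_self\<close>)
    then show "x = 0" by transfer auto
  next
    assume "x = 0"
    then have "component x i = 0" for i by (simp add: zero_hilbert_sum.rep_eq)
    then show "inner x x = 0" unfolding inner_self by simp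
  qed
qed (simp_all add: norm_hilbert_sum_def dist_hilbert_sum_def sgn_hilbert_sum_def
    uniformity_hilbert_sum_def open_hilbert_sum_def)

end


section \<open>The space of square integrable functions on the circle\<close>

abbreviation circle :: "complex set" where
  "circle \<equiv> sphere 0 1"

definition circle_measure :: "complex measure" where
  "circle_measure =
    distr (restrict_space lborel {0..<1}) (restrict_space borel circle) (\<lambda>t. cis (2 * pi * t))"

definition square_integrable :: "(complex \<Rightarrow> complex) \<Rightarrow> bool" where
  "square_integrable f \<longleftrightarrow>
    f \<in> borel_measurable circle_measure \<and> integrable circle_measure (\<lambda>z. (cmod (f z))\<^sup>2)"

definition L2_eq :: "(complex \<Rightarrow> complex) \<Rightarrow> (complex \<Rightarrow> complex) \<Rightarrow> bool" where
  "L2_eq f g \<longleftrightarrow>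
    square_integrable f \<and> square_integrable g \<and> (AE z in circle_measure. f z = g z)"

quotient_type circle_L2 = "complex \<Rightarrow> complex" / partial: L2_eq
proof (rule part_equivpI)
  show "\<exists>f. L2_eq f f"
    by (rule exI[of _ "\<lambda>_. 0"]) (simp add: L2_eq_def square_integrable_def)
  show "symp L2_eq" by (auto simp: symp_def L2_eq_def)
  show "transp L2_eq" unfolding transp_def L2_eq_def by auto
qed

lemma square_integrable_mult:
  assumes "square_integrable f" "square_integrable g"
  shows "integrable circle_measure (\<lambda>z. f z * cnj (g z))"
proof (rule Bochner_Integration.integrable_bound)
  show "integrable circle_measure (\<lambda>z. (cmod (f z))\<^sup>2 + (cmod (g z))\<^sup>2)"
    using assms by (simp add: square_integrable_def)
  have [measurable]: "f \<in> borel_measurable circle_measure" "g \<in> borel_measurable circle_measure"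
    using assms by (simp_all add: square_integrable_def)
  have [measurable]: "cnj \<in> borel_measurable borel"
    by (intro borel_measurable_continuous_onI continuous_intros)
  show "(\<lambda>z. f z * cnj (g z)) \<in> borel_measurable circle_measure"
    by measurable
  have "cmod (f z) * cmod (g z) \<le> (cmod (f z))\<^sup>2 + (cmod (g z))\<^sup>2" for z
  proof -
    have "2 * (cmod (f z) * cmod (g z)) \<le> (cmod (f z))\<^sup>2 + (cmod (g z))\<^sup>2"
      using sum_squares_bound[of "cmod (f z)" "cmod (g z)"] by simp
    moreover have "0 \<le> cmod (f z) * cmod (g z)" by simp
    ultimately show ?thesis by linarith
  qed
  then show "AE z in circle_measure.
      norm (f z * cnj (g z)) \<le> norm ((cmod (f z))\<^sup>2 + (cmod (g z))\<^sup>2)"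
    by (simp add: norm_mult)
qed

lemma square_integrable_scale:
  "square_integrable f \<Longrightarrow> square_integrable (\<lambda>z. c * f z)"
  by (auto simp: square_integrable_def norm_mult power_mult_distrib)

lemma square_integrable_add:
  assumes "square_integrable f" "square_integrable g"
  shows "square_integrable (\<lambda>z. f z + g z)"
  unfolding square_integrable_def
proof
  have [measurable]: "f \<in> borel_measurable circle_measure" "g \<in> borel_measurable circle_measure"
    using assms by (simp_all add: square_integrable_def)
  show "(\<lambda>z. f z + g z) \<in> borel_measurable circle_measure" by measurable
  show "integrable circle_measure (\<lambda>z. (cmod (f z + g z))\<^sup>2)"
  proof (rule Bochner_Integration.integrable_bound)
    show "integrable circle_measure (\<lambda>z. 2 * (cmod (f z))\<^sup>2 + 2 * (cmod (g z))\<^sup>2)"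
      using assms by (simp add: square_integrable_def)
    show "(\<lambda>z. (cmod (f z + g z))\<^sup>2) \<in> borel_measurable circle_measure" by measurable
    have "(cmod (f z + g z))\<^sup>2 \<le> 2 * (cmod (f z))\<^sup>2 + 2 * (cmod (g z))\<^sup>2" for z
    proof -
      have "(cmod (f z + g z))\<^sup>2 \<le> (cmod (f z) + cmod (g z))\<^sup>2"
        by (intro power_mono norm_triangle_ineq) simp
      also have "\<dots> \<le> 2 * (cmod (f z))\<^sup>2 + 2 * (cmod (g z))\<^sup>2"
        using sum_squares_bound[of "cmod (f z)" "cmod (g z)"] by (simp add: power2_sum)
      finally show ?thesis .
    qed
    then show "AE z in circle_measure.
        norm ((cmod (f z + g z))\<^sup>2) \<le> norm (2 * (cmod (f z))\<^sup>2 + 2 * (cmod (g z))\<^sup>2)"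
      by simp
  qed
qed

lemma square_integrable_uminus: "square_integrable f \<Longrightarrow> square_integrable (\<lambda>z. - f z)"
  using square_integrable_scale[of f "-1"] by simp

lemma square_integrable_diff:
  "square_integrable f \<Longrightarrow> square_integrable g \<Longrightarrow> square_integrable (\<lambda>z. f z - g z)"
  using square_integrable_add[of f "\<lambda>z. - g z"] square_integrable_uminus[of g] by simp

instantiation circle_L2 :: complex_inner
begin

lift_definition zero_circle_L2 :: circle_L2 is "\<lambda>_. 0"
  by (simp add: L2_eq_def square_integrable_def)
lift_definition plus_circle_L2 :: "circle_L2 \<Rightarrow> circle_L2 \<Rightarrow> circle_L2"
  is "\<lambda>f g z. f z + g z"
  unfolding L2_eq_def by (auto intro: square_integrable_add)
lift_definition uminus_circle_L2 :: "circle_L2 \<Rightarrow> circle_L2" is "\<lambda>f z. - f z"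
  unfolding L2_eq_def by (auto intro: square_integrable_uminus)
lift_definition minus_circle_L2 :: "circle_L2 \<Rightarrow> circle_L2 \<Rightarrow> circle_L2"
  is "\<lambda>f g z. f z - g z"
  unfolding L2_eq_def by (auto intro: square_integrable_diff)
lift_definition scaleC_circle_L2 :: "complex \<Rightarrow> circle_L2 \<Rightarrow> circle_L2" is "\<lambda>c f z. c * f z"
  unfolding L2_eq_def by (auto intro: square_integrable_scale)
lift_definition cinner_circle_L2 :: "circle_L2 \<Rightarrow> circle_L2 \<Rightarrow> complex"
  is "\<lambda>f g. \<integral>z. f z * cnj (g z) \<partial>circle_measure"
proof -
  fix f f' g g' assume fg: "L2_eq f f'" "L2_eq g g'"
  show "(\<integral>z. f z * cnj (g z) \<partial>circle_measure) = (\<integral>z. f' z * cnj (g' z) \<partial>circle_measure)"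
    using fg square_integrable_mult[of f g] square_integrable_mult[of f' g']
    by (intro integral_cong_AE) (auto simp: L2_eq_def)
qed

definition "r *\<^sub>R (x::circle_L2) = of_real r *\<^sub>C x"
definition "inner (x::circle_L2) y = Re (cinner x y)"
definition "norm (x::circle_L2) = sqrt (inner x x)"
definition "dist (x::circle_L2) y = norm (x - y)"
definition "sgn (x::circle_L2) = inverse (norm x) *\<^sub>R x"
definition [code del]:
  "(uniformity :: (circle_L2 \<times> circle_L2) filter) =
    (INF e\<in>{0 <..}. principal {(x, y). dist x y < e})"
definition [code del]:
  "open (U :: circle_L2 set) \<longleftrightarrow>
    (\<forall>x\<in>U. eventually (\<lambda>(x', y). x' = x \<longrightarrow> y \<in> U) uniformity)"

instance
proof
  fix x y z :: circle_L2 and r s :: real and c d :: complex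
  show "x + y + z = x + (y + z)"
    by transfer (auto simp: L2_eq_def add.assoc intro!: square_integrable_add)
  show "x + y = y + x"
    by transfer (auto simp: L2_eq_def add.commute intro!: square_integrable_add)
  show "0 + x = x" by transfer (auto simp: L2_eq_def)
  show "- x + x = 0" by transfer (auto simp: L2_eq_def square_integrable_def)
  show "x - y = x + - y"
    by transfer (auto simp: L2_eq_def intro!: square_integrable_diff)
  show add_right: "c *\<^sub>C (x + y) = c *\<^sub>C x + c *\<^sub>C y" for c and x y :: circle_L2
    by transfer
      (auto simp: L2_eq_def distrib_left intro!: square_integrable_add square_integrable_scale)
  show add_left: "(c + d) *\<^sub>C x = c *\<^sub>C x + d *\<^sub>C x" for c d and x :: circle_L2
    by transfer
      (auto simp: L2_eq_def distrib_right intro!: square_integrable_add square_integrable_scale)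
  show assoc: "c *\<^sub>C d *\<^sub>C x = (c * d) *\<^sub>C x" for c d and x :: circle_L2
    by transfer (auto simp: L2_eq_def mult.assoc intro!: square_integrable_scale)
  show "r *\<^sub>R x = of_real r *\<^sub>C x" by (fact scaleR_circle_L2_def)
  show "r *\<^sub>R (x + y) = r *\<^sub>R x + r *\<^sub>R y" "(r + s) *\<^sub>R x = r *\<^sub>R x + s *\<^sub>R x"
    "r *\<^sub>R s *\<^sub>R x = (r * s) *\<^sub>R x"
    by (simp_all add: scaleR_circle_L2_def add_right add_left assoc)
  show "1 *\<^sub>R x = x"
    unfolding scaleR_circle_L2_def by transfer (auto simp: L2_eq_def)
  show comm: "cinner x y = cnj (cinner y x)" for x y :: circle_L2
    by transfer (simp add: Bochner_Integration.integral_cnj[symmetric] mult.commute)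
  show cadd: "cinner (x + y) z = cinner x z + cinner y z"
    by transfer (simp add: L2_eq_def distrib_right square_integrable_mult)
  show cscale: "cinner (c *\<^sub>C x) y = c * cinner x y" for c
    by transfer (simp add: mult.assoc)
  show "inner x y = Re (cinner x y)" by (fact inner_circle_L2_def)
  show "inner x y = inner y x"
    using comm[of x y] by (simp add: inner_circle_L2_def)
  show "inner (x + y) z = inner x z + inner y z"
    by (simp add: inner_circle_L2_def cadd)
  show "inner (r *\<^sub>R x) y = r * inner x y"
    by (simp add: inner_circle_L2_def scaleR_circle_L2_def cscale)
  have sq: "Re (\<integral>z. f z * cnj (f z) \<partial>circle_measure) = (\<integral>z. (cmod (f z))\<^sup>2 \<partial>circle_measure)"
    for f
  proof -
    have "(\<lambda>z. f z * cnj (f z)) = (\<lambda>z. complex_of_real ((cmod (f z))\<^sup>2))"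
      by (simp only: complex_norm_square)
    then show ?thesis by (simp del: of_real_power)
  qed
  show "0 \<le> inner x x"
    unfolding inner_circle_L2_def by transfer (simp add: sq)
  show "inner x x = 0 \<longleftrightarrow> x = 0"
    unfolding inner_circle_L2_def
  proof transfer
    fix f assume f: "L2_eq f f"
    then have int: "integrable circle_measure (\<lambda>z. (cmod (f z))\<^sup>2)"
      by (simp add: L2_eq_def square_integrable_def)
    show "Re (\<integral>z. f z * cnj (f z) \<partial>circle_measure) = 0 \<longleftrightarrow> L2_eq f (\<lambda>_. 0)"
      using f integral_nonneg_eq_0_iff_AE[OF int]
      by (simp add: sq L2_eq_def) (simp add: square_integrable_def)
  qed
qed (simp_all add: norm_circle_L2_def dist_circle_L2_def sgn_circle_L2_def
    uniformity_circle_L2_def open_circle_L2_def)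

end


section \<open>Unbounded operators\<close>

text \<open>An unbounded operator is given by its domain \<open>S\<close> and a function \<open>A\<close>, whose values outside
  \<open>S\<close> are irrelevant.\<close>

definition resolvent :: "'a::complex_inner set \<Rightarrow> ('a \<Rightarrow> 'a) \<Rightarrow> complex \<Rightarrow> 'a \<Rightarrow> 'a" where
  "resolvent S A l = inv_into S (\<lambda>x. A x - l *\<^sub>C x)"

definition resolvent_set :: "'a::complex_inner set \<Rightarrow> ('a \<Rightarrow> 'a) \<Rightarrow> complex set" where
  "resolvent_set S A =
    {l. bij_betw (\<lambda>x. A x - l *\<^sub>C x) S UNIV \<and> bounded_linear (resolvent S A l)}"

definition compact_operator :: "('a::real_normed_vector \<Rightarrow> 'b::real_normed_vector) \<Rightarrow> bool" where
  "compact_operator T \<longleftrightarrow> bounded_linear T \<and> compact (closure (T ` cball 0 1))"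

text \<open>By the resolvent identity, compactness of the resolvent at one point of the resolvent set
  implies compactness at every point.\<close>

definition has_compact_resolvent :: "'a::complex_inner set \<Rightarrow> ('a \<Rightarrow> 'a) \<Rightarrow> bool" where
  "has_compact_resolvent S A \<longleftrightarrow>
    (\<exists>l\<in>resolvent_set S A. compact_operator (resolvent S A l))"

definition op_kernel :: "'a::complex_inner set \<Rightarrow> ('a \<Rightarrow> 'a) \<Rightarrow> 'a set" where
  "op_kernel S A = {x \<in> S. A x = 0}"

definition ortho_compl :: "'a::complex_inner set \<Rightarrow> 'a set" where
  "ortho_compl K = {x. \<forall>k\<in>K. cinner x k = 0}"

text \<open>The inverse on the orthogonal complement of the kernel, extended by 0 on the kernel:
  \<open>y = (y - k) + k\<close> is the orthogonal decomposition of the argument.\<close>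

definition reduced_inverse :: "'a::complex_inner set \<Rightarrow> ('a \<Rightarrow> 'a) \<Rightarrow> 'a \<Rightarrow> 'a" where
  "reduced_inverse S A y =
    (THE x. x \<in> S \<inter> ortho_compl (op_kernel S A) \<and>
      (\<exists>k\<in>op_kernel S A. y - k \<in> ortho_compl (op_kernel S A) \<and> A x = y - k))"


section \<open>Differentiation on the circle\<close>

text \<open>The derivative \<open>d/dz\<close> along the circle, i.e. the limit of \<open>(u w - u z) / (w - z)\<close> as \<open>w\<close>
  tends to \<open>z\<close> within the circle; in the coordinate \<open>z = exp (\<i> \<theta>)\<close> it is
  \<open>(1 / (\<i> z)) d/d\<theta>\<close>.\<close>

definition circle_deriv :: "(complex \<Rightarrow> complex) \<Rightarrow> complex \<Rightarrow> complex" where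
  "circle_deriv u z = (THE d. (u has_field_derivative d) (at z within circle))"

definition circle_smooth :: "(complex \<Rightarrow> complex) \<Rightarrow> bool" where
  "circle_smooth u \<longleftrightarrow>
    (\<forall>k. \<forall>z\<in>circle. (circle_deriv ^^ k) u field_differentiable (at z within circle))"

definition absolutely_continuous_on_Icc ::
    "real \<Rightarrow> real \<Rightarrow> (real \<Rightarrow> 'a::metric_space) \<Rightarrow> bool" where
  "absolutely_continuous_on_Icc p q g \<longleftrightarrow>
    (\<forall>e>0. \<exists>d>0. \<forall>I :: (real \<times> real) set.
      finite I \<and> (\<forall>(a, b)\<in>I. p \<le> a \<and> a \<le> b \<and> b \<le> q) \<and>
      disjoint_family_on (\<lambda>(a, b). {a<..<b}) I \<and> (\<Sum>(a, b)\<in>I. b - a) < d \<longrightarrow>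
      (\<Sum>(a, b)\<in>I. dist (g a) (g b)) < e)"

definition circle_abs_continuous :: "(complex \<Rightarrow> complex) \<Rightarrow> bool" where
  "circle_abs_continuous u \<longleftrightarrow> absolutely_continuous_on_Icc 0 1 (\<lambda>t. u (cis (2 * pi * t)))"

text \<open>\<open>H1_deriv x y\<close>: the class \<open>x\<close> has an absolutely continuous representative whose (almost
  everywhere existing) derivative is square integrable with class \<open>y\<close>.\<close>

definition H1_deriv :: "circle_L2 \<Rightarrow> circle_L2 \<Rightarrow> bool" where
  "H1_deriv x y \<longleftrightarrow>
    (\<exists>u v. square_integrable u \<and> abs_circle_L2 u = x \<and> square_integrable v \<and> abs_circle_L2 v = y \<and>
      circle_abs_continuous u \<and>
      (AE z in circle_measure. (u has_field_derivative v z) (at z within circle)))"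

definition H1 :: "circle_L2 set" where
  "H1 = {x. \<exists>y. H1_deriv x y}"

definition L2_deriv :: "circle_L2 \<Rightarrow> circle_L2" where
  "L2_deriv x = (THE y. H1_deriv x y)"

definition mult_op :: "(complex \<Rightarrow> complex) \<Rightarrow> circle_L2 \<Rightarrow> circle_L2" where
  "mult_op g x = abs_circle_L2 (\<lambda>z. g z * rep_circle_L2 x z)"


section \<open>Circle diffeomorphisms\<close>

text \<open>Circle maps are functions on all of \<open>\<complex>\<close> of which only the values on the circle matter.\<close>

definition circle_diffeo :: "(complex \<Rightarrow> complex) \<Rightarrow> bool" where
  "circle_diffeo f \<longleftrightarrow>
    bij_betw f circle circle \<and> circle_smooth f \<and> circle_smooth (inv_into circle f)"

definition circle_lift :: "(complex \<Rightarrow> complex) \<Rightarrow> (real \<Rightarrow> real) \<Rightarrow> bool" where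
  "circle_lift f F \<longleftrightarrow>
    continuous_on UNIV F \<and> (\<forall>t. f (cis (2 * pi * t)) = cis (2 * pi * F t))"

definition orientation_preserving :: "(complex \<Rightarrow> complex) \<Rightarrow> bool" where
  "orientation_preserving f \<longleftrightarrow> (\<exists>F. circle_lift f F \<and> strict_mono F)"

text \<open>The rotation number is an element of \<open>\<real>/\<int>\<close>; \<open>r\<close> is one of its representatives.\<close>

definition has_rotation_number :: "(complex \<Rightarrow> complex) \<Rightarrow> real \<Rightarrow> bool" where
  "has_rotation_number f r \<longleftrightarrow>
    (\<exists>F s. circle_lift f F \<and> (\<forall>t. (\<lambda>n. (F ^^ n) t / real n) \<longlonglongrightarrow> s) \<and> s - r \<in> \<int>)"

definition circle_iter :: "(complex \<Rightarrow> complex) \<Rightarrow> int \<Rightarrow> complex \<Rightarrow> complex" where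
  "circle_iter f n = (if 0 \<le> n then f ^^ nat n else inv_into circle f ^^ nat (- n))"

definition growth_seq :: "(complex \<Rightarrow> complex) \<Rightarrow> nat \<Rightarrow> real" where
  "growth_seq f n =
    max (SUP z\<in>circle. cmod (circle_deriv (circle_iter f (int n)) z))
        (SUP z\<in>circle. cmod (circle_deriv (circle_iter f (- int n)) z))"


section \<open>The deformed Dirac operator\<close>

definition delta :: "(complex \<Rightarrow> complex) \<Rightarrow> int \<Rightarrow> complex \<Rightarrow> complex" where
  "delta f n z = z * circle_deriv (circle_iter f n) z / circle_iter f n z"

definition L_op :: "int \<Rightarrow> circle_L2 \<Rightarrow> circle_L2" where
  "L_op n x = mult_op (\<lambda>z. \<i> * z) (L2_deriv x) - of_int n *\<^sub>C x"

text \<open>The adjoint of \<open>L_n = \<i> z d/dz - n\<close> is \<open>- \<i> z d/dz - n\<close>, again with domain \<open>H1\<close>.\<close>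

definition L_adj :: "int \<Rightarrow> circle_L2 \<Rightarrow> circle_L2" where
  "L_adj n x = - mult_op (\<lambda>z. \<i> * z) (L2_deriv x) - of_int n *\<^sub>C x"

definition dirac_comp ::
    "(complex \<Rightarrow> complex) \<Rightarrow> int \<Rightarrow> circle_L2 \<times> circle_L2 \<Rightarrow> circle_L2 \<times> circle_L2" where
  "dirac_comp f n x =
    (mult_op (\<lambda>z. inverse (delta f n z)) (L_op n (snd x)),
     L_adj n (mult_op (\<lambda>z. inverse (delta f n z)) (fst x)))"

definition dirac_comp_inverse ::
    "(complex \<Rightarrow> complex) \<Rightarrow> int \<Rightarrow> circle_L2 \<times> circle_L2 \<Rightarrow> circle_L2 \<times> circle_L2" where
  "dirac_comp_inverse f n =
    (if n = 0 then reduced_inverse (H1 \<times> H1) (dirac_comp f n)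
     else inv_into (H1 \<times> H1) (dirac_comp f n))"

type_synonym dirac_space = "(int, circle_L2 \<times> circle_L2) hilbert_sum"

definition dirac_domain :: "(complex \<Rightarrow> complex) \<Rightarrow> dirac_space set" where
  "dirac_domain f =
    {x. (\<forall>n. component x n \<in> H1 \<times> H1) \<and>
        (\<lambda>n. (norm (dirac_comp f n (component x n)))\<^sup>2) summable_on UNIV}"

definition dirac :: "(complex \<Rightarrow> complex) \<Rightarrow> dirac_space \<Rightarrow> dirac_space" where
  "dirac f x = Abs_hilbert_sum (\<lambda>n. dirac_comp f n (component x n))"

end

theory Submission
  imports Defs "HOL-Complex_Analysis.Great_Picard"
begin

text \<open>Let \<open>K\<^sub>s\<close> denote the inverse of \<open>d/d\<theta> - s\<close> on periodic Sobolev functions, for real \<open>s \<noteq> 0\<close>. As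
  \<open>d/d\<theta>\<close> is skew-symmetric, \<open>K\<^sub>s\<close> has norm at most \<open>1 / \<bar>s\<bar>\<close>; and it is compact, since its range
  consists of functions with square integrable derivatives, to which Arzela-Ascoli applies. For
  \<open>n \<noteq> 0\<close> the component \<open>D\<^sub>n\<close> has the inverse
  \<open>(y\<^sub>1, y\<^sub>2) \<mapsto> (- \<delta>\<^sub>n K\<^sub>-\<^sub>n y\<^sub>2, K\<^sub>n (\<delta>\<^sub>n y\<^sub>1))\<close>, which is therefore compact of norm at most
  \<open>sup \<bar>\<delta>\<^sub>n\<bar> / \<bar>n\<bar>\<close>; this gives the growth criterion because \<open>\<bar>\<delta>\<^sub>n\<bar> = \<bar>D f\<^sup>n\<bar>\<close> on the circle. A block
  diagonal operator with compact blocks is compact iff the norms of the blocks tend to \<open>0\<close>. Apply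
  this to the resolvent; if its blocks or the operators \<open>D\<^sub>n\<^sup>-\<^sup>1\<close> tend to \<open>0\<close> in norm, then so do the
  others, as the two differ by a Neumann series.\<close>

section \<open>Absolutely continuous functions\<close>

text \<open>Membership in \<open>H1\<close> means an absolutely continuous representative with an
  almost everywhere derivative. Hence skew-symmetry of \<open>d/d\<theta>\<close>, an integration
  over one period, rests on the fundamental theorem of calculus for absolutely continuous functions,
  and the existence of \<open>K\<^sub>s\<close> on the converse facts about indefinite integrals.
  The block n = 0 shapes the choice of the resolvent point: \<open>d/d\<theta>\<close> kills the
  constants, so \<open>D\<^sub>0\<close> has no inverse and the point 0 is excluded. At the
  imaginary point \<open>\<i> t\<close> the antidiagonal block \<open>D\<^sub>0\<close> decouples
  into \<open>d/d\<theta>\<close> shifted by the real numbers t and -t, and there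
  \<open>K\<^sub>s\<close> exists again; t is then shrunk until the other blocks follow by a
  perturbation of their inverses. In the opposite direction the resolvent point l is given and may
  be anywhere. There only a lower bound for \<open>D\<^sub>n - l\<close> is extracted, valid for all
  but finitely many n, and the contribution of l is absorbed into the left-hand side.\<close>

definition small_intervals :: "real \<Rightarrow> real \<Rightarrow> real \<Rightarrow> (real \<times> real) set \<Rightarrow> bool" where
  "small_intervals p q d I \<longleftrightarrow> finite I \<and> (\<forall>(a, b)\<in>I. p \<le> a \<and> a \<le> b \<and> b \<le> q) \<and>
      disjoint_family_on (\<lambda>(a, b). {a<..<b}) I \<and> (\<Sum>(a, b)\<in>I. b - a) < d"

lemma absolutely_continuous_on_Icc_iff:
  "absolutely_continuous_on_Icc p q g \<longleftrightarrow>
    (\<forall>e>0. \<exists>d>0. \<forall>I. small_intervals p q d I \<longrightarrow> (\<Sum>(a, b)\<in>I. dist (g a) (g b)) < e)"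
  by (simp add: absolutely_continuous_on_Icc_def small_intervals_def)

lemma absolutely_continuous_onD:
  assumes "absolutely_continuous_on_Icc p q g" "0 < e"
  obtains d where "0 < d"
    "\<And>I. small_intervals p q d I \<Longrightarrow> (\<Sum>(a, b)\<in>I. dist (g a) (g b)) < e"
  using assms unfolding absolutely_continuous_on_Icc_iff by meson

lemma absolutely_continuous_onI:
  assumes "\<And>e. 0 < e \<Longrightarrow> \<exists>d>0. \<forall>I. small_intervals p q d I \<longrightarrow> (\<Sum>(a, b)\<in>I. dist (g a) (g b)) < e"
  shows "absolutely_continuous_on_Icc p q g"
  using assms unfolding absolutely_continuous_on_Icc_iff by blast

lemma absolutely_continuous_on_Icc_subset:
  assumes "absolutely_continuous_on_Icc p q g" "p \<le> p'" "q' \<le> q"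
  shows "absolutely_continuous_on_Icc p' q' g"
proof -
  have "small_intervals p q d I" if "small_intervals p' q' d I" for d I
    using that assms(2,3) unfolding small_intervals_def by fastforce
  with assms(1) show ?thesis unfolding absolutely_continuous_on_Icc_iff by meson
qed

lemma absolutely_continuous_imp_continuous:
  assumes "absolutely_continuous_on_Icc p q g"
  shows "continuous_on {p..q} g"
  unfolding continuous_on_iff
proof (intro ballI allI impI)
  fix x e :: real assume x: "x \<in> {p..q}" and "0 < e"
  obtain d where "d > 0" and d: "\<And>I. small_intervals p q d I \<Longrightarrow> (\<Sum>(a, b)\<in>I. dist (g a) (g b)) < e"
    using absolutely_continuous_onD[OF assms \<open>0 < e\<close>] by blast
  have "dist (g y) (g x) < e" if "y \<in> {p..q}" "dist y x < d" for y
    using d[of "{(min x y, max x y)}"] x that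
    by (cases "x \<le> y")
      (auto simp: small_intervals_def disjoint_family_on_def dist_real_def dist_commute)
  with \<open>d > 0\<close> show "\<exists>d>0. \<forall>x'\<in>{p..q}. dist x' x < d \<longrightarrow> dist (g x') (g x) < e" by blast
qed

text \<open>A single comparison of increments carries all closure properties used later: sums,
  products, conjugates, Lipschitz functions, and functions that agree on the interval with an
  absolutely continuous one.\<close>

lemma absolutely_continuous_combine:
  assumes f: "absolutely_continuous_on_Icc p q f" and g: "absolutely_continuous_on_Icc p q g"
    and h: "\<And>a b. p \<le> a \<Longrightarrow> a \<le> b \<Longrightarrow> b \<le> q \<Longrightarrow>
      dist (h a) (h b) \<le> M * (dist (f a) (f b) + dist (g a) (g b))"
  shows "absolutely_continuous_on_Icc p q h"
proof (rule absolutely_continuous_onI)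
  fix e :: real assume "e > 0"
  \<comment> \<open>\<open>\<bar>M\<bar> + 1\<close> is positive whatever the sign of
    \<open>M\<close>; the factor 2 shares \<open>e\<close> between \<open>f\<close> and
    \<open>g\<close>.\<close>
  define e' where "e' = e / (2 * (\<bar>M\<bar> + 1))"
  have "e' > 0" using \<open>e > 0\<close> by (simp add: e'_def add_nonneg_pos)
  obtain d1 where "d1 > 0" and d1: "\<And>I. small_intervals p q d1 I \<Longrightarrow> (\<Sum>(a, b)\<in>I. dist (f a) (f b)) < e'"
    using absolutely_continuous_onD[OF f \<open>e' > 0\<close>] by blast
  obtain d2 where "d2 > 0" and d2: "\<And>I. small_intervals p q d2 I \<Longrightarrow> (\<Sum>(a, b)\<in>I. dist (g a) (g b)) < e'"
    using absolutely_continuous_onD[OF g \<open>e' > 0\<close>] by blast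
  show "\<exists>d>0. \<forall>I. small_intervals p q d I \<longrightarrow> (\<Sum>(a, b)\<in>I. dist (h a) (h b)) < e"
  proof (intro exI[of _ "min d1 d2"] conjI allI impI)
    fix I assume I: "small_intervals p q (min d1 d2) I"
    have F: "(\<Sum>(a, b)\<in>I. dist (f a) (f b)) < e'"
      by (rule d1) (use I in \<open>simp add: small_intervals_def\<close>)
    have G: "(\<Sum>(a, b)\<in>I. dist (g a) (g b)) < e'"
      by (rule d2) (use I in \<open>simp add: small_intervals_def\<close>)
    have "(\<Sum>(a, b)\<in>I. dist (h a) (h b))
        \<le> (\<Sum>(a, b)\<in>I. (\<bar>M\<bar> + 1) * (dist (f a) (f b) + dist (g a) (g b)))"
    proof (intro sum_mono, clarify)
      fix a b assume "(a, b) \<in> I"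
      with I have "dist (h a) (h b) \<le> M * (dist (f a) (f b) + dist (g a) (g b))"
        by (intro h) (auto simp: small_intervals_def)
      also have "\<dots> \<le> (\<bar>M\<bar> + 1) * (dist (f a) (f b) + dist (g a) (g b))"
        by (intro mult_right_mono) auto
      finally show "dist (h a) (h b) \<le> (\<bar>M\<bar> + 1) * (dist (f a) (f b) + dist (g a) (g b))" .
    qed
    also have "\<dots> = (\<bar>M\<bar> + 1) * ((\<Sum>(a, b)\<in>I. dist (f a) (f b)) + (\<Sum>(a, b)\<in>I. dist (g a) (g b)))"
      by (simp add: sum.distrib[symmetric] sum_distrib_left case_prod_unfold)
    also have "\<dots> < (\<bar>M\<bar> + 1) * (e' + e')"
      using F G by (intro mult_strict_left_mono add_strict_mono) auto
    also have "\<dots> = 2 * (\<bar>M\<bar> + 1) * e'" by (simp add: algebra_simps)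
    also have "\<dots> = e"
      unfolding e'_def using abs_ge_zero[of M] by (simp add: add_nonneg_eq_0_iff)
    finally show "(\<Sum>(a, b)\<in>I. dist (h a) (h b)) < e" .
  qed (use \<open>d1 > 0\<close> \<open>d2 > 0\<close> in auto)
qed

lemma lipschitz_imp_absolutely_continuous:
  assumes "\<And>a b. p \<le> a \<Longrightarrow> a \<le> b \<Longrightarrow> b \<le> q \<Longrightarrow> dist (h a) (h b) \<le> M * (b - a)"
  shows "absolutely_continuous_on_Icc p q h"
\<comment> \<open>The identity occupies both places, so its increment is counted twice; hence the
  constant \<open>M / 2\<close> below.\<close>
proof (rule absolutely_continuous_combine[where f = "\<lambda>t. t" and g = "\<lambda>t. t"])
  show "absolutely_continuous_on_Icc p q (\<lambda>t::real. t)"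
  proof (rule absolutely_continuous_onI)
    fix e :: real assume "0 < e"
    have "(\<Sum>(a, b)\<in>I. dist a b) = (\<Sum>(a, b)\<in>I. b - a)" if "small_intervals p q e I" for I
      using that by (intro sum.cong) (auto simp: dist_real_def small_intervals_def)
    with \<open>0 < e\<close>
    show "\<exists>d>0. \<forall>I. small_intervals p q d I \<longrightarrow> (\<Sum>(a, b)\<in>I. dist a b) < e"
      by (intro exI[of _ e]) (simp add: small_intervals_def)
  qed
  then show "absolutely_continuous_on_Icc p q (\<lambda>t::real. t)" .
  show "dist (h a) (h b) \<le> (M / 2) * (dist a b + dist a b)" if "p \<le> a" "a \<le> b" "b \<le> q" for a b
    using assms[OF that] that by (simp add: dist_real_def algebra_simps)
qed

lemma absolutely_continuous_bounded:
  fixes g :: "real \<Rightarrow> 'a::real_normed_vector"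
  assumes "absolutely_continuous_on_Icc p q g"
  shows "\<exists>B\<ge>0. \<forall>t\<in>{p..q}. norm (g t) \<le> B"
proof -
  have "bounded (g ` {p..q})"
    by (intro compact_imp_bounded compact_continuous_image
        absolutely_continuous_imp_continuous[OF assms]) simp
  then obtain B where "B > 0" "\<forall>x\<in>g ` {p..q}. norm x \<le> B"
    unfolding bounded_pos by blast
  then show ?thesis by (intro exI[of _ B] conjI ballI) (simp_all add: less_imp_le)
qed

lemma absolutely_continuous_mult:
  fixes f g :: "real \<Rightarrow> 'a::real_normed_algebra"
  assumes f: "absolutely_continuous_on_Icc p q f" and g: "absolutely_continuous_on_Icc p q g"
  shows "absolutely_continuous_on_Icc p q (\<lambda>t. f t * g t)"
proof -
  obtain A where A: "0 \<le> A" "\<forall>t\<in>{p..q}. norm (f t) \<le> A"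
    using absolutely_continuous_bounded[OF f] by blast
  obtain B where B: "0 \<le> B" "\<forall>t\<in>{p..q}. norm (g t) \<le> B"
    using absolutely_continuous_bounded[OF g] by blast
  show ?thesis
  proof (rule absolutely_continuous_combine[OF f g, where M = "A + B"])
    fix a b assume ab: "p \<le> a" "a \<le> b" "b \<le> q"
    have "f a * g a - f b * g b = (f a - f b) * g a + f b * (g a - g b)"
      by (simp add: algebra_simps)
    then have "dist (f a * g a) (f b * g b) \<le> norm ((f a - f b) * g a) + norm (f b * (g a - g b))"
      by (metis dist_norm norm_triangle_ineq)
    also have "\<dots> \<le> dist (f a) (f b) * B + A * dist (g a) (g b)"
      unfolding dist_norm
      by (intro add_mono order_trans[OF norm_mult_ineq] mult_mono) (use ab A B in auto)
    also have "\<dots> \<le> (A + B) * (dist (f a) (f b) + dist (g a) (g b))"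
      using A(1) B(1) by (simp add: algebra_simps)
    finally show "dist (f a * g a) (f b * g b) \<le> (A + B) * (dist (f a) (f b) + dist (g a) (g b))" .
  qed
qed

lemma absolutely_continuous_add:
  fixes f g :: "real \<Rightarrow> 'a::real_normed_vector"
  assumes "absolutely_continuous_on_Icc p q f" "absolutely_continuous_on_Icc p q g"
  shows "absolutely_continuous_on_Icc p q (\<lambda>t. f t + g t)"
  by (rule absolutely_continuous_combine[OF assms, where M = 1])
    (metis dist_triangle_add mult_1)

section \<open>Integrals of almost everywhere derivatives, and derivatives of integrals\<close>

text \<open>The gauge that witnesses integrability comes from differentiability at the points outside
  \<open>N\<close>, and from an open neighbourhood of \<open>N\<close> of small measure at the points of \<open>N\<close>.\<close>

lemma fundamental_theorem_of_calculus_absolutely_continuous: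
  fixes f v :: "real \<Rightarrow> 'a::banach"
  assumes ac: "absolutely_continuous_on_Icc a b f" and "a \<le> b" and N: "negligible N"
    and der: "\<And>t. t \<in> {a..b} - N \<Longrightarrow> (f has_vector_derivative v t) (at t within {a..b})"
  shows "(v has_integral (f b - f a)) {a..b}"
proof -
  \<comment> \<open>Nothing is known about \<open>v\<close> on \<open>N\<close>. Setting it to 0
    there leaves the integral unchanged and removes its values from the Riemann sums at tags in
    \<open>N\<close>.\<close>
  define w where "w = (\<lambda>t. if t \<in> N then 0 else v t)"
  have "(w has_integral (f b - f a)) (cbox a b)"
    unfolding has_integral
  proof (intro allI impI)
    fix e :: real assume "e > 0"
    define e' where "e' = e / (2 * (b - a + 1))"
    have "e' > 0" using \<open>e > 0\<close> \<open>a \<le> b\<close> by (simp add: e'_def)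
    have "\<exists>d>0. t \<in> {a..b} - N \<longrightarrow> (\<forall>y\<in>{a..b}. \<bar>y - t\<bar> < d \<longrightarrow>
        norm (f y - f t - (y - t) *\<^sub>R v t) \<le> e' * \<bar>y - t\<bar>)" for t
    proof (cases "t \<in> {a..b} - N")
      case True
      from der[OF this] \<open>e' > 0\<close> show ?thesis
        unfolding has_vector_derivative_def has_derivative_within_alt by auto
    next
      case False then show ?thesis by (auto intro: exI[of _ 1])
    qed
    then obtain d where d_pos: "\<And>t. d t > 0" and d: "\<And>t y. t \<in> {a..b} - N \<Longrightarrow> y \<in> {a..b} \<Longrightarrow>
        \<bar>y - t\<bar> < d t \<Longrightarrow> norm (f y - f t - (y - t) *\<^sub>R v t) \<le> e' * \<bar>y - t\<bar>" by metis
    have "e / 2 > 0" using \<open>e > 0\<close> by simp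
    obtain r where "r > 0" and r: "\<And>I. small_intervals a b r I \<Longrightarrow> (\<Sum>(a, b)\<in>I. dist (f a) (f b)) < e / 2"
    using absolutely_continuous_onD[OF ac \<open>e / 2 > 0\<close>] by blast
    have Nnull: "N \<in> null_sets lebesgue" using N by (simp add: negligible_iff_null_sets)
    then obtain T where T: "open T" "N \<subseteq> T" "T - N \<in> lmeasurable"
      "emeasure lebesgue (T - N) < ennreal r"
      using sets_lebesgue_outer_open[of N r] \<open>r > 0\<close> by auto
    have "T = (T - N) \<union> N" using T by auto
    then have Tm: "emeasure lebesgue T < ennreal r"
      using T emeasure_Un_null_set[of "T - N" lebesgue N] Nnull by (metis fmeasurableD)
    define \<gamma> where "\<gamma> = (\<lambda>t. if t \<in> N then T else ball t (d t))"
    have "gauge \<gamma>"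
      unfolding gauge_def \<gamma>_def using T d_pos by auto
    moreover have "norm ((\<Sum>(x, k)\<in>p. measure lborel k *\<^sub>R w x) - (f b - f a)) < e"
      if p: "p tagged_division_of cbox a b" and fine: "\<gamma> fine p" for p
    proof -
      note pD = tagged_division_ofD[OF p]
      have kD: "\<exists>c d. k = {c..d} \<and> a \<le> c \<and> c \<le> x \<and> x \<le> d \<and> d \<le> b" if "(x, k) \<in> p" for x k
        using pD(2-4)[OF that] by fastforce
      have k: "k = {Inf k..Sup k}" "a \<le> Inf k" "Inf k \<le> x" "x \<le> Sup k" "Sup k \<le> b"
        "measure lborel k = Sup k - Inf k" "interior k = {Inf k<..<Sup k}"
        if "(x, k) \<in> p" for x k
        using kD[OF that] by auto
      define p1 where "p1 = {(x, k). (x, k) \<in> p \<and> x \<notin> N}"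
      define p2 where "p2 = {(x, k). (x, k) \<in> p \<and> x \<in> N}"
      \<comment> \<open>Absolute continuity sums over a set of endpoint pairs, so different tagged
        intervals must have different endpoints. Disjoint interiors guarantee this for nondegenerate
        intervals only; the degenerate ones contribute 0 and are dropped.\<close>
      define q where "q = {(x, k). (x, k) \<in> p \<and> x \<in> N \<and> Inf k < Sup k}"
      have fin: "finite p" "finite p1" "finite p2" "finite q"
        using pD(1) unfolding p1_def p2_def q_def by (auto intro: finite_subset)
      have split: "p = p1 \<union> p2" "p1 \<inter> p2 = {}" by (auto simp: p1_def p2_def)
      have "(\<Sum>(x, k)\<in>p. measure lborel k *\<^sub>R w x) - (f b - f a)
          = (\<Sum>(x, k)\<in>p. measure lborel k *\<^sub>R w x - (f (Sup k) - f (Inf k)))"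
        using additive_tagged_division_1[OF \<open>a \<le> b\<close>, of p f] p
        by (simp add: sum_subtractf case_prod_unfold)
      also have "\<dots> = (\<Sum>(x, k)\<in>p1. measure lborel k *\<^sub>R w x - (f (Sup k) - f (Inf k)))
          + (\<Sum>(x, k)\<in>p2. measure lborel k *\<^sub>R w x - (f (Sup k) - f (Inf k)))"
        unfolding split(1) by (rule sum.union_disjoint) (use fin split in auto)
      finally have eq: "(\<Sum>(x, k)\<in>p. measure lborel k *\<^sub>R w x) - (f b - f a) = \<dots>" .
      have "norm (\<Sum>(x, k)\<in>p1. measure lborel k *\<^sub>R w x - (f (Sup k) - f (Inf k)))
          \<le> (\<Sum>(x, k)\<in>p1. e' * measure lborel k)"
      proof (rule sum_norm_le, clarify)
        fix x k assume xk: "(x, k) \<in> p1"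
        then have xp: "(x, k) \<in> p" and xN: "x \<notin> N" by (auto simp: p1_def)
        have "k \<subseteq> \<gamma> x" using fine xp by (auto simp: fine_def)
        then have sub: "k \<subseteq> ball x (d x)" using xN by (simp add: \<gamma>_def)
        have xab: "x \<in> {a..b} - N" using k[OF xp] xN by auto
        have mem: "Inf k \<in> k" "Sup k \<in> k" using k[OF xp] by (metis atLeastAtMost_iff order_trans order_refl)+
        have 1: "norm (f (Sup k) - f x - (Sup k - x) *\<^sub>R v x) \<le> e' * \<bar>Sup k - x\<bar>"
          by (rule d[OF xab]) (use k[OF xp] sub mem in \<open>auto simp: dist_real_def subset_eq abs_minus_commute\<close>)
        have 2: "norm (f (Inf k) - f x - (Inf k - x) *\<^sub>R v x) \<le> e' * \<bar>Inf k - x\<bar>"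
          by (rule d[OF xab]) (use k[OF xp] sub mem in \<open>auto simp: dist_real_def subset_eq abs_minus_commute\<close>)
        \<comment> \<open>Straddle estimate: the tag lies between the endpoints, so its distances to
          them add up to exactly the length of \<open>k\<close>, and the two linearisation errors
          sum to \<open>e'\<close> times that length.\<close>
        have "measure lborel k *\<^sub>R w x - (f (Sup k) - f (Inf k)) =
            (f (Inf k) - f x - (Inf k - x) *\<^sub>R v x) - (f (Sup k) - f x - (Sup k - x) *\<^sub>R v x)"
          using xN unfolding k(6)[OF xp] by (simp add: w_def algebra_simps)
        then have "norm (measure lborel k *\<^sub>R w x - (f (Sup k) - f (Inf k)))
            \<le> e' * \<bar>Inf k - x\<bar> + e' * \<bar>Sup k - x\<bar>"
          using 1 2 norm_triangle_ineq4 by (smt (verit))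
        also have "\<dots> = e' * measure lborel k"
          unfolding k(6)[OF xp] using k(3,4)[OF xp] by (simp add: algebra_simps)
        finally show "norm (measure lborel k *\<^sub>R w x - (f (Sup k) - f (Inf k))) \<le> e' * measure lborel k" .
      qed
      also have "\<dots> \<le> (\<Sum>(x, k)\<in>p. e' * measure lborel k)"
        using \<open>e' > 0\<close> fin split by (intro sum_mono2) (auto simp: case_prod_unfold)
      also have "\<dots> = e' * (b - a)"
        using additive_content_tagged_division[of p a b] p \<open>a \<le> b\<close>
        by (simp add: sum_distrib_left[symmetric] case_prod_unfold)
      also have "\<dots> < e / 2"
        using \<open>e > 0\<close> \<open>a \<le> b\<close> unfolding e'_def by (simp add: field_simps)
      finally have A: "norm (\<Sum>(x, k)\<in>p1. measure lborel k *\<^sub>R w x - (f (Sup k) - f (Inf k))) < e / 2" .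
      have "norm (\<Sum>(x, k)\<in>p2. measure lborel k *\<^sub>R w x - (f (Sup k) - f (Inf k)))
          \<le> (\<Sum>(x, k)\<in>p2. dist (f (Inf k)) (f (Sup k)))"
        by (rule sum_norm_le) (auto simp: p2_def w_def dist_norm norm_minus_commute)
      also have "\<dots> = (\<Sum>(x, k)\<in>q. dist (f (Inf k)) (f (Sup k)))"
      proof (rule sum.mono_neutral_right)
        show "\<forall>i\<in>p2 - q. (case i of (x, k) \<Rightarrow> dist (f (Inf k)) (f (Sup k))) = 0"
        proof clarify
          fix x k assume "(x, k) \<in> p2" "(x, k) \<notin> q"
          then have "Inf k = Sup k" using k(3,4)[of x k] by (auto simp: p2_def q_def)
          then show "dist (f (Inf k)) (f (Sup k)) = 0" by simp
        qed
      qed (use fin in \<open>auto simp: p2_def q_def\<close>)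
      also have "\<dots> = (\<Sum>(c, d)\<in>(\<lambda>(x, k). (Inf k, Sup k)) ` q. dist (f c) (f d))"
      proof (subst sum.reindex)
        show "inj_on (\<lambda>(x, k). (Inf k, Sup k)) q"
        proof (rule inj_onI, clarify)
          fix x k x' k' assume *: "(x, k) \<in> q" "(x', k') \<in> q" "Inf k = Inf k'" "Sup k = Sup k'"
          then have "(x, k) \<in> p" "(x', k') \<in> p" "Inf k < Sup k" by (auto simp: q_def)
          with pD(5)[of x k x' k'] k(7) * show "x = x' \<and> k = k'"
            by (metis Int_absorb dense Pair_inject empty_iff greaterThanLessThan_iff)
        qed
      qed (auto simp: case_prod_unfold intro!: sum.cong)
      also have "\<dots> < e / 2"
      proof (rule r)
        let ?I = "(\<lambda>(x, k). (Inf k, Sup k)) ` q"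
        have fI: "finite ?I" using fin by simp
        have ab: "a \<le> x \<and> x \<le> y \<and> y \<le> b" if "(x, y) \<in> ?I" for x y
          using that k unfolding q_def by fastforce
        have dis: "disjoint_family_on (\<lambda>(a, b). {a<..<b}) ?I"
          unfolding disjoint_family_on_def
        proof (intro ballI impI)
          fix i j assume ij: "i \<in> ?I" "j \<in> ?I" "i \<noteq> j"
          then obtain x k x' k' where xk: "(x, k) \<in> q" "(x', k') \<in> q"
            "i = (Inf k, Sup k)" "j = (Inf k', Sup k')" by auto
          with ij have "(x, k) \<in> p" "(x', k') \<in> p" "(x, k) \<noteq> (x', k')" by (auto simp: q_def)
          with pD(5)[of x k x' k'] k(7)[of x k] k(7)[of x' k'] xk
          show "(case i of (a, b) \<Rightarrow> {a<..<b}) \<inter> (case j of (a, b) \<Rightarrow> {a<..<b}) = {}" by simp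
        qed
        \<comment> \<open>The total length is the measure of a disjoint union. Fineness at tags in
          \<open>N\<close> puts that union inside \<open>T\<close>, whose measure is below
          \<open>r\<close>.\<close>
        have "(\<Sum>(c, d)\<in>?I. d - c) = (\<Sum>(c, d)\<in>?I. measure lebesgue {c<..<d})"
        proof (intro sum.cong refl, clarify)
          fix x k assume "(x, k) \<in> q"
          then show "Sup k - Inf k = measure lebesgue {Inf k<..<Sup k}"
            by (simp add: q_def)
        qed
        also have "\<dots> = measure lebesgue (\<Union>(c, d)\<in>?I. {c<..<d})"
        proof (subst measure_finite_Union[OF fI _ dis])
          show "(\<lambda>(a, b). {a<..<b}) ` ?I \<subseteq> sets lebesgue"
            by (intro image_subsetI) (simp add: case_prod_unfold)
          fix i :: "real \<times> real"
          have "emeasure lborel (box (fst i) (snd i)) \<noteq> \<infinity>"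
            using emeasure_lborel_box_finite[of "fst i" "snd i"] by simp
          then show "emeasure lebesgue (case i of (a, b) \<Rightarrow> {a<..<b}) \<noteq> \<infinity>"
            by (simp add: case_prod_unfold)
        qed (simp add: case_prod_unfold)
        also have "\<dots> < r"
        proof -
          have sub: "(\<Union>(c, d)\<in>?I. {c<..<d}) \<subseteq> T"
          proof clarify
            fix x k y assume xk: "(x, k) \<in> q" and y: "y \<in> {Inf k<..<Sup k}"
            then have "k \<subseteq> \<gamma> x" "x \<in> N" using fine by (auto simp: fine_def q_def)
            then have "k \<subseteq> T" by (simp add: \<gamma>_def)
            have xkp: "(x, k) \<in> p" using xk by (simp add: q_def)
            have "y \<in> {Inf k..Sup k}" using y by simp
            also have "\<dots> = k" using k(1)[OF xkp] by (rule sym)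
            finally show "y \<in> T" using \<open>k \<subseteq> T\<close> by (rule rev_subsetD)
          qed
          have "T \<in> sets lebesgue" using \<open>open T\<close> by simp
          then have "emeasure lebesgue (\<Union>(c, d)\<in>?I. {c<..<d}) \<le> emeasure lebesgue T"
            using sub by (rule emeasure_mono[rotated])
          then have lt: "emeasure lebesgue (\<Union>(c, d)\<in>?I. {c<..<d}) < ennreal r"
            using Tm by (rule le_less_trans)
          have "enn2real x < r" if "x < ennreal r" for x
            using that by (cases x) (auto simp: ennreal_less_iff)
          from this[OF lt] show ?thesis by (simp only: measure_def)
        qed
        finally show "small_intervals a b r ?I"
          unfolding small_intervals_def using fI ab dis by blast
      qed
      finally have B: "norm (\<Sum>(x, k)\<in>p2. measure lborel k *\<^sub>R w x - (f (Sup k) - f (Inf k))) < e / 2" .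
      show ?thesis unfolding eq by (rule norm_triangle_lt) (use A B in linarith)
    qed
    ultimately show "\<exists>\<gamma>. gauge \<gamma> \<and> (\<forall>\<D>. \<D> tagged_division_of cbox a b \<and> \<gamma> fine \<D> \<longrightarrow>
        norm ((\<Sum>(x, k)\<in>\<D>. measure lborel k *\<^sub>R w x) - (f b - f a)) < e)"
      by (intro exI[of _ \<gamma>]) (simp add: case_prod_unfold)
  qed
  then have "(w has_integral (f b - f a)) {a..b}" by simp
  then show ?thesis
    by (rule has_integral_spike[OF N, rotated]) (simp add: w_def)
qed

text \<open>Lebesgue differentiation on the line. \<open>integrable_ccontinuous_explicit\<close>
  controls averages over intervals to the right of a point; applied to the reflected function it
  controls those to the left, which explains the reflected exceptional set.\<close>

lemma indefinite_integral_has_vector_derivative: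
  fixes f :: "real \<Rightarrow> 'a::euclidean_space"
  assumes f: "f integrable_on {a..b}"
  obtains N where "negligible N" "\<And>t. t \<in> {a<..<b} - N \<Longrightarrow>
    ((\<lambda>u. integral {a..u} f) has_vector_derivative f t) (at t)"
proof -
  \<comment> \<open>Extension by 0 gives integrability on every interval, so that averages and the
    reflection make sense without regard to the endpoints.\<close>
  define g where "g = (\<lambda>t. if t \<in> {a..b} then f t else 0)"
  have "g integrable_on UNIV"
    unfolding g_def using f by (simp only: integrable_restrict_UNIV)
  then have g: "g integrable_on cbox c d" for c d
    by (rule integrable_on_subcbox) simp
  have gm: "(\<lambda>t. g (- t)) integrable_on cbox c d" for c d :: real
    using g[of "- d" "- c"]
      Henstock_Kurzweil_Integration.integrable_reflect_real[of g "- c" "- d"] by simp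
  obtain N1 where N1: "negligible N1" "\<And>x e. \<lbrakk>x \<notin> N1; 0 < e\<rbrakk> \<Longrightarrow>
      \<exists>d>0. \<forall>h. 0 < h \<and> h < d \<longrightarrow> norm (integral {x..x + h} g /\<^sub>R h - g x) < e"
    using integrable_ccontinuous_explicit[OF g] by (auto simp: scaleR_conv_of_real)
  obtain N2 where N2: "negligible N2" "\<And>x e. \<lbrakk>x \<notin> N2; 0 < e\<rbrakk> \<Longrightarrow>
      \<exists>d>0. \<forall>h. 0 < h \<and> h < d \<longrightarrow> norm (integral {x..x + h} (\<lambda>t. g (- t)) /\<^sub>R h - g (- x)) < e"
    using integrable_ccontinuous_explicit[OF gm] by (auto simp: scaleR_conv_of_real)
  show thesis
  proof
    show "negligible (N1 \<union> uminus ` N2)"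
      using N1(1) N2(1)
      by (intro negligible_Un negligible_differentiable_image_negligible) auto
    fix t assume t: "t \<in> {a<..<b} - (N1 \<union> uminus ` N2)"
    then have tN: "t \<notin> N1" "- t \<notin> N2" by force+
    have F: "integral {a..y} f - integral {a..x} f = integral {x..y} g"
      if "a \<le> x" "x \<le> y" "y \<le> b" for x y
    proof -
      have "integral {a..x} f + integral {x..y} f = integral {a..y} f"
        by (rule Henstock_Kurzweil_Integration.integral_combine)
          (use that in \<open>auto intro: integrable_on_subinterval[OF f]\<close>)
      moreover have "integral {x..y} g = integral {x..y} f"
        by (rule integral_cong) (use that in \<open>auto simp: g_def\<close>)
      ultimately show ?thesis by (simp add: algebra_simps)
    qed
    have gt: "g t = f t" using t by (simp add: g_def)
    show "((\<lambda>u. integral {a..u} f) has_vector_derivative f t) (at t)"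
      unfolding has_vector_derivative_def has_derivative_within_alt
    proof (intro conjI allI impI)
      fix e :: real assume "e > 0"
      obtain d1 where d1: "d1 > 0"
        "\<And>h. 0 < h \<Longrightarrow> h < d1 \<Longrightarrow> norm (integral {t..t + h} g /\<^sub>R h - g t) < e"
        using N1(2)[OF tN(1) \<open>e > 0\<close>] by blast
      obtain d2 where d2: "d2 > 0"
        "\<And>h. 0 < h \<Longrightarrow> h < d2 \<Longrightarrow> norm (integral {- t..- t + h} (\<lambda>t. g (- t)) /\<^sub>R h - g t) < e"
        using N2(2)[OF tN(2) \<open>e > 0\<close>] by auto
      have scale: "norm (I - h *\<^sub>R c) \<le> e * h" if "norm (I /\<^sub>R h - c) < e" "0 < h"
        for I c :: 'a and h :: real
      proof -
        have "I - h *\<^sub>R c = h *\<^sub>R (I /\<^sub>R h - c)"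
          using that by (simp add: algebra_simps)
        then show ?thesis using that by simp
      qed
      show "\<exists>d>0. \<forall>y\<in>UNIV. norm (y - t) < d \<longrightarrow>
        norm (integral {a..y} f - integral {a..t} f - (y - t) *\<^sub>R f t) \<le> e * norm (y - t)"
      proof (intro exI[of _ "min (min d1 d2) (min (t - a) (b - t))"] conjI ballI impI)
        fix y assume y: "norm (y - t) < min (min d1 d2) (min (t - a) (b - t))"
        consider "y = t" | "y > t" | "y < t" by linarith
        then show "norm (integral {a..y} f - integral {a..t} f - (y - t) *\<^sub>R f t) \<le> e * norm (y - t)"
        proof cases
          case 2
          then have "integral {a..y} f - integral {a..t} f = integral {t..t + (y - t)} g"
            using F[of t y] y by (simp add: abs_if split: if_splits)
          moreover have "norm (integral {t..t + (y - t)} g - (y - t) *\<^sub>R g t) \<le> e * (y - t)"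
            using 2 y by (intro scale d1) auto
          ultimately show ?thesis using 2 gt by simp
        next
          case 3
          have "integral {a..t} f - integral {a..y} f = integral {y..t} g"
            using F[of y t] y 3 by (simp add: abs_if split: if_splits)
          also have "\<dots> = integral {- t..- t + (t - y)} (\<lambda>t. g (- t))"
            using Henstock_Kurzweil_Integration.integral_reflect_real[of t y g] by simp
          finally have "integral {a..t} f - integral {a..y} f
              = integral {- t..- t + (t - y)} (\<lambda>t. g (- t))" .
          moreover have "norm (integral {- t..- t + (t - y)} (\<lambda>t. g (- t)) - (t - y) *\<^sub>R g t)
              \<le> e * (t - y)"
            using 3 y by (intro scale d2) auto
          ultimately have "norm (integral {a..t} f - integral {a..y} f - (t - y) *\<^sub>R f t) \<le> e * (t - y)"
            using gt by simp
          moreover have "integral {a..y} f - integral {a..t} f - (y - t) *\<^sub>R f t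
              = - (integral {a..t} f - integral {a..y} f - (t - y) *\<^sub>R f t)"
            by (simp add: algebra_simps)
          ultimately show ?thesis using 3 by (simp only: norm_minus_cancel) simp
        qed simp
      qed (use d1 d2 t in auto)
    qed (rule bounded_linear_scaleR_left)
  qed
qed

text \<open>Cauchy-Schwarz in the form of the arithmetic-geometric mean inequality with a free
  weight \<open>c\<close>. Unlike a product of square roots, the right-hand side is additive over
  disjoint sets, and each application chooses its own \<open>c\<close>.\<close>

lemma norm_integral_le_weighted_square:
  fixes v :: "real \<Rightarrow> 'a::euclidean_space"
  assumes v: "set_integrable lborel S v" and S: "S \<in> sets borel" "emeasure lborel S < \<infinity>"
    and v2: "set_integrable lborel S (\<lambda>t. (norm (v t))\<^sup>2)" and "c > 0"
  shows "norm (LINT t:S|lborel. v t)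
    \<le> (c * measure lborel S + (LINT t:S|lborel. (norm (v t))\<^sup>2) / c) / 2"
proof -
  have one: "set_integrable lborel S (\<lambda>t. c)"
    using S by (simp add: set_integrable_def)
  have "norm (LINT t:S|lborel. v t) \<le> (LINT t:S|lborel. norm (v t))"
    by (rule set_integral_norm_bound[OF v])
  also have "\<dots> \<le> (LINT t:S|lborel. (c + (norm (v t))\<^sup>2 / c) / 2)"
  proof (rule set_integral_mono)
    fix t
    have "0 \<le> (norm (v t) - c)\<^sup>2 / c" using \<open>c > 0\<close> by simp
    also have "\<dots> = (norm (v t))\<^sup>2 / c + c - 2 * norm (v t)"
      using \<open>c > 0\<close> by (simp add: power2_eq_square field_simps)
    finally show "norm (v t) \<le> (c + (norm (v t))\<^sup>2 / c) / 2" by simp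
  qed (use v v2 one in \<open>auto intro: set_integrable_norm set_integral_add\<close>)
  also have "\<dots> = (c * measure lborel S + (LINT t:S|lborel. (norm (v t))\<^sup>2) / c) / 2"
    using v2 one S by (simp add: set_integral_add) (simp add: set_lebesgue_integral_def mult.commute)
  finally show ?thesis .
qed

text \<open>The weighted estimate, summed over the intervals, gives half of \<open>c\<close> times
  the total length plus \<open>1 / c\<close> times the full square integral. A large
  \<open>c\<close> makes the second term small, after which a short total length handles the
  first.\<close>

lemma indefinite_integral_absolutely_continuous:
  fixes v :: "real \<Rightarrow> 'a::euclidean_space"
  assumes v: "set_integrable lborel {p..q} v"
    and v2: "set_integrable lborel {p..q} (\<lambda>t. (norm (v t))\<^sup>2)"
  shows "absolutely_continuous_on_Icc p q (\<lambda>t. integral {p..t} v)"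
proof (rule absolutely_continuous_onI)
  fix e :: real assume "e > 0"
  define B where "B = (LINT t:{p..q}|lborel. (norm (v t))\<^sup>2)"
  have "B \<ge> 0" unfolding B_def set_lebesgue_integral_def by (intro integral_nonneg_AE) auto
  \<comment> \<open>The \<open>+ 1\<close> makes \<open>c\<close> positive and
    \<open>B / c < e\<close> strict even for \<open>B = 0\<close>; total length below
    \<open>e / c\<close> then keeps the other term below \<open>e\<close>.\<close>
  define c where "c = (B + 1) / e"
  have "c > 0" using \<open>B \<ge> 0\<close> \<open>e > 0\<close> by (simp add: c_def)
  have BC: "B / c < e" using \<open>B \<ge> 0\<close> \<open>e > 0\<close> by (simp add: c_def field_simps)
  show "\<exists>d>0. \<forall>I. small_intervals p q d I \<longrightarrow>
      (\<Sum>(a, b)\<in>I. dist (integral {p..a} v) (integral {p..b} v)) < e"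
  proof (intro exI[of _ "e / c"] conjI allI impI)
    fix I assume I: "small_intervals p q (e / c) I"
    then have fin: "finite I" by (simp add: small_intervals_def)
    have sub: "set_integrable lborel {a<..<b} v" "set_integrable lborel {a<..<b} (\<lambda>t. (norm (v t))\<^sup>2)"
      if "(a, b) \<in> I" for a b
    proof -
      have "{a<..<b} \<subseteq> {p..q}" using I that by (auto simp: small_intervals_def)
      then show "set_integrable lborel {a<..<b} v"
        "set_integrable lborel {a<..<b} (\<lambda>t. (norm (v t))\<^sup>2)"
        by (auto intro: set_integrable_subset[OF v] set_integrable_subset[OF v2])
    qed
    have "(\<Sum>(a, b)\<in>I. dist (integral {p..a} v) (integral {p..b} v)) \<le>
      (\<Sum>(a, b)\<in>I. (c * (b - a) + (LINT t:{a<..<b}|lborel. (norm (v t))\<^sup>2) / c) / 2)"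
    proof (intro sum_mono, clarify)
      fix a b assume ab: "(a, b) \<in> I"
      then have le: "p \<le> a" "a \<le> b" "b \<le> q" using I by (auto simp: small_intervals_def)
      have vi: "v integrable_on {p..q}" using set_borel_integral_eq_integral(1)[OF v] .
      have "integral {p..a} v + integral {a..b} v = integral {p..b} v"
        by (rule Henstock_Kurzweil_Integration.integral_combine)
          (use le in \<open>auto intro: integrable_on_subinterval[OF vi]\<close>)
      then have "dist (integral {p..a} v) (integral {p..b} v) = norm (integral {a..b} v)"
        by (metis add_diff_cancel_left' dist_commute dist_norm)
      also have "integral {a..b} v = integral {a<..<b} v"
        by (rule integral_spike_set) (auto intro: negligible_subset[of "{a, b}"])
      also have "\<dots> = (LINT t:{a<..<b}|lborel. v t)"
        using set_borel_integral_eq_integral(2)[OF sub(1)[OF ab]] by simp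
      also have "norm \<dots> \<le> (c * measure lborel {a<..<b} + (LINT t:{a<..<b}|lborel. (norm (v t))\<^sup>2) / c) / 2"
        using sub[OF ab] \<open>c > 0\<close> emeasure_lborel_box_finite[of a b]
        by (intro norm_integral_le_weighted_square) (auto simp: box_real)
      finally show "dist (integral {p..a} v) (integral {p..b} v)
          \<le> (c * (b - a) + (LINT t:{a<..<b}|lborel. (norm (v t))\<^sup>2) / c) / 2"
        using le by simp
    qed
    also have "\<dots> = (c * (\<Sum>(a, b)\<in>I. b - a)
        + (\<Sum>(a, b)\<in>I. LINT t:{a<..<b}|lborel. (norm (v t))\<^sup>2) / c) / 2"
      by (simp add: sum_divide_distrib sum_distrib_left sum.distrib case_prod_unfold add_divide_distrib)
    also have "(\<Sum>(a, b)\<in>I. LINT t:{a<..<b}|lborel. (norm (v t))\<^sup>2) \<le> B"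
    proof -
      have "(\<Sum>(a, b)\<in>I. LINT t:{a<..<b}|lborel. (norm (v t))\<^sup>2)
          = (LINT t:(\<Union>(a, b)\<in>I. {a<..<b})|lborel. (norm (v t))\<^sup>2)"
        using fin I sub unfolding case_prod_unfold
        by (subst set_integral_finite_Union)
          (auto simp: small_intervals_def case_prod_unfold disjoint_family_on_def)
      also have "\<dots> \<le> B"
        unfolding B_def set_lebesgue_integral_def
      proof (rule integral_mono)
        have "(\<Union>(a, b)\<in>I. {a<..<b}) \<in> sets lborel" using fin by (auto simp: case_prod_unfold)
        moreover have sb: "(\<Union>(a, b)\<in>I. {a<..<b}) \<subseteq> {p..q}"
          using I by (fastforce simp: small_intervals_def)
        ultimately show "integrable lborel (\<lambda>t. indicat_real (\<Union>(a, b)\<in>I. {a<..<b}) t *\<^sub>R (norm (v t))\<^sup>2)"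
          using set_integrable_subset[OF v2] unfolding set_integrable_def by blast
        show "indicat_real (\<Union>(a, b)\<in>I. {a<..<b}) t *\<^sub>R (norm (v t))\<^sup>2
            \<le> indicat_real {p..q} t *\<^sub>R (norm (v t))\<^sup>2" for t
          using sb by (auto simp: indicator_def)
      qed (use v2 in \<open>simp add: set_integrable_def\<close>)
      finally show ?thesis .
    qed
    also have "(c * (\<Sum>(a, b)\<in>I. b - a) + B / c) / 2 < e"
    proof -
      have "(\<Sum>(a, b)\<in>I. b - a) < e / c" using I by (simp add: small_intervals_def)
      then have "c * (\<Sum>(a, b)\<in>I. b - a) < e" using \<open>c > 0\<close> by (simp add: field_simps)
      from add_strict_mono[OF this BC] show ?thesis by simp
    qed
    finally show "(\<Sum>(a, b)\<in>I. dist (integral {p..a} v) (integral {p..b} v)) < e"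
      using \<open>c > 0\<close> by (simp add: divide_right_mono)
  qed (use \<open>e > 0\<close> \<open>c > 0\<close> in simp)
qed

section \<open>Complex scalars in inner product spaces\<close>

lemma scaleC_simps [simp]:
  fixes x :: "'a::complex_inner"
  shows "c *\<^sub>C (0::'a) = 0" "0 *\<^sub>C x = 0" "1 *\<^sub>C x = x"
  using scaleC_add_right[of c "0::'a" 0] scaleC_add_left[of 0 0 x] scaleR_scaleC[of 1 x] by auto

lemma scaleC_minus_right: "c *\<^sub>C (- x) = - (c *\<^sub>C (x::'a::complex_inner))"
  using scaleC_add_right[of c x "- x"] by (simp add: add_eq_0_iff)

lemma scaleC_minus_left: "(- c) *\<^sub>C x = - (c *\<^sub>C (x::'a::complex_inner))"
  using scaleC_add_left[of c "- c" x] by (simp add: add_eq_0_iff)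

lemma scaleC_diff_right: "c *\<^sub>C (x - y) = c *\<^sub>C x - c *\<^sub>C (y::'a::complex_inner)"
  using scaleC_add_right[of c x "- y"] by (simp add: scaleC_minus_right)

lemma scaleC_scaleR: "c *\<^sub>C (r *\<^sub>R x) = r *\<^sub>R (c *\<^sub>C (x::'a::complex_inner))"
  by (simp add: scaleR_scaleC scaleC_scaleC mult.commute)

lemma bounded_linear_scaleC: "bounded_linear (\<lambda>x::'a::complex_inner. c *\<^sub>C x)"
  by (rule bounded_linear_intro[of _ "cmod c"])
    (auto simp: scaleC_add_right scaleC_scaleR norm_scaleC mult.commute)

section \<open>Compact operators\<close>

text \<open>A sequence in the closure is shadowed by one in \<open>S\<close> at distance below
  \<open>1 / (n + 1)\<close>; any subsequence along which the shadow converges also works for the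
  original.\<close>

lemma compact_closureI:
  fixes S :: "'a::metric_space set"
  assumes "\<And>g :: nat \<Rightarrow> 'a. (\<forall>k. g k \<in> S) \<Longrightarrow> \<exists>r l. strict_mono r \<and> (\<lambda>k. g (r k)) \<longlonglongrightarrow> l"
  shows "compact (closure S)"
  unfolding compact_eq_seq_compact_metric seq_compact_def
proof (intro allI impI)
  fix f :: "nat \<Rightarrow> 'a" assume f: "\<forall>n. f n \<in> closure S"
  have "\<exists>y\<in>S. dist y (f n) < 1 / real (Suc n)" for n
    using f by (auto simp: closure_approachable simp del: of_nat_Suc)
  then obtain g where g: "\<And>n. g n \<in> S" "\<And>n. dist (g n) (f n) < 1 / real (Suc n)" by metis
  obtain r l where r: "strict_mono r" and l: "(\<lambda>k. g (r k)) \<longlonglongrightarrow> l"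
    using assms[of g] g(1) by blast
  have inv: "(\<lambda>n. 1 / real (Suc n)) \<longlonglongrightarrow> 0"
    using LIMSEQ_inverse_real_of_nat by (simp add: inverse_eq_divide)
  have "(\<lambda>n. dist (g n) (f n)) \<longlonglongrightarrow> 0"
    by (rule tendsto_sandwich[OF _ _ tendsto_const inv];
        intro always_eventually allI less_imp_le[OF g(2)] zero_le_dist)
  from LIMSEQ_subseq_LIMSEQ[OF this r] have "(\<lambda>k. dist (g (r k)) (f (r k))) \<longlonglongrightarrow> 0"
    by (simp add: comp_def)
  from tendsto_add[OF this tendsto_dist[OF l tendsto_const[of l]]]
  have "(\<lambda>k. dist (g (r k)) (f (r k)) + dist (g (r k)) l) \<longlonglongrightarrow> 0" by simp
  then have "(\<lambda>k. dist (f (r k)) l) \<longlonglongrightarrow> 0"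
    by (rule tendsto_sandwich[OF _ _ tendsto_const, rotated 2])
      (intro always_eventually allI zero_le_dist dist_triangle3)+
  then have "(\<lambda>k. f (r k)) \<longlonglongrightarrow> l" by (rule iffD2[OF tendsto_dist_iff])
  moreover have "l \<in> closure S"
    unfolding closure_sequential using g(1) l by (intro exI[of _ "\<lambda>k. g (r k)"]) simp
  ultimately show "\<exists>l\<in>closure S. \<exists>r. strict_mono r \<and> (f \<circ> r) \<longlonglongrightarrow> l"
    using r by (auto simp: comp_def)
qed

lemma compact_operatorI:
  assumes "bounded_linear T"
    and "\<And>x :: nat \<Rightarrow> 'a::real_normed_vector. (\<And>k. norm (x k) \<le> 1) \<Longrightarrow>
      \<exists>r l. strict_mono r \<and> (\<lambda>k. T (x (r k))) \<longlonglongrightarrow> l"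
  shows "compact_operator T"
  unfolding compact_operator_def
proof
  show "compact (closure (T ` cball 0 1))"
  proof (rule compact_closureI)
    fix g :: "nat \<Rightarrow> 'b" assume "\<forall>k. g k \<in> T ` cball 0 1"
    then have "\<forall>k. \<exists>x. norm x \<le> 1 \<and> g k = T x"
      by (metis image_iff mem_cball_0)
    then obtain x where "\<And>k. norm (x k) \<le> 1" "\<And>k. g k = T (x k)" by metis
    then show "\<exists>r l. strict_mono r \<and> (\<lambda>k. g (r k)) \<longlonglongrightarrow> l" using assms(2)[of x] by simp
  qed
qed fact

lemma compact_operatorD:
  fixes x :: "nat \<Rightarrow> 'a::real_normed_vector"
  assumes T: "compact_operator T" and x: "\<And>k. norm (x k) \<le> B"
  shows "\<exists>r l. strict_mono r \<and> (\<lambda>k. T (x (r k))) \<longlonglongrightarrow> l"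
proof -
  interpret T: bounded_linear T using T by (simp add: compact_operator_def)
  define B' where "B' = \<bar>B\<bar> + 1"
  have B': "B' > 0" "\<And>k. norm (x k) \<le> B'"
    using order_trans[OF x abs_ge_self] by (auto simp: B'_def add_increasing2)
  have "T (x k /\<^sub>R B') \<in> closure (T ` cball 0 1)" for k
    using B'(1) B'(2)[of k] by (intro subsetD[OF closure_subset] imageI) (simp add: field_simps)
  moreover have "seq_compact (closure (T ` cball 0 1))"
    using T by (simp add: compact_operator_def compact_eq_seq_compact_metric)
  ultimately obtain r l where r: "strict_mono r" "((\<lambda>k. T (x k /\<^sub>R B')) \<circ> r) \<longlonglongrightarrow> l"
    unfolding seq_compact_def by metis
  from tendsto_scaleR[OF tendsto_const r(2), of B'] have "(\<lambda>k. T (x (r k))) \<longlonglongrightarrow> B' *\<^sub>R l"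
    using B'(1) by (simp add: comp_def T.scaleR)
  with r(1) show ?thesis by blast
qed

lemma compact_operator_bounded_linear: "compact_operator T \<Longrightarrow> bounded_linear T"
  by (simp add: compact_operator_def)

lemma compact_operator_compose_right:
  fixes Q :: "'a::real_normed_vector \<Rightarrow> 'b::real_normed_vector"
  assumes T: "compact_operator T" and Q: "bounded_linear Q"
  shows "compact_operator (\<lambda>x. T (Q x))"
proof (rule compact_operatorI)
  show "bounded_linear (\<lambda>x. T (Q x))"
    using bounded_linear_compose[OF compact_operator_bounded_linear[OF T] Q] .
  fix x :: "nat \<Rightarrow> 'a" assume x: "\<And>k. norm (x k) \<le> 1"
  obtain K where K: "\<And>x. norm (Q x) \<le> norm x * K" "0 \<le> K"
    using bounded_linear.nonneg_bounded[OF Q] by blast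
  have "norm (Q (x k)) \<le> K" for k
    using K(1)[of "x k"] mult_right_mono[OF x K(2), of k] by simp
  then show "\<exists>r l. strict_mono r \<and> (\<lambda>k. T (Q (x (r k)))) \<longlonglongrightarrow> l"
    by (rule compact_operatorD[OF T])
qed

lemma compact_operator_compose_left:
  fixes T :: "'a::real_normed_vector \<Rightarrow> 'b::real_normed_vector"
  assumes T: "compact_operator T" and Q: "bounded_linear Q"
  shows "compact_operator (\<lambda>x. Q (T x))"
proof (rule compact_operatorI)
  show "bounded_linear (\<lambda>x. Q (T x))"
    using bounded_linear_compose[OF Q compact_operator_bounded_linear[OF T]] .
  fix x :: "nat \<Rightarrow> 'a" assume x: "\<And>k. norm (x k) \<le> 1"
  obtain r l where "strict_mono r" "(\<lambda>k. T (x (r k))) \<longlonglongrightarrow> l"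
    using compact_operatorD[where x = x, OF T x] by (elim exE conjE) (rule that)
  then have "strict_mono r \<and> (\<lambda>k. Q (T (x (r k)))) \<longlonglongrightarrow> Q l"
    using bounded_linear.tendsto[OF Q] by simp
  then show "\<exists>r l. strict_mono r \<and> (\<lambda>k. Q (T (x (r k)))) \<longlonglongrightarrow> l"
    by (intro exI[of _ r] exI[of _ "Q l"])
qed

lemma compact_operator_add:
  fixes T :: "'a::real_normed_vector \<Rightarrow> 'b::real_normed_vector"
  assumes T: "compact_operator T" and Q: "compact_operator Q"
  shows "compact_operator (\<lambda>x. T x + Q x)"
proof (rule compact_operatorI)
  show "bounded_linear (\<lambda>x. T x + Q x)"
    by (rule bounded_linear_add[OF compact_operator_bounded_linear[OF T]
        compact_operator_bounded_linear[OF Q]])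
  fix x :: "nat \<Rightarrow> 'a" assume x: "\<And>k. norm (x k) \<le> 1"
  obtain r l where r: "strict_mono r" "(\<lambda>k. T (x (r k))) \<longlonglongrightarrow> l"
    using compact_operatorD[where x = x, OF T x] by (elim exE conjE) (rule that)
  obtain s m where s: "strict_mono s" "(\<lambda>k. Q (x (r (s k)))) \<longlonglongrightarrow> m"
    using compact_operatorD[OF Q, of "\<lambda>k. x (r k)", OF x]
    by (elim exE conjE) (rule that)
  have "(\<lambda>k. T (x (r (s k)))) \<longlonglongrightarrow> l"
    using LIMSEQ_subseq_LIMSEQ[OF r(2) s(1)] by (simp add: comp_def)
  from tendsto_add[OF this s(2)]
  show "\<exists>r l. strict_mono r \<and> (\<lambda>k. T (x (r k)) + Q (x (r k))) \<longlonglongrightarrow> l"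
    using strict_mono_o[OF r(1) s(1)]
    by (intro exI[of _ "r \<circ> s"] exI[of _ "l + m"]) (simp add: comp_def)
qed

lemma compact_operator_Pair:
  assumes T: "compact_operator T" and Q: "compact_operator Q"
  shows "compact_operator (\<lambda>x. (T x, Q x))"
proof -
  have "compact_operator (\<lambda>x. (T x, 0))" "compact_operator (\<lambda>x. (0, Q x))"
    by (rule compact_operator_compose_left[OF T] compact_operator_compose_left[OF Q];
        rule bounded_linear_Pair[OF bounded_linear_ident bounded_linear_zero]
          bounded_linear_Pair[OF bounded_linear_zero bounded_linear_ident])+
  from compact_operator_add[OF this] show ?thesis by simp
qed

section \<open>Inverting the identity minus a compact contraction\<close>

text \<open>No completeness is needed for this Neumann series: the iteration \<open>x \<mapsto> y + S x\<close> has a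
  convergent subsequence because \<open>S\<close> is compact.\<close>

lemma compact_contraction_surj:
  fixes S :: "'a::real_normed_vector \<Rightarrow> 'a"
  assumes S: "compact_operator S" and half: "\<And>x. norm (S x) \<le> norm x / 2"
  shows "\<exists>x. x - S x = y"
proof -
  interpret S: bounded_linear S using S by (simp add: compact_operator_def)
  define X where "X = rec_nat 0 (\<lambda>_ x. y + S x)"
  have X: "X 0 = 0" "\<And>k. X (Suc k) = y + S (X k)" by (simp_all add: X_def)
  have bound: "norm (X k) \<le> 2 * norm y" for k
  proof (induction k)
    case (Suc k)
    have "norm (X (Suc k)) \<le> norm y + norm (S (X k))" unfolding X by (rule norm_triangle_ineq)
    with Suc half[of "X k"] show ?case by linarith
  qed (simp add: X)
  have step: "norm (X (Suc k) - X k) \<le> norm y * (1 / 2) ^ k" for k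
  proof (induction k)
    case (Suc k)
    have "X (Suc (Suc k)) - X (Suc k) = S (X (Suc k) - X k)" by (simp add: X S.diff)
    with half[of "X (Suc k) - X k"] Suc show ?case by simp
  qed (simp add: X)
  have "(\<lambda>k. norm y * (1 / 2) ^ k) \<longlonglongrightarrow> 0"
    by (intro tendsto_mult_right_zero LIMSEQ_realpow_zero) auto
  then have diff0: "(\<lambda>k. X (Suc k) - X k) \<longlonglongrightarrow> 0"
    by (rule Lim_null_comparison[rotated]) (use step in auto)
  obtain r l where r: "strict_mono r" and l: "(\<lambda>k. S (X (r k))) \<longlonglongrightarrow> l"
    using compact_operatorD[where x = X, OF S bound] by (elim exE conjE) (rule that)
  \<comment> \<open>This expression is just \<open>X (r k)\<close>, written so that convergence of
    \<open>S (X (r k))\<close> and vanishing of the increments force convergence of the iterates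
    themselves. Their limit \<open>y + l\<close> is the fixed point.\<close>
  have "(\<lambda>k. (y + S (X (r k))) - (X (Suc (r k)) - X (r k))) \<longlonglongrightarrow> (y + l) - 0"
    using LIMSEQ_subseq_LIMSEQ[OF diff0 r] l by (intro tendsto_intros) (auto simp: comp_def)
  then have "(\<lambda>k. X (r k)) \<longlonglongrightarrow> y + l" by (simp add: X)
  from S.tendsto[OF this] l have "S (y + l) = l" using LIMSEQ_unique by blast
  then show ?thesis by (intro exI[of _ "y + l"]) simp
qed

text \<open>The lower bound \<open>norm x \<le> 2 * norm (x - S x)\<close> makes solutions unique,
  and uniqueness turns an arbitrary choice of solutions into a bounded linear map. The constant is
  \<open>1 / (1 - 1/2)\<close>.\<close>

lemma compact_contraction_inverse:
  fixes S :: "'a::real_normed_vector \<Rightarrow> 'a"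
  assumes S: "compact_operator S" and half: "\<And>x. norm (S x) \<le> norm x / 2"
  obtains Q where "bounded_linear Q" "\<And>y. Q y - S (Q y) = y" "\<And>x. Q (x - S x) = x"
    "\<And>y. norm (Q y) \<le> 2 * norm y"
proof -
  interpret S: bounded_linear S using S by (simp add: compact_operator_def)
  obtain Q where Q: "\<And>y. Q y - S (Q y) = y"
    using compact_contraction_surj[OF assms] by metis
  have lower: "norm x \<le> 2 * norm (x - S x)" for x
    using half[of x] norm_triangle_ineq2[of x "S x"] by linarith
  have inj: "x = x'" if "x - S x = x' - S x'" for x x'
    using lower[of "x - x'"] that by (simp add: S.diff algebra_simps)
  have bound: "norm (Q y) \<le> 2 * norm y" for y using lower[of "Q y"] Q by simp
  have "bounded_linear Q"
  proof (rule bounded_linear_intro)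
    show "Q (x + y) = Q x + Q y" for x y
    proof (rule inj)
      have "Q x + Q y - S (Q x + Q y) = (Q x - S (Q x)) + (Q y - S (Q y))"
        by (simp add: S.add)
      then show "Q (x + y) - S (Q (x + y)) = Q x + Q y - S (Q x + Q y)" by (simp add: Q)
    qed
    show "Q (r *\<^sub>R x) = r *\<^sub>R Q x" for r x
    proof (rule inj)
      have "r *\<^sub>R Q x - S (r *\<^sub>R Q x) = r *\<^sub>R (Q x - S (Q x))"
        by (simp add: S.scaleR scaleR_diff_right)
      then show "Q (r *\<^sub>R x) - S (Q (r *\<^sub>R x)) = r *\<^sub>R Q x - S (r *\<^sub>R Q x)" by (simp add: Q)
    qed
    show "norm (Q x) \<le> norm x * 2" for x using bound[of x] by simp
  qed
  moreover have "Q (x - S x) = x" for x by (rule inj) (simp add: Q)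
  ultimately show thesis using that Q bound by blast
qed

section \<open>Direct sums of operators\<close>

lemma hilbert_sum_eqI: "(\<And>i. component x i = component y i) \<Longrightarrow> x = y"
  by (metis component_inject ext)

lemma component_hilbert_sum [simp]:
  "component 0 i = 0" "component (x + y) i = component x i + component y i"
  "component (x - y) i = component x i - component y i"
  "component (c *\<^sub>C x) i = c *\<^sub>C component x i"
  "component (r *\<^sub>R x) i = r *\<^sub>R component x i"
  by (simp_all add: zero_hilbert_sum.rep_eq plus_hilbert_sum.rep_eq minus_hilbert_sum.rep_eq
      scaleC_hilbert_sum.rep_eq scaleR_hilbert_sum_def scaleR_scaleC)

lemma summable_component: "(\<lambda>i. (norm (component x i))\<^sup>2) summable_on UNIV"
  using component[of x] by simp

lemma component_Abs_hilbert_sum: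
  "(\<lambda>i. (norm (x i))\<^sup>2) summable_on UNIV \<Longrightarrow> component (Abs_hilbert_sum x) = x"
  by (simp add: Abs_hilbert_sum_inverse)

lemma norm_hilbert_sum_eq: "(norm x)\<^sup>2 = (\<Sum>\<^sub>\<infinity>i. (norm (component x i))\<^sup>2)"
proof -
  have "(norm x)\<^sup>2 = Re (cinner x x)"
    by (simp add: power2_norm_eq_inner inner_eq_Re_cinner)
  also have "cinner x x = (\<Sum>\<^sub>\<infinity>i. cinner (component x i) (component x i))"
    by (simp add: cinner_hilbert_sum.rep_eq)
  also have "Re \<dots> = (\<Sum>\<^sub>\<infinity>i. Re (cinner (component x i) (component x i)))"
    by (rule infsum_Re[symmetric]) (intro square_summable_cinner summable_component)
  finally show ?thesis by (simp add: inner_eq_Re_cinner[symmetric] power2_norm_eq_inner)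
qed

lemma sum_component_le: "finite F \<Longrightarrow> (\<Sum>i\<in>F. (norm (component x i))\<^sup>2) \<le> (norm x)\<^sup>2"
  unfolding norm_hilbert_sum_eq by (rule finite_sum_le_infsum) (auto simp: summable_component)

lemma norm_component_le: "norm (component x i) \<le> norm x"
  using sum_component_le[of "{i}" x] by (simp add: power2_le_iff_abs_le)

lemma norm_hilbert_sum_leI:
  assumes "\<And>F. finite F \<Longrightarrow> (\<Sum>i\<in>F. (norm (component x i))\<^sup>2) \<le> B"
  shows "(norm x)\<^sup>2 \<le> B"
  unfolding norm_hilbert_sum_eq
  by (rule infsum_le_finite_sums) (use assms in \<open>auto simp: summable_component\<close>)

definition single :: "'i \<Rightarrow> 'a \<Rightarrow> ('i, 'a::complex_inner) hilbert_sum" where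
  "single i a = Abs_hilbert_sum (\<lambda>j. if j = i then a else 0)"

lemma component_single [simp]: "component (single i a) j = (if j = i then a else 0)"
proof -
  have "(\<lambda>j. (norm (if j = i then a else 0))\<^sup>2) summable_on UNIV"
    by (subst summable_on_cong_neutral[where T = "{i}" and g = "\<lambda>_. (norm a)\<^sup>2"]) auto
  then show ?thesis by (simp add: single_def component_Abs_hilbert_sum)
qed

lemma norm_single [simp]: "norm (single i a) = norm a"
proof -
  have "(norm (single i a))\<^sup>2 = (\<Sum>\<^sub>\<infinity>j\<in>{i}. (norm a)\<^sup>2)"
    unfolding norm_hilbert_sum_eq by (rule infsum_cong_neutral) auto
  then show ?thesis by simp
qed

text \<open>The shape of \<open>dirac_domain\<close> and \<open>dirac\<close> with the circle
  forgotten: all summands share one space and one domain \<open>S\<close>, and only the action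
  depends on the index.\<close>

definition sum_domain :: "'a set \<Rightarrow> ('i \<Rightarrow> 'a \<Rightarrow> 'a) \<Rightarrow> ('i, 'a::complex_inner) hilbert_sum set" where
  "sum_domain S A = {x. (\<forall>i. component x i \<in> S) \<and>
    (\<lambda>i. (norm (A i (component x i)))\<^sup>2) summable_on UNIV}"

definition sum_op ::
    "('i \<Rightarrow> 'a \<Rightarrow> 'a) \<Rightarrow> ('i, 'a::complex_inner) hilbert_sum \<Rightarrow> ('i, 'a) hilbert_sum" where
  "sum_op A x = Abs_hilbert_sum (\<lambda>i. A i (component x i))"

lemma component_sum_op:
  "x \<in> sum_domain S A \<Longrightarrow> component (sum_op A x) i = A i (component x i)"
  by (simp add: sum_op_def sum_domain_def component_Abs_hilbert_sum)

lemma resolvent_eqI: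
  assumes "\<And>y. R y \<in> S" "\<And>y. A (R y) - l *\<^sub>C R y = y" "\<And>x. x \<in> S \<Longrightarrow> R (A x - l *\<^sub>C x) = x"
  shows "bij_betw (\<lambda>x. A x - l *\<^sub>C x) S UNIV" "resolvent S A l = R"
proof -
  show bij: "bij_betw (\<lambda>x. A x - l *\<^sub>C x) S UNIV"
    by (rule bij_betw_byWitness[where f' = R]) (use assms in auto)
  show "resolvent S A l = R"
  proof
    fix y
    have "inv_into S (\<lambda>x. A x - l *\<^sub>C x) (A (R y) - l *\<^sub>C R y) = R y"
      by (rule inv_into_f_f[OF bij_betw_imp_inj_on[OF bij] assms(1)])
    then show "resolvent S A l y = R y" by (simp add: resolvent_def assms(2))
  qed
qed

text \<open>Tychonoff replaces a diagonal argument: one subsequence converges in every component at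
  once. Componentwise convergence becomes norm convergence because all blocks with
  \<open>c i < e\<close> together contribute at most \<open>e\<close> to the norm, uniformly along
  the sequence, and only finitely many blocks remain.\<close>

lemma compact_operator_sum_op:
  fixes R :: "'i::countable \<Rightarrow> 'a::complex_inner \<Rightarrow> 'a"
  assumes R: "\<And>i. compact_operator (R i)" and bound: "\<And>i y. norm (R i y) \<le> c i * norm y"
    and c: "\<And>e. 0 < e \<Longrightarrow> finite {i. e \<le> c i}"
  shows "compact_operator (sum_op R)"
    and "component (sum_op R y) i = R i (component y i)"
proof -
  \<comment> \<open>Only finitely many \<open>c i\<close> reach 1, so their sum plus 1 is a common
    bound for all blocks.\<close>
  define C where "C = 1 + (\<Sum>i\<in>{i. 1 \<le> c i}. c i)"
  have nn: "0 \<le> (\<Sum>i\<in>{i. 1 \<le> c i}. c i)" by (intro sum_nonneg) auto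
  have C: "c i \<le> C" "0 \<le> C" for i
  proof (cases "1 \<le> c i")
    case True
    then have "c i \<le> (\<Sum>i\<in>{i. 1 \<le> c i}. c i)" by (intro member_le_sum c) auto
    then show "c i \<le> C" by (simp add: C_def)
  qed (use nn in \<open>auto simp: C_def\<close>)
  have bC: "norm (R i y) \<le> C * norm y" for i y
    using bound[of i y] mult_right_mono[OF C(1)[of i] norm_ge_zero[of y]] by linarith
  have comp: "component (sum_op R y) i = R i (component y i)" for y i
  proof -
    have "(\<lambda>i. (norm (R i (component y i)))\<^sup>2) summable_on UNIV"
    proof (rule summable_on_comparison_test)
      show "(\<lambda>i. C\<^sup>2 * (norm (component y i))\<^sup>2) summable_on UNIV"
        by (intro summable_on_cmult_right summable_component)
      show "(norm (R i (component y i)))\<^sup>2 \<le> C\<^sup>2 * (norm (component y i))\<^sup>2" for i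
        using power_mono[OF bC, of i "component y i" 2] by (simp add: power_mult_distrib)
    qed simp
    then show ?thesis by (simp add: sum_op_def component_Abs_hilbert_sum)
  qed
  then show "component (sum_op R y) i = R i (component y i)" .
  have lin: "bounded_linear (R i)" for i using R by (rule compact_operator_bounded_linear)
  note Radd = linear_add[OF bounded_linear.linear[OF lin]]
    and RscaleR = linear_scale[OF bounded_linear.linear[OF lin]]
  show "compact_operator (sum_op R)"
  proof (rule compact_operatorI)
    show "bounded_linear (sum_op R)"
    proof (rule bounded_linear_intro)
      show "sum_op R (x + y) = sum_op R x + sum_op R y" for x y
        by (rule hilbert_sum_eqI) (simp add: comp Radd)
      show "sum_op R (r *\<^sub>R x) = r *\<^sub>R sum_op R x" for r x
        by (rule hilbert_sum_eqI) (simp add: comp RscaleR)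
      show "norm (sum_op R x) \<le> norm x * C" for x
      proof (rule power2_le_imp_le)
        show "(norm (sum_op R x))\<^sup>2 \<le> (norm x * C)\<^sup>2"
        proof (rule norm_hilbert_sum_leI)
          fix F :: "'i set" assume "finite F"
          have "(\<Sum>i\<in>F. (norm (component (sum_op R x) i))\<^sup>2) \<le> (\<Sum>i\<in>F. C\<^sup>2 * (norm (component x i))\<^sup>2)"
            using power_mono[OF bC, of _ _ 2]
            by (intro sum_mono) (simp add: comp power_mult_distrib)
          also have "\<dots> \<le> C\<^sup>2 * (norm x)\<^sup>2"
            unfolding sum_distrib_left[symmetric]
            by (intro mult_left_mono sum_component_le \<open>finite F\<close>) simp
          finally show "(\<Sum>i\<in>F. (norm (component (sum_op R x) i))\<^sup>2) \<le> (norm x * C)\<^sup>2"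
            by (simp add: power_mult_distrib mult.commute)
        qed
      qed (use C in simp)
    qed
    fix x :: "nat \<Rightarrow> ('i, 'a) hilbert_sum" assume x: "\<And>k. norm (x k) \<le> 1"
    define K where "K i = closure (R i ` cball 0 1)" for i
    \<comment> \<open>Countability of the index type makes the product metrizable, so that
      compactness yields convergent subsequences.\<close>
    have "compact (Pi\<^sub>E UNIV K)"
      using R unfolding K_def compact_operator_def
      by (simp flip: compactin_euclidean_iff euclidean_product_topology add: compactin_PiE)
    then have "seq_compact (Pi\<^sub>E UNIV K)" by (simp add: compact_eq_seq_compact_metric)
    moreover have "(\<lambda>i. R i (component (x k) i)) \<in> Pi\<^sub>E UNIV K" for k
      using order_trans[OF norm_component_le x]
      by (auto simp: K_def intro!: subsetD[OF closure_subset] imageI)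
    ultimately obtain r g where r: "strict_mono r"
      and g: "((\<lambda>k i. R i (component (x k) i)) \<circ> r) \<longlonglongrightarrow> g"
      unfolding seq_compact_def by metis
    have lim: "(\<lambda>k. R i (component (x (r k)) i)) \<longlonglongrightarrow> g i" for i
      using continuous_on_tendsto_compose[OF continuous_on_product_coordinates[of i] g]
      by (simp add: comp_def)
    have tail: "(\<Sum>i\<in>F. (norm (R i (component (x k) i)))\<^sup>2) \<le> e\<^sup>2"
      if "finite F" "\<And>i. i \<in> F \<Longrightarrow> c i \<le> e" "0 \<le> e" for F e k
    proof -
      have "(\<Sum>i\<in>F. (norm (R i (component (x k) i)))\<^sup>2) \<le> (\<Sum>i\<in>F. e\<^sup>2 * (norm (component (x k) i))\<^sup>2)"
      proof (rule sum_mono)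
        fix i assume "i \<in> F"
        have "norm (R i (component (x k) i)) \<le> e * norm (component (x k) i)"
          using bound[of i "component (x k) i"]
            mult_right_mono[OF that(2)[OF \<open>i \<in> F\<close>] norm_ge_zero[of "component (x k) i"]] by linarith
        from power_mono[OF this, of 2]
        show "(norm (R i (component (x k) i)))\<^sup>2 \<le> e\<^sup>2 * (norm (component (x k) i))\<^sup>2"
          by (simp add: power_mult_distrib)
      qed
      also have "\<dots> \<le> e\<^sup>2 * (norm (x k))\<^sup>2"
        unfolding sum_distrib_left[symmetric] by (intro mult_left_mono sum_component_le that) simp
      also have "\<dots> \<le> e\<^sup>2"
        using power_mono[OF x[of k], of 2] mult_left_mono[of "(norm (x k))\<^sup>2" 1 "e\<^sup>2"] by simp
      finally show ?thesis .
    qed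
    have gtail: "(\<Sum>i\<in>F. (norm (g i))\<^sup>2) \<le> e\<^sup>2"
      if "finite F" "\<And>i. i \<in> F \<Longrightarrow> c i \<le> e" "0 \<le> e" for F e
    proof (rule LIMSEQ_le_const2)
      show "(\<lambda>k. \<Sum>i\<in>F. (norm (R i (component (x (r k)) i)))\<^sup>2) \<longlonglongrightarrow> (\<Sum>i\<in>F. (norm (g i))\<^sup>2)"
        by (intro tendsto_intros lim)
      show "\<exists>N. \<forall>n\<ge>N. (\<Sum>i\<in>F. (norm (R i (component (x (r n)) i)))\<^sup>2) \<le> e\<^sup>2"
        using tail[OF that] by blast
    qed
    \<comment> \<open>With \<open>e = C\<close> the tail estimate covers every finite index set;
      hence the componentwise limit is an element of the Hilbert sum.\<close>
    have "(\<lambda>i. (norm (g i))\<^sup>2) summable_on UNIV"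
    proof (rule nonneg_bdd_above_summable_on)
      show "bdd_above (sum (\<lambda>i. (norm (g i))\<^sup>2) ` {F. F \<subseteq> UNIV \<and> finite F})"
        by (rule bdd_aboveI2[where M = "C\<^sup>2"]) (use gtail[of _ C] C in auto)
    qed simp
    then have g': "component (Abs_hilbert_sum g) = g" by (rule component_Abs_hilbert_sum)
    have "(\<lambda>k. sum_op R (x (r k))) \<longlonglongrightarrow> Abs_hilbert_sum g"
    proof (rule LIMSEQ_I)
      fix e' :: real assume "0 < e'"
      \<comment> \<open>The squared error is at most \<open>e\<^sup>2\<close> from the finitely many
        large blocks plus \<open>4 * e\<^sup>2\<close> from the tails of the sequence and of its
        limit, and 5 is less than 9.\<close>
      define e where "e = e' / 3"
      have "e > 0" using \<open>0 < e'\<close> by (simp add: e_def)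
      define F0 where "F0 = {i. e \<le> c i}"
      have "finite F0" using c[OF \<open>e > 0\<close>] by (simp add: F0_def)
      have "(\<lambda>k. \<Sum>i\<in>F0. (norm (R i (component (x (r k)) i) - g i))\<^sup>2) \<longlonglongrightarrow> (\<Sum>i\<in>F0. (norm (g i - g i))\<^sup>2)"
        by (intro tendsto_intros lim)
      then have "(\<lambda>k. \<Sum>i\<in>F0. (norm (R i (component (x (r k)) i) - g i))\<^sup>2) \<longlonglongrightarrow> 0" by simp
      then obtain N where N: "\<And>k. k \<ge> N \<Longrightarrow>
          (\<Sum>i\<in>F0. (norm (R i (component (x (r k)) i) - g i))\<^sup>2) < e\<^sup>2"
        using LIMSEQ_D[of _ 0 "e\<^sup>2"] \<open>e > 0\<close> by (force simp: sum_nonneg)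
      have "norm (sum_op R (x (r k)) - Abs_hilbert_sum g) < e'" if "k \<ge> N" for k
      proof -
        have "(norm (sum_op R (x (r k)) - Abs_hilbert_sum g))\<^sup>2 \<le> 5 * e\<^sup>2"
        proof (rule norm_hilbert_sum_leI)
          fix F :: "'i set" assume "finite F"
          let ?d = "\<lambda>i. (norm (R i (component (x (r k)) i) - g i))\<^sup>2"
          have "(\<Sum>i\<in>F. ?d i) = (\<Sum>i\<in>F \<inter> F0. ?d i) + (\<Sum>i\<in>F - F0. ?d i)"
            using \<open>finite F\<close> by (rule sum.Int_Diff)
          also have "(\<Sum>i\<in>F \<inter> F0. ?d i) \<le> (\<Sum>i\<in>F0. ?d i)"
            using \<open>finite F0\<close> by (intro sum_mono2) auto
          also have "\<dots> \<le> e\<^sup>2" using N[OF that] by simp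
          also have "(\<Sum>i\<in>F - F0. ?d i) \<le> (\<Sum>i\<in>F - F0. 2 * (norm (R i (component (x (r k)) i)))\<^sup>2 + 2 * (norm (g i))\<^sup>2)"
          proof (rule sum_mono)
            fix i
            let ?a = "R i (component (x (r k)) i)"
            have "(norm (?a - g i))\<^sup>2 \<le> (norm ?a + norm (g i))\<^sup>2"
              by (intro power_mono norm_triangle_ineq4) simp
            also have "\<dots> \<le> 2 * (norm ?a)\<^sup>2 + 2 * (norm (g i))\<^sup>2"
              using sum_squares_bound[of "norm ?a" "norm (g i)"] by (simp add: power2_sum)
            finally show "(norm (?a - g i))\<^sup>2 \<le> 2 * (norm ?a)\<^sup>2 + 2 * (norm (g i))\<^sup>2" .
          qed
          also have "\<dots> = 2 * (\<Sum>i\<in>F - F0. (norm (R i (component (x (r k)) i)))\<^sup>2) + 2 * (\<Sum>i\<in>F - F0. (norm (g i))\<^sup>2)"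
            by (simp add: sum.distrib sum_distrib_left)
          also have "\<dots> \<le> 2 * e\<^sup>2 + 2 * e\<^sup>2"
            using tail[of "F - F0" e "r k"] gtail[of "F - F0" e] \<open>finite F\<close> \<open>e > 0\<close>
            by (intro add_mono mult_left_mono) (auto simp: F0_def)
          finally show "(\<Sum>i\<in>F. (norm (component (sum_op R (x (r k)) - Abs_hilbert_sum g) i))\<^sup>2) \<le> 5 * e\<^sup>2"
            by (simp add: comp g')
        qed
        also have "\<dots> < (3 * e)\<^sup>2" using \<open>e > 0\<close> by (simp add: power2_eq_square)
        finally have "norm (sum_op R (x (r k)) - Abs_hilbert_sum g) < 3 * e"
          by (rule power2_less_imp_less) (use \<open>e > 0\<close> in simp)
        then show ?thesis by (simp add: e_def)
      qed
      then show "\<exists>N. \<forall>k\<ge>N. norm (sum_op R (x (r k)) - Abs_hilbert_sum g) < e'" by blast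
    qed
    with r show "\<exists>r l. strict_mono r \<and> (\<lambda>k. sum_op R (x (r k))) \<longlonglongrightarrow> l" by blast
  qed
qed

text \<open>The sum of the block resolvents is the resolvent of the sum. Its range lies in the
  domain because \<open>A i (R i y) = y + l *\<^sub>C R i y\<close> turns the summability condition
  into one about an element of the Hilbert sum.\<close>

lemma direct_sum_has_compact_resolvent:
  fixes A R :: "'i::countable \<Rightarrow> 'a::complex_inner \<Rightarrow> 'a"
  assumes R: "\<And>i. compact_operator (R i)" and bound: "\<And>i y. norm (R i y) \<le> c i * norm y"
    and c: "\<And>e. 0 < e \<Longrightarrow> finite {i. e \<le> c i}"
    and RS: "\<And>i y. R i y \<in> S" and AR: "\<And>i y. A i (R i y) - l *\<^sub>C R i y = y"
    and RA: "\<And>i x. x \<in> S \<Longrightarrow> R i (A i x - l *\<^sub>C x) = x"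
  shows "has_compact_resolvent (sum_domain S A) (sum_op A)"
proof -
  note comp = compact_operator_sum_op(2)[OF R bound c] and cpt = compact_operator_sum_op(1)[OF R bound c]
  have A: "A i (R i y) = y + l *\<^sub>C R i y" for i y using AR[of i y] by (simp add: algebra_simps)
  have dom: "sum_op R y \<in> sum_domain S A" for y
  proof -
    have "(\<lambda>i. (norm (component (y + l *\<^sub>C sum_op R y) i))\<^sup>2) summable_on UNIV"
      by (rule summable_component)
    then show ?thesis by (simp add: sum_domain_def comp RS A)
  qed
  have "sum_op A (sum_op R y) - l *\<^sub>C sum_op R y = y" for y
    by (rule hilbert_sum_eqI) (simp add: comp component_sum_op[OF dom] AR)
  moreover have "sum_op R (sum_op A x - l *\<^sub>C x) = x" if "x \<in> sum_domain S A" for x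
    by (rule hilbert_sum_eqI)
      (use that in \<open>simp add: comp component_sum_op[OF that] RA sum_domain_def\<close>)
  ultimately have "bij_betw (\<lambda>x. sum_op A x - l *\<^sub>C x) (sum_domain S A) UNIV"
    "resolvent (sum_domain S A) (sum_op A) l = sum_op R"
    using resolvent_eqI[of "sum_op R" "sum_domain S A" "sum_op A" l] dom by blast+
  then show ?thesis
    using cpt compact_operator_bounded_linear[OF cpt]
    unfolding has_compact_resolvent_def resolvent_set_def by auto
qed

text \<open>If the set were infinite for some \<open>e\<close>, normalised vectors in pairwise
  different summands would be mapped by the compact resolvent to mutually orthogonal vectors of norm
  above \<open>e\<close>, and no subsequence of these is Cauchy. The conclusion is phrased through
  \<open>A i - l\<close> on \<open>S\<close>, so the blocks of the resolvent need not be
  identified.\<close>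

lemma direct_sum_compact_resolventD:
  fixes A :: "'i \<Rightarrow> 'a::complex_inner \<Rightarrow> 'a"
  assumes "has_compact_resolvent (sum_domain S A) (sum_op A)"
    and "0 \<in> S" and A0: "\<And>i. A i 0 = 0"
  shows "\<exists>l. \<forall>e>0. finite {i. \<exists>x\<in>S. e * norm (A i x - l *\<^sub>C x) < norm x}"
proof -
  let ?D = "sum_domain S A"
  obtain l where l: "l \<in> resolvent_set ?D (sum_op A)" "compact_operator (resolvent ?D (sum_op A) l)"
    using assms(1) by (auto simp: has_compact_resolvent_def)
  define R where "R = resolvent ?D (sum_op A) l"
  interpret R: bounded_linear R using l(2) unfolding R_def by (rule compact_operator_bounded_linear)
  have bij: "bij_betw (\<lambda>x. sum_op A x - l *\<^sub>C x) ?D UNIV" using l(1) by (simp add: resolvent_set_def)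
  have Rsingle: "R (single i (A i x - l *\<^sub>C x)) = single i x" if "x \<in> S" for i x
  proof -
    have "(\<lambda>j. (norm (component (single i (A i x)) j))\<^sup>2) summable_on UNIV"
      by (rule summable_component)
    then have dom: "single i x \<in> ?D"
      using that \<open>0 \<in> S\<close> by (auto simp: sum_domain_def A0 if_distrib cong: if_cong)
    have "sum_op A (single i x) - l *\<^sub>C single i x = single i (A i x - l *\<^sub>C x)"
      by (rule hilbert_sum_eqI) (simp add: component_sum_op[OF dom] A0)
    with inv_into_f_f[OF bij_betw_imp_inj_on[OF bij] dom] show ?thesis
      by (simp add: R_def resolvent_def)
  qed
  show ?thesis
  proof (intro exI[of _ l] allI impI, rule ccontr)
    fix e :: real assume "0 < e" and inf: "infinite {i. \<exists>x\<in>S. e * norm (A i x - l *\<^sub>C x) < norm x}"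
    from infinite_countable_subset[OF inf] obtain n :: "nat \<Rightarrow> 'i" where n: "inj n"
      "range n \<subseteq> {i. \<exists>x\<in>S. e * norm (A i x - l *\<^sub>C x) < norm x}" by blast
    then have "\<forall>k. \<exists>x\<in>S. e * norm (A (n k) x - l *\<^sub>C x) < norm x" by blast
    then obtain x where x: "\<And>k. x k \<in> S" "\<And>k. e * norm (A (n k) (x k) - l *\<^sub>C x k) < norm (x k)"
      by metis
    define u where "u k = A (n k) (x k) - l *\<^sub>C x k" for k
    \<comment> \<open>Needed for the normalisation: \<open>u k = 0\<close> would give
      \<open>x k = 0\<close>, against the strict inequality.\<close>
    have u0: "u k \<noteq> 0" for k
    proof
      assume "u k = 0"
      then have "single (n k) (x k) = 0"
        using Rsingle[OF x(1), of "n k" k] by (simp add: u_def R.zero hilbert_sum_eqI[of "single (n k) 0" 0])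
      then have "norm (x k) = 0" by (metis norm_single norm_zero)
      moreover have "0 \<le> e * norm (A (n k) (x k) - l *\<^sub>C x k)" using \<open>e > 0\<close> by simp
      ultimately show False using x(2)[of k] by linarith
    qed
    define y where "y k = single (n k) (u k) /\<^sub>R norm (u k)" for k
    have Ry: "R (y k) = single (n k) (x k) /\<^sub>R norm (u k)" for k
      using Rsingle[OF x(1), of "n k" k] by (simp add: y_def R.scaleR u_def)
    have y1: "norm (y k) \<le> 1" for k by (simp add: y_def u0)
    obtain r m where r: "strict_mono r" "(\<lambda>k. R (y (r k))) \<longlonglongrightarrow> m"
      using compact_operatorD[where x = y, OF l(2)[folded R_def] y1] by (elim exE conjE) (rule that)
    then have "Cauchy (\<lambda>k. R (y (r k)))" by (intro LIMSEQ_imp_Cauchy)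
    then obtain N where N: "\<And>i j. i \<ge> N \<Longrightarrow> j \<ge> N \<Longrightarrow> norm (R (y (r i)) - R (y (r j))) < e"
      using CauchyD[OF _ \<open>e > 0\<close>] by blast
    let ?i = "n (r N)"
    \<comment> \<open>Consecutive members of the subsequence live in different summands, so
      component \<open>?i\<close> of their difference sees only the first one.\<close>
    have "n (r (Suc N)) \<noteq> ?i"
      using n(1) r(1) by (metis injD n_not_Suc_n strict_mono_eq)
    then have "component (R (y (r N)) - R (y (r (Suc N)))) ?i = x (r N) /\<^sub>R norm (u (r N))"
      by (simp add: Ry)
    then have "norm (x (r N) /\<^sub>R norm (u (r N))) < e"
      using N[of N "Suc N"] norm_component_le[of "R (y (r N)) - R (y (r (Suc N)))" ?i] by simp
    moreover have "e < norm (x (r N)) / norm (u (r N))"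
      using x(2)[of "r N"] u0[of "r N"] by (simp add: u_def field_simps)
    ultimately show False using u0[of "r N"] by (simp add: divide_inverse mult.commute)
  qed
qed

section \<open>The circle as a quotient of the line\<close>

abbreviation circ :: "real \<Rightarrow> complex" where "circ t \<equiv> cis (2 * pi * t)"

text \<open>\<open>Arg2pi\<close> has its jump at the point 1, so \<open>angle\<close> inverts
  \<open>circ\<close> on exactly the interval [0, 1) from which \<open>circle_measure\<close> is
  transported.\<close>

definition angle :: "complex \<Rightarrow> real" where "angle z = Arg2pi z / (2 * pi)"

lemma angle_circ: "0 \<le> t \<Longrightarrow> t < 1 \<Longrightarrow> angle (circ t) = t"
  using Arg2pi_unique[of 1 "2 * pi * t" "circ t"] by (simp add: angle_def cis_conv_exp)

lemma circ_angle: "z \<in> circle \<Longrightarrow> circ (angle z) = z"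
  using complex_norm_eq_1_exp[of z] by (simp add: angle_def cis_conv_exp)

lemma angle_bounds: "0 \<le> angle z" "angle z < 1"
  using Arg2pi[of z] by (auto simp: angle_def)

lemma circ_1 [simp]: "circ 1 = 1" using cis_2pi by simp

lemma borel_measurable_angle [measurable]: "angle \<in> borel_measurable borel"
proof -
  have "Arg2pi \<in> borel_measurable borel"
    by (rule borel_measurableI_greater) (simp add: open_Arg2pi2pi_gt)
  then show ?thesis unfolding angle_def by measurable
qed

lemma measurable_circ: "circ \<in> restrict_space lborel {0..<1} \<rightarrow>\<^sub>M restrict_space borel circle"
proof (rule measurable_restrict_space2)
  have "circ \<in> borel_measurable borel"
    by (intro borel_measurable_continuous_onI continuous_intros)
  then show "circ \<in> restrict_space lborel {0..<1} \<rightarrow>\<^sub>M borel"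
    by (intro measurable_restrict_space1) simp
qed auto

lemma space_circle_measure [simp]: "space circle_measure = circle"
  by (simp add: circle_measure_def space_restrict_space)

lemma sets_circle_measure: "sets circle_measure = sets (restrict_space borel circle)"
  by (simp add: circle_measure_def)

text \<open>From the line to the circle, an exceptional null set is pulled back along the Borel
  function \<open>angle\<close>; its preimage under \<open>circ\<close> is the old set cut down to
  [0, 1).\<close>

lemma AE_circle_measure_iff:
  "(AE z in circle_measure. P z) \<longleftrightarrow> (AE t in lborel. 0 \<le> t \<and> t < 1 \<longrightarrow> P (circ t))"
proof
  assume "AE z in circle_measure. P z"
  then have "AE t in restrict_space lborel {0..<1}. P (circ t)"
    unfolding circle_measure_def by (rule AE_distrD[OF measurable_circ])
  then show "AE t in lborel. 0 \<le> t \<and> t < 1 \<longrightarrow> P (circ t)"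
    by (subst (asm) AE_restrict_space_iff) auto
next
  assume "AE t in lborel. 0 \<le> t \<and> t < 1 \<longrightarrow> P (circ t)"
  then obtain N where N: "{t \<in> space lborel. \<not> (0 \<le> t \<and> t < 1 \<longrightarrow> P (circ t))} \<subseteq> N"
    "emeasure lborel N = 0" "N \<in> sets lborel" by (rule AE_E)
  show "AE z in circle_measure. P z"
  proof (rule AE_I)
    have N': "angle -` N \<in> sets borel"
      using measurable_sets[OF borel_measurable_angle, of N] N(3) by simp
    show A: "angle -` N \<inter> circle \<in> sets circle_measure"
      unfolding sets_circle_measure using N' by (auto simp: sets_restrict_space)
    have "circ -` (angle -` N \<inter> circle) \<inter> space (restrict_space lborel {0..<1}) = N \<inter> {0..<1}"
      by (auto simp: space_restrict_space angle_circ)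
    then have "emeasure circle_measure (angle -` N \<inter> circle)
        = emeasure (restrict_space lborel {0..<1}) (N \<inter> {0..<1})"
      using A unfolding circle_measure_def by (subst emeasure_distr[OF measurable_circ]) auto
    also have "\<dots> = emeasure lborel (N \<inter> {0..<1})"
      by (rule emeasure_restrict_space) auto
    also have "\<dots> \<le> emeasure lborel N"
      using N(3) by (intro emeasure_mono) auto
    finally show "emeasure circle_measure (angle -` N \<inter> circle) = 0" using N(2) by simp
    show "{z \<in> space circle_measure. \<not> P z} \<subseteq> angle -` N \<inter> circle"
    proof
      fix z assume z: "z \<in> {z \<in> space circle_measure. \<not> P z}"
      then have "circ (angle z) = z" by (intro circ_angle) simp
      with z angle_bounds[of z] have "angle z \<in> N" by (intro subsetD[OF N(1)]) simp
      with z show "z \<in> angle -` N \<inter> circle" by simp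
    qed
  qed
qed

lemma
  fixes f :: "complex \<Rightarrow> 'a::{banach, second_countable_topology}"
  assumes f: "f \<in> borel_measurable circle_measure"
  shows integrable_circle_measure_iff:
      "integrable circle_measure f \<longleftrightarrow> set_integrable lborel {0..<1} (\<lambda>t. f (circ t))"
    and integral_circle_measure:
      "(\<integral>z. f z \<partial>circle_measure) = (LINT t:{0..<1}|lborel. f (circ t))"
proof -
  have f': "f \<in> borel_measurable (restrict_space borel circle)"
    using f sets_circle_measure measurable_cong_sets by blast
  show "integrable circle_measure f \<longleftrightarrow> set_integrable lborel {0..<1} (\<lambda>t. f (circ t))"
    unfolding circle_measure_def set_integrable_def
    by (subst integrable_distr_eq[OF measurable_circ f'], subst integrable_restrict_space) auto
  show "(\<integral>z. f z \<partial>circle_measure) = (LINT t:{0..<1}|lborel. f (circ t))"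
    unfolding circle_measure_def set_lebesgue_integral_def
    by (subst integral_distr[OF measurable_circ f'], subst integral_restrict_space) auto
qed

lemma finite_measure_circle: "finite_measure circle_measure"
proof
  have "emeasure circle_measure (space circle_measure)
      = emeasure (restrict_space lborel {0..<1}) (circ -` circle \<inter> space (restrict_space lborel {0..<1}))"
    unfolding circle_measure_def
    by (subst emeasure_distr[OF measurable_circ])
      (auto simp: space_restrict_space sets_restrict_space intro!: image_eqI[of _ _ UNIV])
  also have "circ -` circle \<inter> space (restrict_space lborel {0..<1}) = {0..<1}"
    by (auto simp: space_restrict_space)
  also have "emeasure (restrict_space lborel {0..<1}) {0..<1::real} = emeasure lborel {0..<1::real}"
    by (rule emeasure_restrict_space) auto
  finally show "emeasure circle_measure (space circle_measure) \<noteq> \<infinity>" by simp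
qed

lemma continuous_imp_measurable_circle:
  "continuous_on circle g \<Longrightarrow> g \<in> borel_measurable circle_measure"
  using borel_measurable_continuous_on_restrict[of circle g] sets_circle_measure
    measurable_cong_sets by blast

lemma continuous_on_circle_bounded:
  fixes g :: "complex \<Rightarrow> complex"
  assumes "continuous_on circle g"
  shows "\<exists>B\<ge>0. \<forall>z\<in>circle. cmod (g z) \<le> B"
proof -
  have "bounded (g ` circle)"
    by (intro compact_imp_bounded compact_continuous_image assms compact_sphere)
  then obtain B where "B > 0" "\<forall>x\<in>g ` circle. norm x \<le> B"
    unfolding bounded_pos by blast
  then show ?thesis by (intro exI[of _ B] conjI ballI) (simp_all add: less_imp_le)
qed

section \<open>Bounded multipliers of square integrable functions\<close>

lemma square_integrable_mult_bounded:
  assumes f: "square_integrable f" and g: "g \<in> borel_measurable circle_measure"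
    and B: "\<forall>z\<in>circle. cmod (g z) \<le> B"
  shows "square_integrable (\<lambda>z. g z * f z)"
  unfolding square_integrable_def
proof
  have f': "f \<in> borel_measurable circle_measure" "integrable circle_measure (\<lambda>z. (cmod (f z))\<^sup>2)"
    using f by (auto simp: square_integrable_def)
  show m: "(\<lambda>z. g z * f z) \<in> borel_measurable circle_measure"
    using f'(1) g by measurable
  show "integrable circle_measure (\<lambda>z. (cmod (g z * f z))\<^sup>2)"
  proof (rule Bochner_Integration.integrable_bound)
    show "integrable circle_measure (\<lambda>z. B\<^sup>2 * (cmod (f z))\<^sup>2)" using f'(2) by simp
    show "(\<lambda>z. (cmod (g z * f z))\<^sup>2) \<in> borel_measurable circle_measure" using m by measurable
    show "AE z in circle_measure. norm ((cmod (g z * f z))\<^sup>2) \<le> norm (B\<^sup>2 * (cmod (f z))\<^sup>2)"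
    proof (rule AE_I2)
      fix z assume "z \<in> space circle_measure"
      then have "(cmod (g z))\<^sup>2 \<le> B\<^sup>2" using B by (intro power_mono) auto
      then show "norm ((cmod (g z * f z))\<^sup>2) \<le> norm (B\<^sup>2 * (cmod (f z))\<^sup>2)"
        by (simp add: norm_mult power_mult_distrib mult_right_mono)
    qed
  qed
qed

lemma square_integrable_bounded:
  assumes "f \<in> borel_measurable circle_measure" "\<forall>z\<in>circle. cmod (f z) \<le> B"
  shows "square_integrable f"
proof -
  interpret finite_measure circle_measure by (rule finite_measure_circle)
  have "square_integrable (\<lambda>_. 1)" by (simp add: square_integrable_def)
  from square_integrable_mult_bounded[OF this assms] show ?thesis by simp
qed

lemma square_integrable_continuous:
  "continuous_on circle f \<Longrightarrow> square_integrable f"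
  using continuous_on_circle_bounded[of f] continuous_imp_measurable_circle[of f]
    square_integrable_bounded by meson

section \<open>Calculus with classes of functions\<close>

lemma L2_rep: "square_integrable (rep_circle_L2 x)" "abs_circle_L2 (rep_circle_L2 x) = x"
  using Quotient_rep_reflp[OF Quotient_circle_L2, of x] Quotient_abs_rep[OF Quotient_circle_L2, of x]
  by (auto simp: L2_eq_def)

lemma abs_circle_L2_eq_iff:
  assumes "square_integrable f" "square_integrable g"
  shows "abs_circle_L2 f = abs_circle_L2 g \<longleftrightarrow> (AE z in circle_measure. f z = g z)"
  using Quotient_rel[OF Quotient_circle_L2, of f g] assms by (auto simp: L2_eq_def)

lemma abs_circle_L2_eqI:
  assumes "square_integrable f" "square_integrable g" "\<And>z. z \<in> circle \<Longrightarrow> f z = g z"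
  shows "abs_circle_L2 f = abs_circle_L2 g"
  using assms by (subst abs_circle_L2_eq_iff) (auto intro!: AE_I2)

lemma L2_eq_refl: "square_integrable f \<Longrightarrow> L2_eq f f" by (simp add: L2_eq_def)

lemma abs_circle_L2_add: "square_integrable f \<Longrightarrow> square_integrable g \<Longrightarrow>
    abs_circle_L2 (\<lambda>z. f z + g z) = abs_circle_L2 f + abs_circle_L2 g"
  by (simp add: plus_circle_L2.abs_eq L2_eq_refl)

lemma abs_circle_L2_diff: "square_integrable f \<Longrightarrow> square_integrable g \<Longrightarrow>
    abs_circle_L2 (\<lambda>z. f z - g z) = abs_circle_L2 f - abs_circle_L2 g"
  by (simp add: minus_circle_L2.abs_eq L2_eq_refl)

lemma abs_circle_L2_scaleC: "square_integrable f \<Longrightarrow>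
    abs_circle_L2 (\<lambda>z. c * f z) = c *\<^sub>C abs_circle_L2 f"
  by (simp add: scaleC_circle_L2.abs_eq L2_eq_refl)

lemma cinner_abs_circle_L2: "square_integrable f \<Longrightarrow> square_integrable g \<Longrightarrow>
    cinner (abs_circle_L2 f) (abs_circle_L2 g) = (\<integral>z. f z * cnj (g z) \<partial>circle_measure)"
  by (simp add: cinner_circle_L2.abs_eq L2_eq_refl)

lemma norm_abs_circle_L2:
  assumes "square_integrable f"
  shows "(norm (abs_circle_L2 f))\<^sup>2 = (\<integral>z. (cmod (f z))\<^sup>2 \<partial>circle_measure)"
proof -
  have "(\<lambda>z. f z * cnj (f z)) = (\<lambda>z. complex_of_real ((cmod (f z))\<^sup>2))"
    by (simp only: complex_norm_square)
  then show ?thesis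
    using cinner_abs_circle_L2[OF assms assms]
    by (simp add: power2_norm_eq_inner inner_eq_Re_cinner del: of_real_power)
qed

lemma norm_abs_circle_L2_le:
  assumes "square_integrable f" "square_integrable g"
    and "\<And>z. z \<in> circle \<Longrightarrow> cmod (f z) \<le> B * cmod (g z)" and "0 \<le> B"
  shows "norm (abs_circle_L2 f) \<le> B * norm (abs_circle_L2 g)"
proof (rule power2_le_imp_le)
  have "(norm (abs_circle_L2 f))\<^sup>2 \<le> (\<integral>z. B\<^sup>2 * (cmod (g z))\<^sup>2 \<partial>circle_measure)"
    unfolding norm_abs_circle_L2[OF assms(1)]
  proof (rule integral_mono_AE)
    show "AE z in circle_measure. (cmod (f z))\<^sup>2 \<le> B\<^sup>2 * (cmod (g z))\<^sup>2"
      using assms(3) by (intro AE_I2) (simp add: power_mult_distrib[symmetric] power_mono)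
  qed (use assms in \<open>auto simp: square_integrable_def\<close>)
  then show "(norm (abs_circle_L2 f))\<^sup>2 \<le> (B * norm (abs_circle_L2 g))\<^sup>2"
    by (simp add: norm_abs_circle_L2[OF assms(2)] power_mult_distrib)
qed (use assms in simp)

lemma square_integrable_mult_continuous:
  assumes "square_integrable f" "continuous_on circle g"
  shows "square_integrable (\<lambda>z. g z * f z)"
  using continuous_on_circle_bounded[OF assms(2)] continuous_imp_measurable_circle[OF assms(2)]
    square_integrable_mult_bounded[OF assms(1)] by meson

text \<open>\<open>mult_op\<close> uses the representative picked by \<open>rep_circle_L2\<close>;
  this rule frees all later computations from that choice, since two representatives differ on a
  null set only.\<close>

lemma mult_op_abs:
  assumes f: "square_integrable f" and g: "continuous_on circle g"
  shows "mult_op g (abs_circle_L2 f) = abs_circle_L2 (\<lambda>z. g z * f z)"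
proof -
  have "AE z in circle_measure. rep_circle_L2 (abs_circle_L2 f) z = f z"
    using L2_rep[of "abs_circle_L2 f"] f abs_circle_L2_eq_iff by blast
  then show ?thesis
    unfolding mult_op_def
    by (subst abs_circle_L2_eq_iff)
      (auto intro: square_integrable_mult_continuous f g L2_rep)
qed

lemma mult_op_add: "continuous_on circle g \<Longrightarrow> mult_op g (x + y) = mult_op g x + mult_op g y"
proof -
  assume g: "continuous_on circle g"
  let ?x = "rep_circle_L2 x" and ?y = "rep_circle_L2 y"
  have "mult_op g (x + y) = mult_op g (abs_circle_L2 (\<lambda>z. ?x z + ?y z))"
    by (simp add: abs_circle_L2_add L2_rep)
  also have "\<dots> = abs_circle_L2 (\<lambda>z. g z * ?x z + g z * ?y z)"
    using g by (subst mult_op_abs) (auto intro: square_integrable_add L2_rep simp: distrib_left)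
  also have "\<dots> = mult_op g x + mult_op g y"
    using g by (simp add: mult_op_def abs_circle_L2_add square_integrable_mult_continuous L2_rep)
  finally show ?thesis .
qed

lemma mult_op_scaleC: "continuous_on circle g \<Longrightarrow> mult_op g (c *\<^sub>C x) = c *\<^sub>C mult_op g x"
proof -
  assume g: "continuous_on circle g"
  let ?x = "rep_circle_L2 x"
  have "mult_op g (c *\<^sub>C x) = mult_op g (abs_circle_L2 (\<lambda>z. c * ?x z))"
    by (simp add: abs_circle_L2_scaleC L2_rep)
  also have "\<dots> = abs_circle_L2 (\<lambda>z. c * (g z * ?x z))"
    using g by (subst mult_op_abs) (auto intro: square_integrable_scale L2_rep simp: ac_simps)
  also have "\<dots> = c *\<^sub>C mult_op g x"
    using g by (simp add: mult_op_def abs_circle_L2_scaleC square_integrable_mult_continuous L2_rep)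
  finally show ?thesis .
qed

lemma norm_mult_op_le:
  assumes g: "continuous_on circle g" and B: "\<And>z. z \<in> circle \<Longrightarrow> cmod (g z) \<le> B" "0 \<le> B"
  shows "norm (mult_op g x) \<le> B * norm x"
proof -
  have "norm (abs_circle_L2 (\<lambda>z. g z * rep_circle_L2 x z)) \<le> B * norm (abs_circle_L2 (rep_circle_L2 x))"
    using B by (intro norm_abs_circle_L2_le square_integrable_mult_continuous L2_rep g)
      (auto simp: norm_mult intro: mult_right_mono)
  then show ?thesis by (simp add: mult_op_def L2_rep)
qed

lemma bounded_linear_mult_op:
  assumes g: "continuous_on circle g"
  shows "bounded_linear (mult_op g)"
proof -
  obtain B where B: "B \<ge> 0" "\<forall>z\<in>circle. cmod (g z) \<le> B"
    using continuous_on_circle_bounded[OF g] by (elim exE conjE) (rule that)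
  show ?thesis
  proof (rule bounded_linear_intro)
    show "norm (mult_op g x) \<le> norm x * B" for x
      using norm_mult_op_le[OF g, of B x] B by (simp add: mult.commute)
  qed (simp_all add: mult_op_add[OF g] mult_op_scaleC[OF g] scaleR_scaleC)
qed

lemma mult_op_mult_op:
  assumes "continuous_on circle g" "continuous_on circle h"
  shows "mult_op g (mult_op h x) = mult_op (\<lambda>z. g z * h z) x"
  unfolding mult_op_def[of h]
  using assms by (subst mult_op_abs)
    (auto simp: mult_op_def mult.assoc intro: square_integrable_mult_continuous L2_rep)

lemma mult_op_cong_1:
  assumes "\<And>z. z \<in> circle \<Longrightarrow> g z = 1"
  shows "mult_op g x = x"
proof -
  have "continuous_on circle g \<longleftrightarrow> continuous_on circle (\<lambda>_. 1 :: complex)"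
    by (rule continuous_on_cong) (use assms in auto)
  then have g: "continuous_on circle g" by simp
  have "mult_op g x = abs_circle_L2 (rep_circle_L2 x)"
    unfolding mult_op_def using g assms
    by (intro abs_circle_L2_eqI square_integrable_mult_continuous L2_rep) auto
  then show ?thesis by (simp add: L2_rep)
qed

section \<open>Derivatives along the circle\<close>

lemma has_vector_derivative_circ: "(circ has_vector_derivative (2 * pi * \<i>) * circ t) (at t within S)"
proof -
  have "((\<lambda>z. exp (\<i> * (2 * of_real pi * z))) has_field_derivative (2 * pi * \<i>) * circ t)
      (at (of_real t))"
    by (auto intro!: derivative_eq_intros simp: cis_conv_exp)
  from has_vector_derivative_real_field[OF this] show ?thesis by (simp add: cis_conv_exp)
qed

lemma has_vector_derivative_quotient:
  fixes f :: "real \<Rightarrow> complex"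
  assumes "(f has_vector_derivative D) (at t)"
  shows "((\<lambda>s. (f s - f t) / complex_of_real (s - t)) \<longlongrightarrow> D) (at t)"
proof -
  have lim: "((\<lambda>s. norm (f s - f t - (s - t) *\<^sub>R D) / norm (s - t)) \<longlongrightarrow> 0) (at t)"
    using assms by (simp add: has_vector_derivative_def has_derivative_iff_norm)
  have "((\<lambda>s. norm ((f s - f t) / complex_of_real (s - t) - D)) \<longlongrightarrow> 0) (at t)"
  proof (rule Lim_transform_eventually[OF lim])
    show "\<forall>\<^sub>F s in at t. norm (f s - f t - (s - t) *\<^sub>R D) / norm (s - t)
        = norm ((f s - f t) / complex_of_real (s - t) - D)"
    proof (rule eventually_at_topological[THEN iffD2], intro exI[of _ UNIV] conjI ballI impI)
      fix s assume "s \<noteq> t"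
      then have "(f s - f t) / complex_of_real (s - t) - D
          = (f s - f t - (s - t) *\<^sub>R D) / complex_of_real (s - t)"
        by (simp add: scaleR_conv_of_real field_simps)
      then show "norm (f s - f t - (s - t) *\<^sub>R D) / norm (s - t)
          = norm ((f s - f t) / complex_of_real (s - t) - D)"
        by (simp add: norm_divide del: of_real_diff)
    qed auto
  qed
  then show ?thesis by (intro LIM_zero_cancel[of _ D]) (simp add: tendsto_norm_zero_iff)
qed

text \<open>The difference quotient along the circle is the quotient of those of \<open>u\<close>
  after \<open>circ\<close> and of \<open>circ\<close>, whose derivative never vanishes. A
  continuous local inverse of \<open>circ\<close> transfers the limit from the line to the
  circle.\<close>

lemma circle_derivative_of_parametrization:
  assumes D: "((\<lambda>t. u (circ t)) has_vector_derivative D) (at t)"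
  shows "(u has_field_derivative D / (2 * pi * \<i> * circ t)) (at (circ t) within circle)"
proof -
  \<comment> \<open>Division by \<open>circ t\<close> moves the branch cut of \<open>Arg\<close> to
    the antipode of \<open>circ t\<close>, so \<open>\<tau>\<close> is continuous at
    \<open>circ t\<close> for every t, including integers, where \<open>angle\<close> jumps.\<close>
  define \<tau> where "\<tau> w = t + Arg (w / circ t) / (2 * pi)" for w
  have \<tau>: "circ (\<tau> w) = w" if "w \<in> circle" for w
  proof -
    have "circ (\<tau> w) = circ t * cis (Arg (w / circ t))"
      by (simp add: \<tau>_def cis_mult distrib_left)
    also have "cis (Arg (w / circ t)) = w / circ t"
      using that by (subst cis_Arg) (auto simp: sgn_div_norm norm_divide)
    finally show ?thesis by simp
  qed
  define F where "F s = (u (circ s) - u (circ t)) / (circ s - circ t)" for s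
  have "((\<lambda>s. ((u (circ s) - u (circ t)) / complex_of_real (s - t)) /
      ((circ s - circ t) / complex_of_real (s - t))) \<longlongrightarrow> D / (2 * pi * \<i> * circ t)) (at t)"
    by (intro tendsto_divide has_vector_derivative_quotient[OF D]
        has_vector_derivative_quotient[OF has_vector_derivative_circ]) simp
  then have F: "(F \<longlongrightarrow> D / (2 * pi * \<i> * circ t)) (at t)"
    by (rule Lim_transform_eventually) (auto simp: F_def eventually_at_filter)
  have Arg1: "isCont Arg 1" by (rule continuous_at_Arg) (simp add: complex_nonpos_Reals_iff)
  have "((\<lambda>w. w / circ t) \<longlongrightarrow> circ t / circ t) (at (circ t) within circle)"
    by (intro tendsto_divide tendsto_ident_at tendsto_const) simp
  then have "((\<lambda>w. w / circ t) \<longlongrightarrow> 1) (at (circ t) within circle)" by simp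
  from isCont_tendsto_compose[OF Arg1 this]
  have "((\<lambda>w. Arg (w / circ t)) \<longlongrightarrow> Arg 1) (at (circ t) within circle)" .
  from tendsto_add[OF tendsto_const[of t] tendsto_divide[OF this tendsto_const[of "2 * pi"]]]
  have "(\<tau> \<longlongrightarrow> t) (at (circ t) within circle)"
    by (simp add: \<tau>_def[abs_def])
  moreover have ne: "\<forall>\<^sub>F w in at (circ t) within circle. \<tau> w \<noteq> t"
    unfolding eventually_at_filter
  proof (rule always_eventually, intro allI impI notI)
    fix w assume "w \<noteq> circ t" "w \<in> circle" "\<tau> w = t"
    with \<tau>[of w] show False by simp
  qed
  ultimately have "filterlim \<tau> (at t) (at (circ t) within circle)"
    by (simp add: filterlim_at)
  from filterlim_compose[OF F this]
  have "((\<lambda>w. F (\<tau> w)) \<longlongrightarrow> D / (2 * pi * \<i> * circ t)) (at (circ t) within circle)" .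
  then have "((\<lambda>w. (u w - u (circ t)) / (w - circ t)) \<longlongrightarrow> D / (2 * pi * \<i> * circ t))
      (at (circ t) within circle)"
    by (rule Lim_transform_eventually)
      (auto simp: F_def \<tau> eventually_at_filter)
  then show ?thesis by (simp add: has_field_derivative_iff)
qed

lemma parametrization_of_circle_derivative:
  assumes "(u has_field_derivative d) (at (circ t) within circle)"
  shows "((\<lambda>t. u (circ t)) has_vector_derivative (2 * pi * \<i> * circ t) * d) (at t)"
proof -
  have "(u has_field_derivative d) (at (circ t) within range circ)"
    by (rule DERIV_subset[OF assms]) auto
  from field_vector_diff_chain_within[OF has_vector_derivative_circ[of t UNIV] this]
  show ?thesis by (simp add: comp_def)
qed

section \<open>Sobolev functions\<close>

lemma AE_lborel_negligible:
  fixes P :: "'a::euclidean_space \<Rightarrow> bool"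
  assumes "AE t in lborel. P t"
  obtains N where "negligible N" "\<And>t. t \<notin> N \<Longrightarrow> P t"
proof -
  obtain N where N: "{t \<in> space lborel. \<not> P t} \<subseteq> N" "emeasure lborel N = 0" "N \<in> sets lborel"
    using assms by (rule AE_E)
  have "N \<in> null_sets lebesgue" using N by (intro null_sets_completionI null_setsI)
  then show thesis using N(1) by (intro that[of N]) (auto simp: negligible_iff_null_sets)
qed

lemma continuously_differentiable_imp_absolutely_continuous:
  fixes f :: "real \<Rightarrow> complex"
  assumes D: "\<And>t. t \<in> {p..q} \<Longrightarrow> (f has_vector_derivative D t) (at t within {p..q})"
    and cont: "continuous_on {p..q} D"
  shows "absolutely_continuous_on_Icc p q f"
proof -
  have "bounded (D ` {p..q})"
    by (intro compact_imp_bounded compact_continuous_image cont) simp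
  then obtain B where B: "\<forall>x\<in>D ` {p..q}. norm x \<le> B"
    unfolding bounded_iff by (elim exE) (rule that)
  show ?thesis
  proof (rule lipschitz_imp_absolutely_continuous)
    fix a b assume ab: "p \<le> a" "a \<le> b" "b \<le> q"
    have "norm (f b - f a) \<le> B * norm (b - a)"
    proof (rule differentiable_bound[of "{p..q}" f "\<lambda>t h. h *\<^sub>R D t"])
      fix t assume t: "t \<in> {p..q}"
      then show "(f has_derivative (\<lambda>h. h *\<^sub>R D t)) (at t within {p..q})"
        using D[OF t] by (simp add: has_vector_derivative_def)
      show "onorm (\<lambda>h. h *\<^sub>R D t) \<le> B"
      proof (rule onorm_le)
        fix h :: real
        have "norm (D t) \<le> B" using B t by (intro B[rule_format] imageI)
        then show "norm (h *\<^sub>R D t) \<le> B * norm h"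
          using mult_right_mono[of "norm (D t)" B "\<bar>h\<bar>"] by (simp add: mult.commute)
      qed
    qed (use ab in auto)
    then show "dist (f a) (f b) \<le> B * (b - a)"
      using ab by (simp add: dist_norm norm_minus_commute)
  qed
qed

text \<open>\<open>w\<close> represents the angular derivative \<open>i z du/dz\<close> of \<open>u\<close>.\<close>

definition H1_pair :: "(complex \<Rightarrow> complex) \<Rightarrow> (complex \<Rightarrow> complex) \<Rightarrow> bool" where
  "H1_pair u w \<longleftrightarrow> square_integrable u \<and> square_integrable w \<and>
    absolutely_continuous_on_Icc 0 1 (\<lambda>t. u (circ t)) \<and>
    (AE t in lborel. 0 < t \<and> t < 1 \<longrightarrow>
      ((\<lambda>t. u (circ t)) has_vector_derivative complex_of_real (2 * pi) * w (circ t)) (at t))"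

text \<open>This is \<open>d/d\<theta>\<close> for \<open>z = exp (\<i> \<theta>)\<close>; up to
  sign, \<open>L_op\<close> and \<open>L_adj\<close> are real shifts of it.\<close>

definition theta_deriv :: "circle_L2 \<Rightarrow> circle_L2" where
  "theta_deriv x = mult_op (\<lambda>z. \<i> * z) (L2_deriv x)"

lemma continuous_on_iz: "continuous_on circle (\<lambda>z. \<i> * z)"
  and continuous_on_inverse_iz: "continuous_on circle (\<lambda>z. 1 / (\<i> * z))"
  by (auto intro!: continuous_intros)

lemma H1_pair_of_H1_deriv:
  assumes "H1_deriv x y"
  obtains u w where "H1_pair u w" "abs_circle_L2 u = x" "abs_circle_L2 w = mult_op (\<lambda>z. \<i> * z) y"
proof -
  obtain u v where uv: "square_integrable u" "abs_circle_L2 u = x" "square_integrable v"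
    "abs_circle_L2 v = y" "circle_abs_continuous u"
    "AE z in circle_measure. (u has_field_derivative v z) (at z within circle)"
    using assms unfolding H1_deriv_def by (elim exE conjE) (rule that)
  have "AE t in lborel. 0 < t \<and> t < 1 \<longrightarrow>
      ((\<lambda>t. u (circ t)) has_vector_derivative 2 * pi * (\<i> * circ t * v (circ t))) (at t)"
    using uv(6) unfolding AE_circle_measure_iff
  proof (rule AE_mp, intro AE_I2 impI)
    fix t :: real
    assume "0 \<le> t \<and> t < 1 \<longrightarrow> (u has_field_derivative v (circ t)) (at (circ t) within circle)"
      "0 < t \<and> t < 1"
    then have "(u has_field_derivative v (circ t)) (at (circ t) within circle)" by simp
    from parametrization_of_circle_derivative[OF this]
    show "((\<lambda>t. u (circ t)) has_vector_derivative 2 * pi * (\<i> * circ t * v (circ t))) (at t)"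
      by (simp add: mult.assoc)
  qed
  then have "H1_pair u (\<lambda>z. \<i> * z * v z)"
    using uv square_integrable_mult_continuous[OF uv(3) continuous_on_iz]
    unfolding H1_pair_def circle_abs_continuous_def by (simp add: mult.assoc)
  moreover have "abs_circle_L2 (\<lambda>z. \<i> * z * v z) = mult_op (\<lambda>z. \<i> * z) y"
    using mult_op_abs[OF uv(3) continuous_on_iz] uv(4) by simp
  ultimately show thesis using uv(2) by (intro that)
qed

lemma H1_deriv_of_H1_pair:
  assumes "H1_pair u w"
  shows "H1_deriv (abs_circle_L2 u) (mult_op (\<lambda>z. 1 / (\<i> * z)) (abs_circle_L2 w))"
proof -
  have uw: "square_integrable u" "square_integrable w"
    "absolutely_continuous_on_Icc 0 1 (\<lambda>t. u (circ t))"
    and D: "AE t in lborel. 0 < t \<and> t < 1 \<longrightarrow>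
      ((\<lambda>t. u (circ t)) has_vector_derivative 2 * pi * w (circ t)) (at t)"
    using assms by (simp_all add: H1_pair_def)
  \<comment> \<open>\<open>H1_pair\<close> speaks about 0 < t < 1 and the circle about 0 \<le> t <
    1; the missing point is a null set.\<close>
  have "AE z in circle_measure. (u has_field_derivative 1 / (\<i> * z) * w z) (at z within circle)"
    unfolding AE_circle_measure_iff using AE_lborel_singleton[of 0] D
  proof eventually_elim
    case (elim t)
    show ?case
    proof
      assume "0 \<le> t \<and> t < 1"
      with elim have "((\<lambda>t. u (circ t)) has_vector_derivative 2 * pi * w (circ t)) (at t)" by auto
      from circle_derivative_of_parametrization[OF this]
      show "(u has_field_derivative 1 / (\<i> * circ t) * w (circ t)) (at (circ t) within circle)"
        by (rule DERIV_cong) (simp add: field_simps)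
    qed
  qed
  then show ?thesis
    unfolding H1_deriv_def circle_abs_continuous_def
    using uw mult_op_abs[OF uw(2) continuous_on_inverse_iz]
      square_integrable_mult_continuous[OF uw(2) continuous_on_inverse_iz]
    by (intro exI[of _ u] exI[of _ "\<lambda>z. 1 / (\<i> * z) * w z"]) simp
qed

text \<open>Continuous representatives of one class differ on an open subset of (0, 1) that is also
  negligible, hence empty; functions that agree on an open interval have the same derivatives
  there.\<close>

lemma H1_pair_unique:
  assumes uw: "H1_pair u w" and uw': "H1_pair u' w'" and eq: "abs_circle_L2 u = abs_circle_L2 u'"
  shows "abs_circle_L2 w = abs_circle_L2 w'"
proof -
  have si: "square_integrable u" "square_integrable u'" "square_integrable w" "square_integrable w'"
    using uw uw' by (simp_all add: H1_pair_def)
  have "AE z in circle_measure. u z = u' z"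
    using eq abs_circle_L2_eq_iff[OF si(1,2)] by simp
  then have ae: "AE t in lborel. 0 \<le> t \<and> t < 1 \<longrightarrow> u (circ t) = u' (circ t)"
    by (simp add: AE_circle_measure_iff)
  define S where "S = {0<..<1} \<inter> (\<lambda>t. u (circ t) - u' (circ t)) -` (- {0})"
  have "continuous_on {0..1} (\<lambda>t. u (circ t) - u' (circ t))"
    using uw uw' unfolding H1_pair_def
    by (intro continuous_on_diff absolutely_continuous_imp_continuous) simp_all
  then have "continuous_on {0<..<1} (\<lambda>t. u (circ t) - u' (circ t))"
    by (rule continuous_on_subset) auto
  then have "open S"
    unfolding S_def by (intro continuous_open_preimage) auto
  obtain N where N: "negligible N" "\<And>t. t \<notin> N \<Longrightarrow> 0 \<le> t \<and> t < 1 \<longrightarrow> u (circ t) = u' (circ t)"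
    using AE_lborel_negligible[OF ae] by metis
  have "S \<subseteq> N" using N(2) by (force simp: S_def)
  then have "negligible S" using N(1) negligible_subset by blast
  then have "S = {}" using open_not_negligible[OF \<open>open S\<close>] by blast
  then have same: "u (circ t) = u' (circ t)" if "t \<in> {0<..<1}" for t
    using that by (auto simp: S_def)
  have "AE t in lborel. 0 < t \<and> t < 1 \<longrightarrow>
      ((\<lambda>t. u (circ t)) has_vector_derivative 2 * pi * w (circ t)) (at t)"
    "AE t in lborel. 0 < t \<and> t < 1 \<longrightarrow>
      ((\<lambda>t. u' (circ t)) has_vector_derivative 2 * pi * w' (circ t)) (at t)"
    using uw uw' by (simp_all add: H1_pair_def)
  with AE_lborel_singleton[of 0] have "AE t in lborel. 0 \<le> t \<and> t < 1 \<longrightarrow> w (circ t) = w' (circ t)"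
  proof eventually_elim
    case (elim t)
    show ?case
    proof
      assume "0 \<le> t \<and> t < 1"
      with elim(1) have t: "t \<in> {0<..<1}" by auto
      then have 1: "((\<lambda>t. u (circ t)) has_vector_derivative 2 * pi * w (circ t)) (at t)"
        and 2: "((\<lambda>t. u' (circ t)) has_vector_derivative 2 * pi * w' (circ t)) (at t)"
        using elim(2,3) by auto
      have "((\<lambda>t. u' (circ t)) has_vector_derivative 2 * pi * w (circ t)) (at t)"
        by (rule has_vector_derivative_transform_within_open[OF 1 _ t same]) auto
      from vector_derivative_unique_at[OF this 2] show "w (circ t) = w' (circ t)" by simp
    qed
  qed
  then show ?thesis
    using abs_circle_L2_eq_iff[OF si(3,4)] by (simp add: AE_circle_measure_iff)
qed

lemma mult_op_iz_cancel: "mult_op (\<lambda>z. 1 / (\<i> * z)) (mult_op (\<lambda>z. \<i> * z) y) = y"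
  "mult_op (\<lambda>z. \<i> * z) (mult_op (\<lambda>z. 1 / (\<i> * z)) y) = y"
  by (subst mult_op_mult_op; auto intro!: continuous_on_iz continuous_on_inverse_iz mult_op_cong_1)+

text \<open>Justifies the definite description in \<open>L2_deriv\<close>: multiplication by
  \<open>\<i> * z\<close> is injective, so uniqueness of the angular derivative carries
  over.\<close>

lemma L2_deriv_eqI:
  assumes "H1_deriv x y" shows "L2_deriv x = y"
  unfolding L2_deriv_def
proof (rule the_equality[of "H1_deriv x", OF assms])
  fix y' assume y': "H1_deriv x y'"
  obtain u w where uw: "H1_pair u w" "abs_circle_L2 u = x" "abs_circle_L2 w = mult_op (\<lambda>z. \<i> * z) y"
    using assms by (rule H1_pair_of_H1_deriv)
  obtain u' w' where uw': "H1_pair u' w'" "abs_circle_L2 u' = x" "abs_circle_L2 w' = mult_op (\<lambda>z. \<i> * z) y'"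
    using y' by (rule H1_pair_of_H1_deriv)
  have "mult_op (\<lambda>z. \<i> * z) y = mult_op (\<lambda>z. \<i> * z) y'"
    using H1_pair_unique[OF uw(1) uw'(1)] uw uw' by simp
  then show "y' = y" by (metis mult_op_iz_cancel(1))
qed

lemma H1_pair_theta_deriv:
  assumes "H1_pair u w"
  shows "abs_circle_L2 u \<in> H1" "theta_deriv (abs_circle_L2 u) = abs_circle_L2 w"
  using H1_deriv_of_H1_pair[OF assms] L2_deriv_eqI[OF H1_deriv_of_H1_pair[OF assms]]
  by (auto simp: H1_def theta_deriv_def mult_op_iz_cancel)

lemma H1_obtain_pair:
  assumes "x \<in> H1"
  obtains u w where "H1_pair u w" "abs_circle_L2 u = x" "abs_circle_L2 w = theta_deriv x"
proof -
  obtain y where y: "H1_deriv x y" using assms by (auto simp: H1_def)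
  obtain u w where "H1_pair u w" "abs_circle_L2 u = x" "abs_circle_L2 w = mult_op (\<lambda>z. \<i> * z) y"
    using y by (rule H1_pair_of_H1_deriv)
  then show thesis using L2_deriv_eqI[OF y] by (intro that) (simp_all add: theta_deriv_def)
qed

section \<open>Algebraic operations on Sobolev functions\<close>

lemma H1_pair_add:
  assumes "H1_pair u w" "H1_pair u' w'"
  shows "H1_pair (\<lambda>z. u z + u' z) (\<lambda>z. w z + w' z)"
proof -
  have "AE t in lborel. 0 < t \<and> t < 1 \<longrightarrow> ((\<lambda>t. u (circ t) + u' (circ t))
      has_vector_derivative 2 * pi * (w (circ t) + w' (circ t))) (at t)"
    using assms[unfolded H1_pair_def, THEN conjunct2, THEN conjunct2, THEN conjunct2]
    by eventually_elim (auto simp: distrib_left intro: has_vector_derivative_add)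
  then show ?thesis using assms
    by (simp add: H1_pair_def square_integrable_add absolutely_continuous_add)
qed

lemma absolutely_continuous_const: "absolutely_continuous_on_Icc p q (\<lambda>_. c)"
  by (rule lipschitz_imp_absolutely_continuous[where M = 0]) simp

text \<open>Along \<open>circ\<close> the multiplier is continuously differentiable, hence
  absolutely continuous on [0, 1], and the product rule applies almost everywhere. The factor
  \<open>\<i> * z\<close> turns \<open>g'\<close> into the angular derivative of
  \<open>g\<close>.\<close>

lemma H1_pair_mult:
  assumes uw: "H1_pair u w"
    and g: "\<And>z. z \<in> circle \<Longrightarrow> (g has_field_derivative g' z) (at z within circle)"
    and g': "continuous_on circle g'"
  shows "H1_pair (\<lambda>z. g z * u z) (\<lambda>z. g z * w z + \<i> * z * g' z * u z)"
proof -
  have uw': "square_integrable u" "square_integrable w"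
    "absolutely_continuous_on_Icc 0 1 (\<lambda>t. u (circ t))"
    and D: "AE t in lborel. 0 < t \<and> t < 1 \<longrightarrow>
      ((\<lambda>t. u (circ t)) has_vector_derivative 2 * pi * w (circ t)) (at t)"
    using uw by (simp_all add: H1_pair_def)
  have gc: "continuous_on circle g"
    unfolding continuous_on_eq_continuous_within using g DERIV_continuous by blast
  have Dg: "((\<lambda>t. g (circ t)) has_vector_derivative (2 * pi * \<i> * circ t) * g' (circ t)) (at t)" for t
    by (rule parametrization_of_circle_derivative) (rule g, simp)
  have "absolutely_continuous_on_Icc 0 1 (\<lambda>t. g (circ t))"
  proof (rule continuously_differentiable_imp_absolutely_continuous)
    show "((\<lambda>t. g (circ t)) has_vector_derivative (2 * pi * \<i> * circ t) * g' (circ t))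
        (at t within {0..1})" for t
      using Dg by (rule has_vector_derivative_at_within)
    show "continuous_on {0..1} (\<lambda>t. (2 * pi * \<i> * circ t) * g' (circ t))"
      by (intro continuous_intros continuous_on_compose2[OF g']) auto
  qed
  then have "absolutely_continuous_on_Icc 0 1 (\<lambda>t. g (circ t) * u (circ t))"
    using uw'(3) by (rule absolutely_continuous_mult)
  moreover have "AE t in lborel. 0 < t \<and> t < 1 \<longrightarrow> ((\<lambda>t. g (circ t) * u (circ t))
      has_vector_derivative 2 * pi * (g (circ t) * w (circ t) + \<i> * circ t * g' (circ t) * u (circ t))) (at t)"
    using D
  proof (rule AE_mp, intro AE_I2 impI)
    fix t :: real
    assume "0 < t \<and> t < 1 \<longrightarrow> ((\<lambda>t. u (circ t)) has_vector_derivative 2 * pi * w (circ t)) (at t)"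
      "0 < t \<and> t < 1"
    then have "((\<lambda>t. u (circ t)) has_vector_derivative 2 * pi * w (circ t)) (at t)" by simp
    from has_vector_derivative_mult[OF Dg this]
    show "((\<lambda>t. g (circ t) * u (circ t)) has_vector_derivative
        2 * pi * (g (circ t) * w (circ t) + \<i> * circ t * g' (circ t) * u (circ t))) (at t)"
      by (rule has_vector_derivative_eq_rhs) (simp add: algebra_simps)
  qed
  moreover have "continuous_on circle (\<lambda>z. \<i> * z * g' z)"
    by (intro continuous_intros g')
  ultimately show ?thesis
    unfolding H1_pair_def
    using square_integrable_mult_continuous[OF uw'(1) gc]
      square_integrable_add[OF square_integrable_mult_continuous[OF uw'(2) gc]
        square_integrable_mult_continuous[OF uw'(1), of "\<lambda>z. \<i> * z * g' z"]] by simp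
qed

lemma mult_op_in_H1:
  assumes "x \<in> H1" and g: "\<And>z. z \<in> circle \<Longrightarrow> (g has_field_derivative g' z) (at z within circle)"
    and "continuous_on circle g'"
  shows "mult_op g x \<in> H1"
proof -
  obtain u w where uw: "H1_pair u w" "abs_circle_L2 u = x" "abs_circle_L2 w = theta_deriv x"
    using assms(1) by (rule H1_obtain_pair)
  have gc: "continuous_on circle g"
    unfolding continuous_on_eq_continuous_within using g DERIV_continuous by blast
  have "mult_op g x = abs_circle_L2 (\<lambda>z. g z * u z)"
    using mult_op_abs[of u g] uw gc by (simp add: H1_pair_def)
  with H1_pair_theta_deriv(1)[OF H1_pair_mult[OF uw(1) g assms(3)]] show ?thesis by simp
qed

lemma H1_add: "x \<in> H1 \<Longrightarrow> y \<in> H1 \<Longrightarrow> x + y \<in> H1"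
  and theta_deriv_add: "x \<in> H1 \<Longrightarrow> y \<in> H1 \<Longrightarrow> theta_deriv (x + y) = theta_deriv x + theta_deriv y"
proof -
  assume "x \<in> H1" "y \<in> H1"
  obtain u w where uw: "H1_pair u w" "abs_circle_L2 u = x" "abs_circle_L2 w = theta_deriv x"
    using \<open>x \<in> H1\<close> by (rule H1_obtain_pair)
  obtain u' w' where uw': "H1_pair u' w'" "abs_circle_L2 u' = y" "abs_circle_L2 w' = theta_deriv y"
    using \<open>y \<in> H1\<close> by (rule H1_obtain_pair)
  show "x + y \<in> H1" "theta_deriv (x + y) = theta_deriv x + theta_deriv y"
    using H1_pair_theta_deriv[OF H1_pair_add[OF uw(1) uw'(1)]] uw uw'
    by (simp_all add: H1_pair_def abs_circle_L2_add)
qed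

lemma H1_scaleC: "x \<in> H1 \<Longrightarrow> c *\<^sub>C x \<in> H1"
  and theta_deriv_scaleC: "x \<in> H1 \<Longrightarrow> theta_deriv (c *\<^sub>C x) = c *\<^sub>C theta_deriv x"
proof -
  assume "x \<in> H1"
  obtain u w where uw: "H1_pair u w" "abs_circle_L2 u = x" "abs_circle_L2 w = theta_deriv x"
    using \<open>x \<in> H1\<close> by (rule H1_obtain_pair)
  have "H1_pair (\<lambda>z. c * u z) (\<lambda>z. c * w z + \<i> * z * 0 * u z)"
    using uw(1) by (rule H1_pair_mult) (auto intro!: derivative_eq_intros)
  then show "c *\<^sub>C x \<in> H1" "theta_deriv (c *\<^sub>C x) = c *\<^sub>C theta_deriv x"
    using H1_pair_theta_deriv[of "\<lambda>z. c * u z" "\<lambda>z. c * w z"] uw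
    by (simp_all add: H1_pair_def abs_circle_L2_scaleC)
qed

lemma H1_pair_has_integral:
  fixes u w :: "complex \<Rightarrow> complex"
  assumes "H1_pair u w" "0 \<le> a" "a \<le> b" "b \<le> 1"
  shows "((\<lambda>t. 2 * pi * w (circ t)) has_integral (u (circ b) - u (circ a))) {a..b}"
proof -
  have ac: "absolutely_continuous_on_Icc 0 1 (\<lambda>t. u (circ t))"
    and D: "AE t in lborel. 0 < t \<and> t < 1 \<longrightarrow>
      ((\<lambda>t. u (circ t)) has_vector_derivative 2 * pi * w (circ t)) (at t)"
    using assms(1) by (simp_all add: H1_pair_def)
  obtain N where N: "negligible N" "\<And>t. t \<notin> N \<Longrightarrow> 0 < t \<and> t < 1 \<longrightarrow>
      ((\<lambda>t. u (circ t)) has_vector_derivative 2 * pi * w (circ t)) (at t)"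
    using AE_lborel_negligible[OF D] by metis
  show ?thesis
  proof (rule fundamental_theorem_of_calculus_absolutely_continuous[where f = "\<lambda>t. u (circ t)"])
    show "absolutely_continuous_on_Icc a b (\<lambda>t. u (circ t))"
      using ac assms by (intro absolutely_continuous_on_Icc_subset[OF ac])
    show "negligible (N \<union> {0, 1})" using N(1) by simp
    fix t assume "t \<in> {a..b} - (N \<union> {0, 1})"
    then have "0 < t \<and> t < 1" "t \<notin> N" using assms by auto
    then show "((\<lambda>t. u (circ t)) has_vector_derivative 2 * pi * w (circ t)) (at t within {a..b})"
      using N(2) has_vector_derivative_at_within by blast
  qed fact
qed

text \<open>Integrate the derivative of \<open>\<bar>u\<bar>\<^sup>2\<close> over one period. Since
  \<open>inner\<close> is the real part of \<open>cinner\<close>, this vanishing is all that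
  skew-symmetry has to say about a single vector.\<close>

lemma theta_deriv_skew:
  assumes "x \<in> H1"
  shows "inner (theta_deriv x) x = 0"
proof -
  obtain u w where uw: "H1_pair u w" "abs_circle_L2 u = x" "abs_circle_L2 w = theta_deriv x"
    using assms by (rule H1_obtain_pair)
  have si: "square_integrable u" "square_integrable w"
    and ac: "absolutely_continuous_on_Icc 0 1 (\<lambda>t. u (circ t))"
    and D: "AE t in lborel. 0 < t \<and> t < 1 \<longrightarrow>
      ((\<lambda>t. u (circ t)) has_vector_derivative 2 * pi * w (circ t)) (at t)"
    using uw(1) by (simp_all add: H1_pair_def)
  \<comment> \<open>The angular derivative of \<open>u z * cnj (u z)\<close>.\<close>
  define F where "F z = w z * cnj (u z) + u z * cnj (w z)" for z
  have int: "integrable circle_measure (\<lambda>z. w z * cnj (u z))"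
    "integrable circle_measure (\<lambda>z. u z * cnj (w z))"
    by (intro square_integrable_mult si)+
  then have Fint: "integrable circle_measure F" unfolding F_def by simp
  then have Fm: "F \<in> borel_measurable circle_measure" by simp
  obtain N where N: "negligible N" "\<And>t. t \<notin> N \<Longrightarrow> 0 < t \<and> t < 1 \<longrightarrow>
      ((\<lambda>t. u (circ t)) has_vector_derivative 2 * pi * w (circ t)) (at t)"
    using AE_lborel_negligible[OF D] by metis
  have "((\<lambda>t. 2 * pi * F (circ t)) has_integral
      (u (circ 1) * cnj (u (circ 1)) - u (circ 0) * cnj (u (circ 0)))) {0..1}"
  proof (rule fundamental_theorem_of_calculus_absolutely_continuous)
    have "absolutely_continuous_on_Icc 0 1 (\<lambda>t. cnj (u (circ t)))"
      by (rule absolutely_continuous_combine[OF ac ac, where M = 1])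
        (simp add: dist_norm flip: complex_cnj_diff)
    then show "absolutely_continuous_on_Icc 0 1 (\<lambda>t. u (circ t) * cnj (u (circ t)))"
      by (rule absolutely_continuous_mult[OF ac])
    show "negligible (N \<union> {0, 1})" using N(1) by simp
    fix t :: real assume "t \<in> {0..1} - (N \<union> {0, 1})"
    then have 1: "((\<lambda>t. u (circ t)) has_vector_derivative 2 * pi * w (circ t)) (at t)"
      using N(2)[of t] by auto
    have 2: "((\<lambda>t. cnj (u (circ t))) has_vector_derivative cnj (2 * pi * w (circ t))) (at t)"
      by (rule bounded_linear.has_vector_derivative[OF bounded_linear_cnj 1])
    have "((\<lambda>t. u (circ t) * cnj (u (circ t))) has_vector_derivative 2 * pi * F (circ t)) (at t)"
      by (rule has_vector_derivative_eq_rhs[OF has_vector_derivative_mult[OF 1 2]])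
        (simp add: F_def algebra_simps)
    then show "((\<lambda>t. u (circ t) * cnj (u (circ t))) has_vector_derivative 2 * pi * F (circ t))
        (at t within {0..1})" by (rule has_vector_derivative_at_within)
  qed simp
  \<comment> \<open>The boundary terms cancel because \<open>circ 0\<close> and
    \<open>circ 1\<close> are both the point 1: periodicity is built into functions on the
    circle.\<close>
  then have "((\<lambda>t. 2 * pi * F (circ t)) has_integral 0) {0..1}" by simp
  from has_integral_mult_right[OF this, of "1 / (2 * complex_of_real pi)"]
  have "((\<lambda>t. F (circ t)) has_integral 0) {0..1}" by simp
  then have HK: "((\<lambda>t. F (circ t)) has_integral 0) {0..<1}"
    by (subst (asm) has_integral_spike_set_eq[where T = "{0..<1}"])
      (auto intro: negligible_subset[of "{1}"])
  have "set_integrable lborel {0..<1} (\<lambda>t. F (circ t))"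
    using Fint integrable_circle_measure_iff[OF Fm] by simp
  then have "(LINT t:{0..<1}|lborel. F (circ t)) = 0"
    using set_borel_integral_eq_integral(2) integral_unique[OF HK] by metis
  then have "0 = (\<integral>z. F z \<partial>circle_measure)"
    using integral_circle_measure[OF Fm] by simp
  also have "\<dots> = cinner (theta_deriv x) x + cinner x (theta_deriv x)"
    unfolding F_def
    using int cinner_abs_circle_L2[OF si(2,1)] cinner_abs_circle_L2[OF si] uw(2,3) by simp
  finally have "Re (cinner (theta_deriv x) x) + Re (cinner x (theta_deriv x)) = 0"
    by (metis plus_complex.sel(1) zero_complex.sel(1))
  then show ?thesis by (simp add: inner_commute flip: inner_eq_Re_cinner)
qed

text \<open>Pythagoras: for the real inner product \<open>x\<close> is orthogonal to its angular
  derivative, and a real shift keeps it so. This one identity bounds both the inverse and the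
  derivative of its values.\<close>

lemma norm_theta_deriv_minus:
  assumes "x \<in> H1"
  shows "(norm (theta_deriv x - s *\<^sub>R x))\<^sup>2 = (norm (theta_deriv x))\<^sup>2 + s\<^sup>2 * (norm x)\<^sup>2"
proof -
  let ?a = "theta_deriv x"
  have "inner (?a - s *\<^sub>R x) (?a - s *\<^sub>R x) = inner ?a ?a - 2 * s * inner ?a x + s\<^sup>2 * inner x x"
    by (simp add: inner_diff_left inner_diff_right inner_commute power2_eq_square algebra_simps)
  then show ?thesis by (simp add: power2_norm_eq_inner theta_deriv_skew[OF assms])
qed

section \<open>The inverse of the angular derivative\<close>

text \<open>The composite may jump at z = 1, where \<open>g 0\<close> and \<open>g 1\<close> meet,
  so measurability comes from \<open>angle\<close> and not from continuity on the circle.\<close>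

lemma square_integrable_angle:
  fixes g :: "real \<Rightarrow> complex"
  assumes g: "continuous_on {0..1} g"
  shows "square_integrable (\<lambda>z. g (angle z))"
proof -
  have "bounded (g ` {0..1})"
    by (intro compact_imp_bounded compact_continuous_image g) simp
  then obtain B where B: "\<forall>x\<in>g ` {0..1}. norm x \<le> B"
    unfolding bounded_iff by (elim exE) (rule that)
  have m: "(\<lambda>t. indicator {0..1} t *\<^sub>R g t) \<in> borel_measurable borel"
    by (rule borel_measurable_continuous_on_indicator) (use g in auto)
  have ab: "angle z \<in> {0..1}" for z using angle_bounds[of z] by simp
  have "(\<lambda>z. indicator {0..1} (angle z) *\<^sub>R g (angle z)) \<in> borel_measurable borel"
    by (rule measurable_compose[OF borel_measurable_angle m])
  then have "(\<lambda>z. g (angle z)) \<in> borel_measurable borel" using ab by simp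
  then have "(\<lambda>z. g (angle z)) \<in> borel_measurable circle_measure"
    using measurable_restrict_space1 sets_circle_measure measurable_cong_sets by blast
  then show ?thesis
    by (rule square_integrable_bounded[where B = B]) (use B ab in blast)
qed

lemma norm_abs_circle_L2_const: "norm (abs_circle_L2 (\<lambda>_. c)) = cmod c"
proof -
  have si: "square_integrable (\<lambda>_. c)" by (rule square_integrable_continuous) simp
  have "(norm (abs_circle_L2 (\<lambda>_. c)))\<^sup>2 = (LINT t:{0..<1::real}|lborel. (cmod c)\<^sup>2)"
    unfolding norm_abs_circle_L2[OF si] by (rule integral_circle_measure) simp
  also have "\<dots> = (cmod c)\<^sup>2" by (simp add: set_lebesgue_integral_def)
  finally show ?thesis by simp
qed

lemma norm_abs_circle_L2_le_const:
  assumes "square_integrable f" "\<And>z. z \<in> circle \<Longrightarrow> cmod (f z) \<le> B" "0 \<le> B"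
  shows "norm (abs_circle_L2 f) \<le> B"
proof -
  have "norm (abs_circle_L2 f) \<le> B * norm (abs_circle_L2 (\<lambda>_. 1))"
    using assms by (intro norm_abs_circle_L2_le) (auto intro: square_integrable_continuous)
  then show ?thesis by (simp add: norm_abs_circle_L2_const)
qed

text \<open>A Hoelder estimate of exponent 1/2 with its optimisation left open: \<open>c = 1\<close>
  bounds the oscillation of \<open>u\<close>, and a large \<open>c\<close> gives
  equicontinuity.\<close>

lemma H1_pair_increment:
  assumes uw: "H1_pair u w" and B: "norm (abs_circle_L2 w) \<le> B" and "c > 0"
    and ab: "0 \<le> a" "a \<le> b" "b \<le> 1"
  shows "cmod (u (circ b) - u (circ a)) \<le> pi * (c * (b - a) + B\<^sup>2 / c)"
proof -
  have w: "square_integrable w" using uw by (simp add: H1_pair_def)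
  have wm: "w \<in> borel_measurable circle_measure"
    and w2: "integrable circle_measure (\<lambda>z. (cmod (w z))\<^sup>2)"
    using w by (auto simp: square_integrable_def)
  have "square_integrable (\<lambda>_. 1)" by (rule square_integrable_continuous) simp
  from square_integrable_mult[OF w this] have w1: "integrable circle_measure w" by simp
  have wm2: "(\<lambda>z. (cmod (w z))\<^sup>2) \<in> borel_measurable circle_measure" using wm by measurable
  have S1: "set_integrable lborel {0..<1} (\<lambda>t. w (circ t))"
    using w1 integrable_circle_measure_iff[OF wm] by simp
  have S2: "set_integrable lborel {0..<1} (\<lambda>t. (cmod (w (circ t)))\<^sup>2)"
    using w2 integrable_circle_measure_iff[OF wm2] by simp
  have sub: "{a<..<b} \<subseteq> {0..<1}" using ab by auto
  have s1: "set_integrable lborel {a<..<b} (\<lambda>t. w (circ t))"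
    by (rule set_integrable_subset[OF S1 _ sub]) simp
  have s2: "set_integrable lborel {a<..<b} (\<lambda>t. (cmod (w (circ t)))\<^sup>2)"
    by (rule set_integrable_subset[OF S2 _ sub]) simp
  have "(LINT t:{a<..<b}|lborel. (cmod (w (circ t)))\<^sup>2) \<le> (LINT t:{0..<1}|lborel. (cmod (w (circ t)))\<^sup>2)"
    unfolding set_lebesgue_integral_def
  proof (rule integral_mono)
    show "indicat_real {a<..<b} t *\<^sub>R (cmod (w (circ t)))\<^sup>2
        \<le> indicat_real {0..<1} t *\<^sub>R (cmod (w (circ t)))\<^sup>2" for t
      using ab by (auto simp: indicator_def)
  qed (use s2 S2 in \<open>simp_all add: set_integrable_def\<close>)
  also have "\<dots> = (norm (abs_circle_L2 w))\<^sup>2"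
    by (simp add: norm_abs_circle_L2[OF w] integral_circle_measure[OF wm2])
  also have "\<dots> \<le> B\<^sup>2" using B by (intro power_mono) auto
  finally have le: "(LINT t:{a<..<b}|lborel. (cmod (w (circ t)))\<^sup>2) \<le> B\<^sup>2" .
  have fin: "emeasure lborel {a<..<b} < \<infinity>" using emeasure_lborel_box_finite[of a b] by (simp add: box_real)
  have "cmod (LINT t:{a<..<b}|lborel. w (circ t))
      \<le> (c * measure lborel {a<..<b} + (LINT t:{a<..<b}|lborel. (cmod (w (circ t)))\<^sup>2) / c) / 2"
    by (rule norm_integral_le_weighted_square[OF s1 _ fin s2 \<open>c > 0\<close>]) simp
  also have "\<dots> \<le> (c * (b - a) + B\<^sup>2 / c) / 2"
    using ab le \<open>c > 0\<close> by (intro divide_right_mono add_mono) auto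
  finally have I: "cmod (LINT t:{a<..<b}|lborel. w (circ t)) \<le> (c * (b - a) + B\<^sup>2 / c) / 2" .
  have "u (circ b) - u (circ a) = integral {a..b} (\<lambda>t. complex_of_real (2 * pi) * w (circ t))"
    using integral_unique[OF H1_pair_has_integral[OF uw ab]] by simp
  also have "\<dots> = integral {a<..<b} (\<lambda>t. complex_of_real (2 * pi) * w (circ t))"
    by (rule integral_spike_set) (auto intro: negligible_subset[of "{a, b}"])
  also have "\<dots> = complex_of_real (2 * pi) * integral {a<..<b} (\<lambda>t. w (circ t))"
    by (rule integral_mult_right)
  also have "integral {a<..<b} (\<lambda>t. w (circ t)) = (LINT t:{a<..<b}|lborel. w (circ t))"
    using set_borel_integral_eq_integral(2)[OF s1] by simp
  finally have "cmod (u (circ b) - u (circ a)) = 2 * pi * cmod (LINT t:{a<..<b}|lborel. w (circ t))"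
    by (simp add: norm_mult)
  also have "\<dots> \<le> 2 * pi * ((c * (b - a) + B\<^sup>2 / c) / 2)"
    using I by (intro mult_left_mono) auto
  finally show ?thesis by simp
qed

text \<open>Rellich's theorem on the circle. The bound on the derivatives gives equicontinuity, the
  bound on the functions a uniform bound, and the uniform limit from Arzela-Ascoli is also a limit
  in \<open>L\<^sup>2\<close> since the measure has total mass 1.\<close>

lemma H1_bounded_sequence_convergent_subsequence:
  fixes x :: "nat \<Rightarrow> circle_L2"
  assumes x: "\<And>k. x k \<in> H1" and B: "\<And>k. norm (x k) \<le> B" "\<And>k. norm (theta_deriv (x k)) \<le> B"
  shows "\<exists>r l. strict_mono r \<and> (\<lambda>k. x (r k)) \<longlonglongrightarrow> l"
proof -
  have "0 \<le> B" using B(1)[of 0] norm_ge_zero order_trans by blast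
  have "\<exists>u w. H1_pair u w \<and> abs_circle_L2 u = x k \<and> abs_circle_L2 w = theta_deriv (x k)" for k
    using H1_obtain_pair[OF x[of k]] by metis
  then obtain u w where uw: "\<And>k. H1_pair (u k) (w k)" "\<And>k. abs_circle_L2 (u k) = x k"
    "\<And>k. abs_circle_L2 (w k) = theta_deriv (x k)" by metis
  have si: "square_integrable (u k)" for k using uw(1)[of k] by (simp add: H1_pair_def)
  have incr: "cmod (u k (circ b) - u k (circ a)) \<le> pi * (c * \<bar>b - a\<bar> + B\<^sup>2 / c)"
    if "c > 0" "a \<in> {0..1}" "b \<in> {0..1}" for k a b c
  proof (cases "a \<le> b")
    case True
    then show ?thesis
      using H1_pair_increment[OF uw(1)[of k], of B c a b] B(2)[of k] uw(3)[of k] that by simp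
  next
    case False
    then show ?thesis
      using H1_pair_increment[OF uw(1)[of k], of B c b a] B(2)[of k] uw(3)[of k] that
      by (simp add: norm_minus_commute)
  qed
  \<comment> \<open>Bound for the oscillation: the increment estimate with \<open>c = 1\<close> on
    an interval of length at most 1.\<close>
  define K where "K = pi * (1 + B\<^sup>2)"
  \<comment> \<open>A value above \<open>B + K\<close> at one point would force a constant above
    \<open>B\<close> below the modulus on the whole circle, contradicting the bound on the
    norm.\<close>
  have bound: "cmod (u k (circ t)) \<le> B + K" if t: "t \<in> {0..1}" for k t
  proof (rule ccontr)
    assume "\<not> cmod (u k (circ t)) \<le> B + K"
    then have big: "cmod (u k (circ t)) - K > B" by simp
    have "norm (abs_circle_L2 (\<lambda>_. complex_of_real (cmod (u k (circ t)) - K)))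
        \<le> 1 * norm (abs_circle_L2 (u k))"
    proof (rule norm_abs_circle_L2_le[OF _ si])
      show "square_integrable (\<lambda>_. complex_of_real (cmod (u k (circ t)) - K))"
        by (rule square_integrable_continuous) simp
      fix z :: complex assume z: "z \<in> circle"
      have s: "angle z \<in> {0..1}" using angle_bounds[of z] by simp
      have "cmod (u k (circ (angle z)) - u k (circ t)) \<le> pi * (1 * \<bar>angle z - t\<bar> + B\<^sup>2 / 1)"
        using s t by (intro incr) auto
      also have "\<dots> \<le> K" unfolding K_def using s t by (intro mult_left_mono) auto
      finally have "cmod (u k (circ t)) - K \<le> cmod (u k z)"
        using norm_triangle_ineq2[of "u k (circ t)" "u k z"] circ_angle[OF z]
        by (simp add: norm_minus_commute)
      then show "cmod (complex_of_real (cmod (u k (circ t)) - K)) \<le> 1 * cmod (u k z)"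
        using big \<open>0 \<le> B\<close> by (simp only: norm_of_real)
    qed simp
    then have "cmod (u k (circ t)) - K \<le> norm (x k)"
      unfolding norm_abs_circle_L2_const uw(2) norm_of_real by simp
    with big B(1)[of k] show False by simp
  qed
  obtain g r where g: "continuous_on {0..1} g" and r: "strict_mono (r :: nat \<Rightarrow> nat)"
    and lim: "\<And>e. 0 < e \<Longrightarrow> \<exists>N. \<forall>n t. N \<le> n \<and> t \<in> {0..1} \<longrightarrow> norm (u (r n) (circ t) - g t) < e"
  proof (rule Arzela_Ascoli[of "{0..1::real}" "\<lambda>k t. u k (circ t)" "B + K"])
    fix a e :: real assume a: "a \<in> {0..1}" and "0 < e"
    \<comment> \<open>Chosen so that \<open>pi * (B\<^sup>2 + 1) / c\<close> equals
      \<open>e / 2\<close>; the \<open>+ 1\<close> keeps \<open>c\<close> positive for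
      \<open>B = 0\<close>. The distance bound below then handles the other half of
      \<open>e\<close>.\<close>
    define c where "c = 2 * pi * (B\<^sup>2 + 1) / e"
    have "B\<^sup>2 + 1 > 0" by (simp add: add_nonneg_pos)
    then have "c > 0" using \<open>0 < e\<close> by (simp add: c_def)
    have "pi * (B\<^sup>2 / c) < pi * ((B\<^sup>2 + 1) / c)"
      using \<open>c > 0\<close> by (simp add: divide_strict_right_mono)
    also have "\<dots> = e / 2" unfolding c_def using \<open>B\<^sup>2 + 1 > 0\<close> by simp
    finally have c: "pi * (B\<^sup>2 / c) < e / 2" .
    show "\<exists>d>0. \<forall>n y. y \<in> {0..1} \<and> norm (a - y) < d \<longrightarrow> norm (u n (circ a) - u n (circ y)) < e"
    proof (intro exI[of _ "e / (2 * pi * c)"] conjI allI impI)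
      fix n y assume y: "y \<in> {0..1} \<and> norm (a - y) < e / (2 * pi * c)"
      then have "pi * (c * \<bar>a - y\<bar>) < e / 2"
        using \<open>c > 0\<close> by (simp add: field_simps)
      moreover have "norm (u n (circ a) - u n (circ y)) \<le> pi * (c * \<bar>a - y\<bar> + B\<^sup>2 / c)"
        using y a \<open>c > 0\<close> by (intro incr) auto
      ultimately show "norm (u n (circ a) - u n (circ y)) < e"
        using c unfolding distrib_left by linarith
    qed (use \<open>0 < e\<close> \<open>c > 0\<close> in simp)
  qed (use bound in auto)
  have gs: "square_integrable (\<lambda>z. g (angle z))" by (rule square_integrable_angle[OF g])
  have "(\<lambda>k. x (r k)) \<longlonglongrightarrow> abs_circle_L2 (\<lambda>z. g (angle z))"
  proof (rule LIMSEQ_I)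
    fix e :: real assume "0 < e"
    obtain N where N: "\<And>n t. N \<le> n \<Longrightarrow> t \<in> {0..1} \<Longrightarrow> norm (u (r n) (circ t) - g t) < e / 2"
      using lim[of "e / 2"] \<open>0 < e\<close> by auto
    have "norm (x (r n) - abs_circle_L2 (\<lambda>z. g (angle z))) < e" if "N \<le> n" for n
    proof -
      have "norm (abs_circle_L2 (\<lambda>z. u (r n) z - g (angle z))) \<le> e / 2"
      proof (rule norm_abs_circle_L2_le_const)
        fix z :: complex assume "z \<in> circle"
        then show "cmod (u (r n) z - g (angle z)) \<le> e / 2"
          using N[OF that, of "angle z"] angle_bounds[of z] circ_angle[of z] by simp
      qed (use \<open>0 < e\<close> in \<open>auto intro: square_integrable_diff si gs\<close>)
      then show ?thesis using \<open>0 < e\<close> by (simp add: abs_circle_L2_diff si gs uw(2))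
    qed
    then show "\<exists>N. \<forall>n\<ge>N. norm (x (r n) - abs_circle_L2 (\<lambda>z. g (angle z))) < e" by blast
  qed
  with r show ?thesis by (intro exI conjI)
qed

text \<open>The solution is \<open>u(t) = exp (2 pi s t) (c + 2 pi \<integral>\<^sub>0\<^sup>t exp (-2 pi s \<tau>) y(\<tau>) d\<tau>)\<close>, and for
  \<open>s \<noteq> 0\<close> the constant \<open>c\<close> can be chosen such that \<open>u\<close> is periodic.\<close>

lemma theta_deriv_minus_surj:
  assumes "s \<noteq> 0"
  shows "\<exists>x\<in>H1. theta_deriv x - s *\<^sub>R x = y"
proof -
  define g where "g = rep_circle_L2 y"
  have g: "square_integrable g" "abs_circle_L2 g = y" by (simp_all add: g_def L2_rep)
  define k where "k z = complex_of_real (2 * pi) * exp (- (2 * pi * s * complex_of_real (angle z))) * g z" for z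
  have "square_integrable (\<lambda>z. complex_of_real (2 * pi) * exp (- (2 * pi * s * complex_of_real (angle z))))"
    by (rule square_integrable_angle[where g = "\<lambda>t. complex_of_real (2 * pi) * exp (- (2 * pi * s * complex_of_real t))"])
      (intro continuous_intros)
  then have m: "(\<lambda>z. complex_of_real (2 * pi) * exp (- (2 * pi * s * complex_of_real (angle z))))
      \<in> borel_measurable circle_measure" by (simp add: square_integrable_def)
  have "continuous_on {0..1::real} (\<lambda>t. complex_of_real (2 * pi) * exp (- (2 * pi * s * complex_of_real t)))"
    by (intro continuous_intros)
  then have "bounded ((\<lambda>t. complex_of_real (2 * pi) * exp (- (2 * pi * s * complex_of_real t))) ` {0..1::real})"
    by (intro compact_imp_bounded compact_continuous_image) simp_all
  then obtain B where B: "\<forall>z\<in>(\<lambda>t. complex_of_real (2 * pi) * exp (- (2 * pi * s * complex_of_real t))) ` {0..1}. cmod z \<le> B"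
    unfolding bounded_iff by (elim exE) (rule that)
  have ksi: "square_integrable k"
    unfolding k_def
  proof (rule square_integrable_mult_bounded[OF g(1) m], intro ballI)
    fix z show "cmod (complex_of_real (2 * pi) * exp (- (2 * pi * s * complex_of_real (angle z)))) \<le> B"
      using angle_bounds[of z] by (intro B[rule_format] image_eqI[of _ _ "angle z"]) auto
  qed
  have km: "k \<in> borel_measurable circle_measure"
    and k2: "integrable circle_measure (\<lambda>z. (cmod (k z))\<^sup>2)"
    using ksi by (auto simp: square_integrable_def)
  have "square_integrable (\<lambda>_. 1)" by (rule square_integrable_continuous) simp
  from square_integrable_mult[OF ksi this] have k1: "integrable circle_measure k" by simp
  have km2: "(\<lambda>z. (cmod (k z))\<^sup>2) \<in> borel_measurable circle_measure" using km by measurable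
  \<comment> \<open>Integrals over the circle run over [0, 1), the calculus over [0, 1]; with the
    value 0 at t = 1 the two integrands coincide on the nose.\<close>
  define v where "v t = (if 0 \<le> t \<and> t < 1 then k (circ t) else 0)" for t :: real
  have v: "set_integrable lborel {0..1} v"
  proof -
    have "(\<lambda>t. indicator {0..1} t *\<^sub>R v t) = (\<lambda>t. indicator {0..<1} t *\<^sub>R k (circ t))"
      by (auto simp: v_def indicator_def fun_eq_iff)
    then show ?thesis
      using k1 integrable_circle_measure_iff[OF km] by (simp add: set_integrable_def)
  qed
  have v2: "set_integrable lborel {0..1} (\<lambda>t. (cmod (v t))\<^sup>2)"
  proof -
    have "(\<lambda>t. indicator {0..1} t *\<^sub>R (cmod (v t))\<^sup>2) = (\<lambda>t. indicator {0..<1} t *\<^sub>R (cmod (k (circ t)))\<^sup>2)"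
      by (auto simp: v_def indicator_def fun_eq_iff)
    then show ?thesis
      using k2 integrable_circle_measure_iff[OF km2] by (simp add: set_integrable_def)
  qed
  define P where "P t = integral {0..t} v" for t
  define E where "E t = exp (2 * pi * s * complex_of_real t)" for t
  \<comment> \<open>The solution of \<open>E 1 * (c + P 1) = c\<close>, which says
    \<open>U 1 = U 0\<close>.\<close>
  define c where "c = E 1 * P 1 / (1 - E 1)"
  define U where "U t = E t * (c + P t)" for t
  define u where "u z = U (angle z)" for z
  have "E 1 = complex_of_real (exp (2 * pi * s))" by (simp add: E_def exp_of_real[symmetric])
  \<comment> \<open>Here a real \<open>s \<noteq> 0\<close> is essential: the factor gained over one
    period differs from 1, so the equation for \<open>c\<close> is solvable.\<close>
  moreover have "exp (2 * pi * s) \<noteq> 1" using \<open>s \<noteq> 0\<close> by simp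
  ultimately have "E 1 \<noteq> 1" by (metis of_real_eq_1_iff)
  then have "U 1 = c" by (simp add: U_def c_def field_simps)
  moreover have "U 0 = c" by (simp add: U_def E_def P_def)
  ultimately have periodic: "U 1 = U 0" by simp
  have angle1: "angle 1 = 0" using angle_circ[of 0] by simp
  have u_circ: "u (circ t) = U t" if "t \<in> {0..1}" for t
    using that periodic angle_circ[of t] angle1 by (cases "t = 1") (auto simp: u_def)
  have dE: "(E has_vector_derivative complex_of_real (2 * pi * s) * E t) (at t within S)" for t S
  proof -
    have "((\<lambda>z. exp (2 * pi * s * z)) has_field_derivative complex_of_real (2 * pi * s) * E t) (at (complex_of_real t))"
      by (auto intro!: derivative_eq_intros simp: E_def)
    from has_vector_derivative_real_field[OF this] show ?thesis by (simp add: E_def[abs_def])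
  qed
  have acE: "absolutely_continuous_on_Icc 0 1 E"
  proof (rule continuously_differentiable_imp_absolutely_continuous[OF dE])
    show "continuous_on {0..1} (\<lambda>t. complex_of_real (2 * pi * s) * E t)"
      unfolding E_def by (intro continuous_intros)
  qed
  have acU: "absolutely_continuous_on_Icc 0 1 U"
    unfolding U_def P_def
    by (intro absolutely_continuous_mult acE absolutely_continuous_add absolutely_continuous_const
        indefinite_integral_absolutely_continuous v v2)
  have acu: "absolutely_continuous_on_Icc 0 1 (\<lambda>t. u (circ t))"
    by (rule absolutely_continuous_combine[OF acU acU, where M = 1]) (simp add: u_circ)
  have usi: "square_integrable u"
    unfolding u_def by (rule square_integrable_angle[OF absolutely_continuous_imp_continuous[OF acU]])
  \<comment> \<open>Read off from the equation to be solved. Differentiating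
    \<open>U = E * (c + P)\<close> gives \<open>2 * pi * s * U\<close> plus \<open>E * v\<close>,
    and the exponentials in \<open>E * v\<close> cancel to \<open>2 * pi * g\<close>.\<close>
  define w where "w z = complex_of_real s * u z + g z" for z
  have wsi: "square_integrable w"
    unfolding w_def by (intro square_integrable_add square_integrable_scale usi g)
  obtain N where N: "negligible N" "\<And>t. t \<in> {0<..<1} - N \<Longrightarrow> (P has_vector_derivative v t) (at t)"
    using indefinite_integral_has_vector_derivative[OF set_borel_integral_eq_integral(1)[OF v]]
    unfolding P_def by metis
  have D: "((\<lambda>t. u (circ t)) has_vector_derivative complex_of_real (2 * pi) * w (circ t)) (at t)"
    if t: "t \<in> {0<..<1} - N" for t
  proof (rule has_vector_derivative_transform_within_open[of U _ t "{0<..<1}"])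
    have P': "((\<lambda>t. c + P t) has_vector_derivative v t) (at t)"
      using has_vector_derivative_add[OF has_vector_derivative_const N(2)[OF t]] by simp
    have vt: "v t = complex_of_real (2 * pi) * exp (- (2 * pi * s * complex_of_real t)) * g (circ t)"
      using t angle_circ[of t] by (simp add: v_def k_def)
    have "E t * v t = E t * exp (- (2 * pi * s * complex_of_real t)) * (complex_of_real (2 * pi) * g (circ t))"
      unfolding vt by (simp only: ac_simps)
    also have "E t * exp (- (2 * pi * s * complex_of_real t)) = 1"
      by (simp add: E_def exp_add[symmetric])
    finally have Ev: "E t * v t = complex_of_real (2 * pi) * g (circ t)" by simp
    show "(U has_vector_derivative complex_of_real (2 * pi) * w (circ t)) (at t)"
      unfolding U_def[abs_def]
    proof (rule has_vector_derivative_eq_rhs[OF has_vector_derivative_mult[OF dE P']])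
      have "u (circ t) = E t * (c + P t)" using u_circ[of t] t by (simp add: U_def)
      then show "E t * v t + complex_of_real (2 * pi * s) * E t * (c + P t) = complex_of_real (2 * pi) * w (circ t)"
        unfolding Ev w_def by (simp add: algebra_simps)
    qed
  qed (use t u_circ in auto)
  have "N \<in> null_sets lebesgue" using N(1) by (simp add: negligible_iff_null_sets)
  then have "AE t in lebesgue. t \<notin> N" by (rule AE_not_in)
  then have "AE t in lborel. t \<notin> N" by (simp add: AE_completion_iff)
  then have "AE t in lborel. 0 < t \<and> t < 1 \<longrightarrow>
      ((\<lambda>t. u (circ t)) has_vector_derivative complex_of_real (2 * pi) * w (circ t)) (at t)"
    by eventually_elim (use D in auto)
  then have uw: "H1_pair u w" unfolding H1_pair_def using usi wsi acu by blast
  have "theta_deriv (abs_circle_L2 u) = s *\<^sub>R abs_circle_L2 u + y"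
    unfolding H1_pair_theta_deriv(2)[OF uw] w_def using usi g
    by (simp add: abs_circle_L2_add square_integrable_scale abs_circle_L2_scaleC scaleR_scaleC)
  with H1_pair_theta_deriv(1)[OF uw] show ?thesis
    by (intro bexI[of _ "abs_circle_L2 u"]) simp_all
qed

lemma H1_diff: "x \<in> H1 \<Longrightarrow> y \<in> H1 \<Longrightarrow> x - y \<in> H1"
  and theta_deriv_diff: "x \<in> H1 \<Longrightarrow> y \<in> H1 \<Longrightarrow> theta_deriv (x - y) = theta_deriv x - theta_deriv y"
  using H1_add[of x "(- 1) *\<^sub>C y"] theta_deriv_add[of x "(- 1) *\<^sub>C y"]
    H1_scaleC[of y "- 1"] theta_deriv_scaleC[of y "- 1"] by (auto simp: scaleC_minus_left)

lemma theta_deriv_minus_lower_bound: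
  assumes "x \<in> H1"
  shows "\<bar>s\<bar> * norm x \<le> norm (theta_deriv x - s *\<^sub>R x)"
    and "norm (theta_deriv x) \<le> norm (theta_deriv x - s *\<^sub>R x)"
proof -
  note n = norm_theta_deriv_minus[OF assms, of s]
  show "\<bar>s\<bar> * norm x \<le> norm (theta_deriv x - s *\<^sub>R x)"
    by (rule power2_le_imp_le) (use n in \<open>simp_all add: power_mult_distrib\<close>)
  show "norm (theta_deriv x) \<le> norm (theta_deriv x - s *\<^sub>R x)"
    by (rule power2_le_imp_le) (use n in simp_all)
qed

text \<open>The lower bound makes the solutions unique, hence linear in \<open>y\<close>.
  Compactness holds because \<open>theta_deriv (K y)\<close> is bounded along with
  \<open>K y\<close>, so that images of bounded sequences fall under the Rellich lemma.\<close>

lemma theta_deriv_minus_inverse: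
  assumes "s \<noteq> 0"
  obtains K where "compact_operator K" "\<And>y. K y \<in> H1" "\<And>y. theta_deriv (K y) - s *\<^sub>R K y = y"
    "\<And>x. x \<in> H1 \<Longrightarrow> K (theta_deriv x - s *\<^sub>R x) = x" "\<And>y. norm (K y) \<le> norm y / \<bar>s\<bar>"
proof -
  have "\<exists>x. x \<in> H1 \<and> theta_deriv x - s *\<^sub>R x = y" for y
    using theta_deriv_minus_surj[OF assms, of y] by blast
  then obtain K where K: "\<And>y. K y \<in> H1" "\<And>y. theta_deriv (K y) - s *\<^sub>R K y = y" by metis
  have inj: "x = x'" if "x \<in> H1" "x' \<in> H1" "theta_deriv x - s *\<^sub>R x = theta_deriv x' - s *\<^sub>R x'" for x x'
  proof -
    have "theta_deriv (x - x') - s *\<^sub>R (x - x') = 0"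
      using that(3) by (simp add: theta_deriv_diff that(1,2) algebra_simps)
    then have "\<bar>s\<bar> * norm (x - x') \<le> 0"
      using theta_deriv_minus_lower_bound(1)[OF H1_diff[OF that(1,2)], of s] by simp
    then show ?thesis using assms by (simp add: mult_le_0_iff)
  qed
  have bound: "norm (K y) \<le> norm y / \<bar>s\<bar>" for y
    using theta_deriv_minus_lower_bound(1)[OF K(1)[of y], of s] K(2)[of y] assms
    by (simp add: field_simps)
  have lin: "bounded_linear K"
  proof (rule bounded_linear_intro)
    show "K (x + y) = K x + K y" for x y
    proof (rule inj[OF K(1) H1_add[OF K(1) K(1)]])
      have "theta_deriv (K x + K y) - s *\<^sub>R (K x + K y)
          = (theta_deriv (K x) - s *\<^sub>R K x) + (theta_deriv (K y) - s *\<^sub>R K y)"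
        by (simp add: theta_deriv_add K(1) algebra_simps)
      then show "theta_deriv (K (x + y)) - s *\<^sub>R K (x + y)
          = theta_deriv (K x + K y) - s *\<^sub>R (K x + K y)" by (simp only: K(2))
    qed
    show "K (r *\<^sub>R x) = r *\<^sub>R K x" for r x
    proof (rule inj[OF K(1)])
      show "r *\<^sub>R K x \<in> H1" by (simp add: scaleR_scaleC[of r] H1_scaleC K(1))
      have "theta_deriv (r *\<^sub>R K x) - s *\<^sub>R (r *\<^sub>R K x) = r *\<^sub>R (theta_deriv (K x) - s *\<^sub>R K x)"
        by (simp add: scaleR_scaleC[of r] theta_deriv_scaleC K(1) scaleC_diff_right scaleC_scaleR)
      then show "theta_deriv (K (r *\<^sub>R x)) - s *\<^sub>R K (r *\<^sub>R x)
          = theta_deriv (r *\<^sub>R K x) - s *\<^sub>R r *\<^sub>R K x" by (simp only: K(2))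
    qed
    show "norm (K x) \<le> norm x * (1 / \<bar>s\<bar>)" for x using bound[of x] by simp
  qed
  have "compact_operator K"
  proof (rule compact_operatorI[OF lin])
    fix x :: "nat \<Rightarrow> circle_L2" assume x: "\<And>k. norm (x k) \<le> 1"
    show "\<exists>r l. strict_mono r \<and> (\<lambda>k. K (x (r k))) \<longlonglongrightarrow> l"
    \<comment> \<open>\<open>1 / \<bar>s\<bar>\<close> bounds the functions and 1 their
      derivatives.\<close>
    proof (rule H1_bounded_sequence_convergent_subsequence[where B = "max 1 (1 / \<bar>s\<bar>)"])
      show "norm (K (x k)) \<le> max 1 (1 / \<bar>s\<bar>)" for k
        using bound[of "x k"] divide_right_mono[OF x[of k], of "\<bar>s\<bar>"] by simp
      show "norm (theta_deriv (K (x k))) \<le> max 1 (1 / \<bar>s\<bar>)" for k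
        using theta_deriv_minus_lower_bound(2)[OF K(1), of "x k" s] x[of k]
        by (simp add: K(2) le_max_iff_disj)
    qed (rule K(1))
  qed
  moreover have "K (theta_deriv x - s *\<^sub>R x) = x" if "x \<in> H1" for x
    by (rule inj[OF K(1) that]) (simp only: K(2))
  ultimately show thesis using that K bound by blast
qed

section \<open>Smoothness of the cocycle\<close>

text \<open>The circle has empty interior, so uniqueness of the derivative within it is taken from
  uniqueness of the real derivative of \<open>u\<close> along \<open>circ\<close>.\<close>

lemma circle_deriv_eq:
  assumes "z \<in> circle" "(u has_field_derivative d) (at z within circle)"
  shows "circle_deriv u z = d"
  unfolding circle_deriv_def
proof (rule the_equality[where P = "\<lambda>d. (u has_field_derivative d) (at z within circle)", OF assms(2)])
  fix d' assume d': "(u has_field_derivative d') (at z within circle)"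
  define t where "t = angle z"
  have z: "z = circ t" using circ_angle[OF assms(1)] by (simp add: t_def)
  have "2 * pi * \<i> * circ t * d' = 2 * pi * \<i> * circ t * d"
    by (rule vector_derivative_unique_at; rule parametrization_of_circle_derivative)
      (use d' assms(2) z in auto)
  then show "d' = d" by simp
qed

text \<open>The regularity that \<open>H1\<close> demands: \<open>delta\<close> contains one
  derivative of the iterate, and multiplication by it must be continuously differentiable once more.
  With derivatives as witnesses in place of iterated \<open>circle_deriv\<close>, the chain rule
  passes the property to compositions directly.\<close>

definition circle_C2 :: "(complex \<Rightarrow> complex) \<Rightarrow> bool" where
  "circle_C2 u \<longleftrightarrow> (\<exists>u1 u2. continuous_on circle u2 \<and>
    (\<forall>z\<in>circle. (u has_field_derivative u1 z) (at z within circle)) \<and>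
    (\<forall>z\<in>circle. (u1 has_field_derivative u2 z) (at z within circle)))"

lemma has_circle_deriv:
  assumes "z \<in> circle" "u field_differentiable (at z within circle)"
  shows "(u has_field_derivative circle_deriv u z) (at z within circle)"
proof -
  obtain d where d: "(u has_field_derivative d) (at z within circle)"
    using assms(2) by (auto simp: field_differentiable_def)
  with circle_deriv_eq[OF assms(1) d] show ?thesis by simp
qed

lemma circle_smooth_imp_C2:
  assumes "circle_smooth u"
  shows "circle_C2 u"
proof -
  have d: "(circle_deriv ^^ k) u field_differentiable (at z within circle)" if "z \<in> circle" for k z
    using assms that by (simp add: circle_smooth_def)
  have 0: "u field_differentiable (at z within circle)" if "z \<in> circle" for z
    using d[of z 0] that by simp
  have 1: "circle_deriv u field_differentiable (at z within circle)" if "z \<in> circle" for z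
    using d[of z 1] that by simp
  have 2: "circle_deriv (circle_deriv u) field_differentiable (at z within circle)" if "z \<in> circle" for z
    using d[of z 2] that by (simp add: numeral_2_eq_2)
  show ?thesis
    unfolding circle_C2_def
  proof (rule exI[of _ "circle_deriv u"], rule exI[of _ "circle_deriv (circle_deriv u)"], intro conjI ballI)
    show "continuous_on circle (circle_deriv (circle_deriv u))"
      unfolding continuous_on_eq_continuous_within
      using 2 field_differentiable_imp_continuous_at by blast
  qed (use 0 1 has_circle_deriv in auto)
qed

lemma circle_C2_compose:
  assumes u: "circle_C2 u" and v: "circle_C2 v" and sub: "v ` circle \<subseteq> circle"
  shows "circle_C2 (\<lambda>z. u (v z))"
proof -
  obtain u1 u2 where u1: "\<And>z. z \<in> circle \<Longrightarrow> (u has_field_derivative u1 z) (at z within circle)"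
    and u2: "\<And>z. z \<in> circle \<Longrightarrow> (u1 has_field_derivative u2 z) (at z within circle)"
    and cu: "continuous_on circle u2" using u unfolding circle_C2_def by metis
  obtain v1 v2 where v1: "\<And>z. z \<in> circle \<Longrightarrow> (v has_field_derivative v1 z) (at z within circle)"
    and v2: "\<And>z. z \<in> circle \<Longrightarrow> (v1 has_field_derivative v2 z) (at z within circle)"
    and cv: "continuous_on circle v2" using v unfolding circle_C2_def by metis
  have chain: "((\<lambda>z. h (v z)) has_field_derivative h' * v1 z) (at z within circle)"
    if "z \<in> circle" "(h has_field_derivative h') (at (v z) within circle)" for h h' z
    using DERIV_image_chain[OF DERIV_subset[OF that(2) sub] v1[OF that(1)]] by (simp add: comp_def)
  have cont: "continuous_on circle v" "continuous_on circle v1" "continuous_on circle u1"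
    unfolding continuous_on_eq_continuous_within using v1 v2 u2 DERIV_continuous by blast+
  show ?thesis
    unfolding circle_C2_def
  proof (rule exI[of _ "\<lambda>z. u1 (v z) * v1 z"],
      rule exI[of _ "\<lambda>z. u2 (v z) * v1 z * v1 z + u1 (v z) * v2 z"], intro conjI ballI)
    show "continuous_on circle (\<lambda>z. u2 (v z) * v1 z * v1 z + u1 (v z) * v2 z)"
      by (intro continuous_intros cont cv continuous_on_compose2[OF cu cont(1) sub]
          continuous_on_compose2[OF cont(3) cont(1) sub])
    fix z assume z: "z \<in> circle"
    then have vz: "v z \<in> circle" using sub by blast
    show "((\<lambda>z. u (v z)) has_field_derivative u1 (v z) * v1 z) (at z within circle)"
      by (rule chain[OF z u1[OF vz]])
    show "((\<lambda>z. u1 (v z) * v1 z) has_field_derivative u2 (v z) * v1 z * v1 z + u1 (v z) * v2 z)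
        (at z within circle)"
      by (rule DERIV_cong[OF DERIV_mult[OF chain[OF z u2[OF vz]] v2[OF z]]]) (simp add: algebra_simps)
  qed
qed

lemma circle_C2_id: "circle_C2 (\<lambda>z. z)"
  unfolding circle_C2_def
  by (rule exI[of _ "\<lambda>_. 1"], rule exI[of _ "\<lambda>_. 0"]) (auto intro!: derivative_eq_intros)

lemma circle_C2_funpow:
  assumes "circle_C2 u" "u ` circle \<subseteq> circle"
  shows "circle_C2 (u ^^ k) \<and> (u ^^ k) ` circle \<subseteq> circle"
proof (induction k)
  case 0
  have "u ^^ 0 = (\<lambda>z. z)" by (simp add: fun_eq_iff)
  then show ?case using circle_C2_id by (simp only: image_ident order_refl simp_thms)
next
  case (Suc k)
  have "u ^^ Suc k = (\<lambda>z. u ((u ^^ k) z))" by (simp add: fun_eq_iff)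
  moreover have "circle_C2 (\<lambda>z. u ((u ^^ k) z))"
    by (rule circle_C2_compose[OF assms(1)]) (simp_all only: Suc)
  moreover have "(\<lambda>z. u ((u ^^ k) z)) ` circle \<subseteq> circle"
    unfolding image_subset_iff
  proof
    fix z assume "z \<in> circle"
    then have "(u ^^ k) z \<in> circle" using Suc by (auto simp only: image_subset_iff)
    then show "u ((u ^^ k) z) \<in> circle" using assms(2) by (auto simp only: image_subset_iff)
  qed
  ultimately show ?case by (simp only:)
qed

lemma funpow_cancel:
  assumes "\<And>z. z \<in> S \<Longrightarrow> g (h z) = z" "h ` S \<subseteq> S" "z \<in> S"
  shows "(g ^^ k) ((h ^^ k) z) = z"
proof (induction k)
  case (Suc k)
  have "(h ^^ k) z \<in> S"
    by (induction k) (use assms(2,3) in \<open>auto simp: image_subset_iff\<close>)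
  then have "g (h ((h ^^ k) z)) = (h ^^ k) z" by (rule assms(1))
  then have "(g ^^ Suc k) ((h ^^ Suc k) z) = (g ^^ k) ((h ^^ k) z)"
    by (simp only: funpow_Suc_right[of k g] funpow.simps(2)[of k h] comp_apply)
  with Suc show ?case by simp
qed simp

section \<open>Iterates of a circle diffeomorphism and their cocycle\<close>

context
  fixes f :: "complex \<Rightarrow> complex"
  assumes f: "circle_diffeo f"
begin

lemma circle_diffeo_maps: "f ` circle \<subseteq> circle" "inv_into circle f ` circle \<subseteq> circle"
  and circle_diffeo_inverse: "z \<in> circle \<Longrightarrow> inv_into circle f (f z) = z"
    "z \<in> circle \<Longrightarrow> f (inv_into circle f z) = z"
proof -
  have bij: "bij_betw f circle circle" using f by (simp add: circle_diffeo_def)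
  show "f ` circle \<subseteq> circle" using bij by (simp add: bij_betw_def)
  show "inv_into circle f ` circle \<subseteq> circle"
    using bij_betw_inv_into[OF bij] by (simp add: bij_betw_def)
  show "z \<in> circle \<Longrightarrow> inv_into circle f (f z) = z"
    by (rule bij_betw_inv_into_left[OF bij])
  show "z \<in> circle \<Longrightarrow> f (inv_into circle f z) = z"
    by (rule bij_betw_inv_into_right[OF bij])
qed

lemma circle_iter_C2: "circle_C2 (circle_iter f n)" "circle_iter f n ` circle \<subseteq> circle"
proof -
  have "circle_smooth f" "circle_smooth (inv_into circle f)"
    using f by (simp_all add: circle_diffeo_def)
  note C2 = this[THEN circle_smooth_imp_C2]
  have "circle_C2 (circle_iter f n) \<and> circle_iter f n ` circle \<subseteq> circle"
  proof (cases "0 \<le> n")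
    case True
    then have "circle_iter f n = f ^^ nat n" by (simp add: circle_iter_def)
    then show ?thesis using circle_C2_funpow[OF C2(1) circle_diffeo_maps(1)] by (simp only:)
  next
    case False
    then have "circle_iter f n = inv_into circle f ^^ nat (- n)" by (simp add: circle_iter_def)
    then show ?thesis using circle_C2_funpow[OF C2(2) circle_diffeo_maps(2)] by (simp only:)
  qed
  then show "circle_C2 (circle_iter f n)" "circle_iter f n ` circle \<subseteq> circle" by blast+
qed

lemma circle_iter_inverse:
  assumes "z \<in> circle"
  shows "circle_iter f (- n) (circle_iter f n z) = z"
proof -
  have "(inv_into circle f ^^ k) ((f ^^ k) z) = z" "(f ^^ k) ((inv_into circle f ^^ k) z) = z" for k
    by (rule funpow_cancel[of circle, OF circle_diffeo_inverse(1) circle_diffeo_maps(1) assms]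
        funpow_cancel[of circle, OF circle_diffeo_inverse(2) circle_diffeo_maps(2) assms]; assumption)+
  then show ?thesis by (auto simp: circle_iter_def)
qed

lemma circle_iter_derivatives:
  obtains F2 where "continuous_on circle F2"
    "\<And>z. z \<in> circle \<Longrightarrow> (circle_iter f n has_field_derivative circle_deriv (circle_iter f n) z) (at z within circle)"
    "\<And>z. z \<in> circle \<Longrightarrow> (circle_deriv (circle_iter f n) has_field_derivative F2 z) (at z within circle)"
proof -
  let ?F = "circle_iter f n"
  obtain F1 F2 where c: "continuous_on circle F2"
    and F1: "\<And>z. z \<in> circle \<Longrightarrow> (?F has_field_derivative F1 z) (at z within circle)"
    and F2: "\<And>z. z \<in> circle \<Longrightarrow> (F1 has_field_derivative F2 z) (at z within circle)"
    using circle_iter_C2(1)[of n] unfolding circle_C2_def by metis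
  have eq: "circle_deriv ?F z = F1 z" if "z \<in> circle" for z
    using circle_deriv_eq[OF that F1[OF that]] .
  show thesis
  proof (rule that[OF c])
    fix z assume z: "z \<in> circle"
    show "(?F has_field_derivative circle_deriv ?F z) (at z within circle)"
      unfolding eq[OF z] by (rule F1[OF z])
    show "(circle_deriv ?F has_field_derivative F2 z) (at z within circle)"
      by (rule has_field_derivative_transform_within[OF F2[OF z] zero_less_one z]) (simp add: eq)
  qed
qed

text \<open>The opposite iterate is a differentiable left inverse; a zero here would by the chain
  rule give the identity the derivative 0.\<close>

lemma circle_deriv_circle_iter_nonzero:
  assumes z: "z \<in> circle"
  shows "circle_deriv (circle_iter f n) z \<noteq> 0"
proof
  assume zero: "circle_deriv (circle_iter f n) z = 0"
  let ?F = "circle_iter f n" and ?G = "circle_iter f (- n)"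
  have F: "(?F has_field_derivative 0) (at z within circle)"
    using circle_iter_derivatives[of n] z zero by metis
  have "?F z \<in> circle" using circle_iter_C2(2) z by blast
  then have G: "(?G has_field_derivative circle_deriv ?G (?F z)) (at (?F z) within circle)"
    using circle_iter_derivatives[of "- n"] by metis
  have "(?G \<circ> ?F has_field_derivative circle_deriv ?G (?F z) * 0) (at z within circle)"
    by (rule DERIV_image_chain[OF DERIV_subset[OF G circle_iter_C2(2)] F])
  then have GF: "(?G \<circ> ?F has_field_derivative 0) (at z within circle)" by (simp only: mult_zero_right)
  have "((\<lambda>z. z) has_field_derivative 0) (at z within circle)"
    by (rule has_field_derivative_transform_within[OF GF zero_less_one z])
      (simp only: comp_apply circle_iter_inverse)
  then have "circle_deriv (\<lambda>z. z) z = 0" by (rule circle_deriv_eq[OF z])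
  moreover have "circle_deriv (\<lambda>z. z) z = 1" by (rule circle_deriv_eq[OF z]) (rule DERIV_ident)
  ultimately show False by simp
qed

lemma norm_delta:
  assumes "z \<in> circle"
  shows "cmod (delta f n z) = cmod (circle_deriv (circle_iter f n) z)"
proof -
  have "circle_iter f n z \<in> circle" using circle_iter_C2(2) assms by blast
  then have "cmod (circle_iter f n z) = 1" by simp
  then show ?thesis using assms by (simp add: delta_def norm_mult norm_divide)
qed

lemma delta_nonzero:
  assumes "z \<in> circle" shows "delta f n z \<noteq> 0"
  using norm_delta[OF assms, of n] circle_deriv_circle_iter_nonzero[OF assms, of n] by auto

lemma delta_differentiable:
  obtains d where "continuous_on circle d"
    "\<And>z. z \<in> circle \<Longrightarrow> (delta f n has_field_derivative d z) (at z within circle)"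
proof -
  let ?F = "circle_iter f n"
  let ?F1 = "circle_deriv ?F"
  obtain F2 where c: "continuous_on circle F2"
    and F1: "\<And>z. z \<in> circle \<Longrightarrow> (?F has_field_derivative ?F1 z) (at z within circle)"
    and F2: "\<And>z. z \<in> circle \<Longrightarrow> (?F1 has_field_derivative F2 z) (at z within circle)"
    using circle_iter_derivatives[of n] by metis
  have nz: "?F z \<noteq> 0" if "z \<in> circle" for z
  proof -
    have "?F z \<in> circle" using circle_iter_C2(2) that by blast
    then show ?thesis by auto
  qed
  have cont: "continuous_on circle ?F" "continuous_on circle ?F1"
    unfolding continuous_on_eq_continuous_within using F1 F2 DERIV_continuous by blast+
  show thesis
  proof (rule that)
    show "continuous_on circle (\<lambda>z. ((?F1 z + z * F2 z) * ?F z - z * ?F1 z * ?F1 z) / (?F z * ?F z))"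
      by (intro continuous_intros cont c) (use nz in auto)
    fix z assume z: "z \<in> circle"
    have "((\<lambda>z. z * ?F1 z / ?F z) has_field_derivative
        ((?F1 z + z * F2 z) * ?F z - z * ?F1 z * ?F1 z) / (?F z * ?F z)) (at z within circle)"
      using nz[OF z] by (auto intro!: derivative_eq_intros F1[OF z] F2[OF z])
    then show "(delta f n has_field_derivative
        ((?F1 z + z * F2 z) * ?F z - z * ?F1 z * ?F1 z) / (?F z * ?F z)) (at z within circle)"
      by (simp add: delta_def[abs_def])
  qed
qed

lemma continuous_on_delta: "continuous_on circle (delta f n)"
proof -
  obtain d where "\<And>z. z \<in> circle \<Longrightarrow> (delta f n has_field_derivative d z) (at z within circle)"
    using delta_differentiable[of n] by metis
  then show ?thesis
    unfolding continuous_on_eq_continuous_within using DERIV_continuous by blast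
qed

lemma continuous_on_inverse_delta: "continuous_on circle (\<lambda>z. inverse (delta f n z))"
  by (intro continuous_on_inverse continuous_on_delta ballI delta_nonzero)

lemma mult_op_delta_H1: "x \<in> H1 \<Longrightarrow> mult_op (delta f n) x \<in> H1"
  and mult_op_inverse_delta_H1: "x \<in> H1 \<Longrightarrow> mult_op (\<lambda>z. inverse (delta f n z)) x \<in> H1"
proof -
  assume x: "x \<in> H1"
  obtain d where d: "continuous_on circle d"
    "\<And>z. z \<in> circle \<Longrightarrow> (delta f n has_field_derivative d z) (at z within circle)"
    using delta_differentiable[of n] by metis
  show "mult_op (delta f n) x \<in> H1" by (rule mult_op_in_H1[OF x d(2,1)])
  show "mult_op (\<lambda>z. inverse (delta f n z)) x \<in> H1"
  proof (rule mult_op_in_H1[OF x])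
    show "continuous_on circle (\<lambda>z. - (inverse (delta f n z) * d z * inverse (delta f n z)))"
      by (intro continuous_intros d continuous_on_delta) (use delta_nonzero in auto)
    show "((\<lambda>z. inverse (delta f n z)) has_field_derivative
        - (inverse (delta f n z) * d z * inverse (delta f n z))) (at z within circle)" if "z \<in> circle" for z
      by (rule DERIV_inverse'[OF d(2)[OF that] delta_nonzero[OF that]])
  qed
qed

lemma mult_op_delta_cancel:
  "mult_op (delta f n) (mult_op (\<lambda>z. inverse (delta f n z)) x) = x"
  "mult_op (\<lambda>z. inverse (delta f n z)) (mult_op (delta f n) x) = x"
  unfolding mult_op_mult_op[OF continuous_on_delta continuous_on_inverse_delta]
    mult_op_mult_op[OF continuous_on_inverse_delta continuous_on_delta]
  by (rule mult_op_cong_1, simp add: delta_nonzero)+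

text \<open>\<open>growth_seq\<close> already takes the maximum over both signs of the exponent, so
  the index \<open>\<bar>n\<bar>\<close> serves n and -n. Continuity on the compact circle makes the
  supremum a genuine one.\<close>

lemma norm_delta_le_growth_seq:
  assumes z: "z \<in> circle"
  shows "cmod (delta f n z) \<le> growth_seq f (nat \<bar>n\<bar>)"
proof -
  have "bdd_above ((\<lambda>z. cmod (circle_deriv (circle_iter f n) z)) ` circle)"
  proof -
    obtain B where "\<forall>z\<in>circle. cmod (delta f n z) \<le> B"
      using continuous_on_circle_bounded[OF continuous_on_delta[of n]] by (elim exE conjE) (rule that)
    then show ?thesis by (intro bdd_aboveI2[where M = B]) (simp add: norm_delta)
  qed
  then have "cmod (circle_deriv (circle_iter f n) z) \<le> (SUP z\<in>circle. cmod (circle_deriv (circle_iter f n) z))"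
    by (rule cSUP_upper[OF z])
  then show ?thesis
    unfolding norm_delta[OF z] growth_seq_def
    by (cases "0 \<le> n") (auto simp: le_max_iff_disj)
qed

end

section \<open>The components of the Dirac operator\<close>

text \<open>The surjectivity lemma supplies some element of \<open>H1\<close>, and 0 is its zero
  multiple.\<close>

lemma zero_in_H1: "0 \<in> H1"
  using theta_deriv_minus_surj[of 1 0] H1_scaleC[of _ 0] by force

lemma theta_deriv_zero: "theta_deriv 0 = 0"
  using theta_deriv_scaleC[OF zero_in_H1, of 0] by simp

text \<open>Both operators brought to the form \<open>theta_deriv x - s *\<^sub>R x\<close> with
  real \<open>s\<close>, the form in which the inverses are available.\<close>

lemma L_op_eq: "L_op n x = theta_deriv x - real_of_int n *\<^sub>R x"
  and L_adj_eq: "L_adj n x = - (theta_deriv x - (- real_of_int n) *\<^sub>R x)"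
  by (simp_all add: L_op_def L_adj_def theta_deriv_def scaleR_scaleC scaleC_minus_left)

text \<open>For antidiagonal block operators, hence the crossed coordinates: the norm is the larger
  of the two entries and not their sum.\<close>

lemma norm_Pair_le:
  assumes "norm a \<le> C * norm (snd y)" "norm b \<le> C * norm (fst y)" "0 \<le> C"
  shows "norm (a, b) \<le> C * norm y"
proof (rule power2_le_imp_le)
  have "(norm a)\<^sup>2 \<le> (C * norm (snd y))\<^sup>2" "(norm b)\<^sup>2 \<le> (C * norm (fst y))\<^sup>2"
    using assms by (auto intro: power_mono)
  then have "(norm a)\<^sup>2 + (norm b)\<^sup>2 \<le> C\<^sup>2 * ((norm (fst y))\<^sup>2 + (norm (snd y))\<^sup>2)"
    by (simp add: power_mult_distrib distrib_left)
  then show "(norm (a, b))\<^sup>2 \<le> (C * norm y)\<^sup>2"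
    by (cases y) (simp add: norm_prod_def power_mult_distrib)
qed (use assms in simp)

context
  fixes f :: "complex \<Rightarrow> complex"
  assumes f: "circle_diffeo f"
begin

lemmas bounded_linear_delta = bounded_linear_mult_op[OF continuous_on_delta[OF f]]
  and bounded_linear_inverse_delta = bounded_linear_mult_op[OF continuous_on_inverse_delta[OF f]]

lemma dirac_comp_zero: "dirac_comp f n 0 = 0"
  using linear_0[OF bounded_linear.linear[OF bounded_linear_inverse_delta]]
  by (simp add: dirac_comp_def L_op_eq L_adj_eq theta_deriv_zero zero_prod_def)

lemma dirac_comp_inverse_props:
  assumes "n \<noteq> 0"
  defines "T \<equiv> dirac_comp_inverse f n"
  shows "compact_operator T"
    and "T y \<in> H1 \<times> H1"
    and "dirac_comp f n (T y) = y"
    and "x \<in> H1 \<times> H1 \<Longrightarrow> T (dirac_comp f n x) = x"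
    and "(\<And>z. z \<in> circle \<Longrightarrow> cmod (delta f n z) \<le> B) \<Longrightarrow> norm (T y) \<le> B / \<bar>real_of_int n\<bar> * norm y"
proof -
  let ?s = "real_of_int n"
  have s: "?s \<noteq> 0" "- ?s \<noteq> 0" using assms by auto
  obtain K where K: "compact_operator K" "\<And>y. K y \<in> H1" "\<And>y. theta_deriv (K y) - ?s *\<^sub>R K y = y"
    "\<And>x. x \<in> H1 \<Longrightarrow> K (theta_deriv x - ?s *\<^sub>R x) = x" "\<And>y. norm (K y) \<le> norm y / \<bar>?s\<bar>"
    using theta_deriv_minus_inverse[OF s(1)] by metis
  obtain K' where K': "compact_operator K'" "\<And>y. K' y \<in> H1" "\<And>y. theta_deriv (K' y) - (- ?s) *\<^sub>R K' y = y"
    "\<And>x. x \<in> H1 \<Longrightarrow> K' (theta_deriv x - (- ?s) *\<^sub>R x) = x" "\<And>y. norm (K' y) \<le> norm y / \<bar>- ?s\<bar>"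
    using theta_deriv_minus_inverse[OF s(2)] by metis
  let ?M = "mult_op (delta f n)" and ?M' = "mult_op (\<lambda>z. inverse (delta f n z))"
  \<comment> \<open>Solve the two rows separately: the first determines the second coordinate; the
    second determines the first coordinate divided by \<open>delta\<close>, and the leading minus
    sign of \<open>L_adj\<close> passes to the argument of \<open>K'\<close>.\<close>
  define T' where "T' y = (?M (K' (- snd y)), K (?M (fst y)))" for y
  note cancel = mult_op_delta_cancel[OF f] and H = mult_op_delta_H1[OF f] mult_op_inverse_delta_H1[OF f]
  have T'S: "T' y \<in> H1 \<times> H1" for y by (simp add: T'_def H K(2) K'(2))
  have AT': "dirac_comp f n (T' y) = y" for y
    by (simp only: dirac_comp_def T'_def fst_conv snd_conv cancel L_op_eq L_adj_eq K(3) K'(3)) simp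
  have T'A: "T' (dirac_comp f n x) = x" if "x \<in> H1 \<times> H1" for x
  proof -
    have x: "snd x \<in> H1" "?M' (fst x) \<in> H1" using that H by auto
    show ?thesis
      by (simp only: dirac_comp_def T'_def fst_conv snd_conv cancel L_op_eq L_adj_eq minus_minus
          K(4)[OF x(1)] K'(4)[OF x(2)]) simp
  qed
  have cT': "compact_operator T'"
    unfolding T'_def
  proof (intro compact_operator_Pair)
    have "bounded_linear (\<lambda>y :: circle_L2 \<times> circle_L2. - snd y)"
      by (rule bounded_linear_minus[OF bounded_linear_snd])
    from compact_operator_compose_right[OF K'(1) this]
    show "compact_operator (\<lambda>y :: circle_L2 \<times> circle_L2. ?M (K' (- snd y)))"
      by (rule compact_operator_compose_left[OF _ bounded_linear_delta])
    show "compact_operator (\<lambda>y :: circle_L2 \<times> circle_L2. K (?M (fst y)))"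
      by (rule compact_operator_compose_right[OF K(1)
            bounded_linear_compose[OF bounded_linear_delta bounded_linear_fst]])
  qed
  have TT': "T = T'"
  proof
    fix y
    have "inj_on (dirac_comp f n) (H1 \<times> H1)" by (rule inj_on_inverseI[of _ T']) (rule T'A)
    then have "inv_into (H1 \<times> H1) (dirac_comp f n) (dirac_comp f n (T' y)) = T' y"
      by (rule inv_into_f_f[OF _ T'S])
    then show "T y = T' y" by (simp add: T_def dirac_comp_inverse_def \<open>n \<noteq> 0\<close> AT')
  qed
  show "compact_operator T" unfolding TT' by (rule cT')
  show "T y \<in> H1 \<times> H1" unfolding TT' by (rule T'S)
  show "dirac_comp f n (T y) = y" unfolding TT' by (rule AT')
  show "x \<in> H1 \<times> H1 \<Longrightarrow> T (dirac_comp f n x) = x" unfolding TT' by (rule T'A)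
  assume B: "\<And>z. z \<in> circle \<Longrightarrow> cmod (delta f n z) \<le> B"
  have "cmod (delta f n 1) \<le> B" by (rule B) simp
  then have "0 \<le> B" by (rule order_trans[OF norm_ge_zero])
  have M: "norm (?M x) \<le> B * norm x" for x
    by (rule norm_mult_op_le[OF continuous_on_delta[OF f] B \<open>0 \<le> B\<close>])
  have "norm (T' y) \<le> B / \<bar>?s\<bar> * norm y"
    unfolding T'_def
  proof (rule norm_Pair_le)
    have "norm (?M (K' (- snd y))) \<le> B * norm (K' (- snd y))" by (rule M)
    also have "\<dots> \<le> B * (norm (- snd y) / \<bar>- ?s\<bar>)" by (intro mult_left_mono K' \<open>0 \<le> B\<close>)
    finally show "norm (?M (K' (- snd y))) \<le> B / \<bar>?s\<bar> * norm (snd y)" by simp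
    have "norm (K (?M (fst y))) \<le> norm (?M (fst y)) / \<bar>?s\<bar>" by (rule K)
    also have "\<dots> \<le> B * norm (fst y) / \<bar>?s\<bar>" by (intro divide_right_mono M) simp
    finally show "norm (K (?M (fst y))) \<le> B / \<bar>?s\<bar> * norm (fst y)" by simp
  qed (use \<open>0 \<le> B\<close> in simp)
  then show "norm (T y) \<le> B / \<bar>?s\<bar> * norm y" unfolding TT' .
qed

text \<open>\<open>(\<plusminus>\<i>)\<close>-combinations of the two coordinates diagonalise \<open>D\<^sub>0\<close>, which turns the resolvent equation
  at \<open>\<i> t\<close> into one equation for \<open>theta_deriv + t\<close> and one for \<open>theta_deriv - t\<close>.\<close>

lemma dirac_comp_0_resolvent:
  assumes "0 < t"
  obtains R where "compact_operator R" "\<And>y. R y \<in> H1 \<times> H1"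
    "\<And>y. dirac_comp f 0 (R y) - (\<i> * complex_of_real t) *\<^sub>C R y = y"
    "\<And>x. x \<in> H1 \<times> H1 \<Longrightarrow> R (dirac_comp f 0 x - (\<i> * complex_of_real t) *\<^sub>C x) = x"
proof -
  \<comment> \<open>The imaginary unit as a real linear map with \<open>J (J x) = - x\<close>; all
    calculations below then involve real scalars only.\<close>
  define J :: "circle_L2 \<Rightarrow> circle_L2" where "J x = \<i> *\<^sub>C x" for x
  have J: "bounded_linear J" unfolding J_def by (rule bounded_linear_scaleC)
  interpret J: bounded_linear J by (rule J)
  have JJ: "J (J x) = - x" for x by (simp add: J_def scaleC_scaleC scaleC_minus_left)
  have JH: "J x \<in> H1" "theta_deriv (J x) = J (theta_deriv x)" if "x \<in> H1" for x
    using that by (simp_all add: J_def H1_scaleC theta_deriv_scaleC)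
  have sJ: "(\<i> * complex_of_real t) *\<^sub>C x = t *\<^sub>R J x" for x :: circle_L2
    by (simp add: J_def scaleR_scaleC scaleC_scaleC mult.commute)
  have scaleR_H1: "r *\<^sub>R x \<in> H1" "theta_deriv (r *\<^sub>R x) = r *\<^sub>R theta_deriv x" if "x \<in> H1" for r x
    using that by (simp_all add: scaleR_scaleC H1_scaleC theta_deriv_scaleC)
  have delta1: "mult_op (\<lambda>z. inverse (delta f 0 z)) x = x" for x
  proof (rule mult_op_cong_1)
    fix z :: complex assume z: "z \<in> circle"
    have "circle_deriv (circle_iter f 0) z = 1"
      by (rule circle_deriv_eq[OF z]) (simp add: circle_iter_def id_def)
    then show "inverse (delta f 0 z) = 1" using z by (auto simp: delta_def circle_iter_def)
  qed
  have D0: "dirac_comp f 0 x - (\<i> * complex_of_real t) *\<^sub>C x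
      = (theta_deriv (snd x) - t *\<^sub>R J (fst x), - theta_deriv (fst x) - t *\<^sub>R J (snd x))" for x
    by (simp add: dirac_comp_def delta1 L_op_eq L_adj_eq scaleC_prod_def sJ)
  have t: "t \<noteq> 0" "- t \<noteq> 0" using assms by auto
  obtain K where K: "compact_operator K" "\<And>y. K y \<in> H1" "\<And>y. theta_deriv (K y) - (- t) *\<^sub>R K y = y"
    "\<And>x. x \<in> H1 \<Longrightarrow> K (theta_deriv x - (- t) *\<^sub>R x) = x"
    using theta_deriv_minus_inverse[OF t(2)] by metis
  obtain K' where K': "compact_operator K'" "\<And>y. K' y \<in> H1" "\<And>y. theta_deriv (K' y) - t *\<^sub>R K' y = y"
    "\<And>x. x \<in> H1 \<Longrightarrow> K' (theta_deriv x - t *\<^sub>R x) = x"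
    using theta_deriv_minus_inverse[OF t(1)] by metis
  \<comment> \<open>If \<open>(a, b)\<close> solves the resolvent equation for \<open>y\<close>,
    then \<open>a + J b\<close> satisfies
    \<open>theta_deriv w + t *\<^sub>R w = J (fst y) - snd y\<close>, and \<open>a - J b\<close> the
    corresponding equation with shift -t; \<open>W\<close> and \<open>W'\<close> are their
    solutions.\<close>
  define W where "W y = K (J (fst y) - snd y)" for y
  define W' where "W' y = K' (- J (fst y) - snd y)" for y
  \<comment> \<open>Recovers a and b from \<open>a + J b\<close> and \<open>a - J b\<close>; the
    factor \<open>- J\<close> inverts \<open>J\<close>.\<close>
  define R where "R y = ((1 / 2) *\<^sub>R (W y + W' y), (- (1 / 2)) *\<^sub>R J (W y - W' y))" for y
  have WH: "W y \<in> H1" "W' y \<in> H1" for y by (simp_all add: W_def W'_def K K')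
  have RS: "R y \<in> H1 \<times> H1" for y
    by (simp add: R_def scaleR_H1 H1_add JH H1_diff WH del: scaleR_minus_left)
  have thW: "theta_deriv (W y) = J (fst y) - snd y - t *\<^sub>R W y" for y
    using K(3)[of "J (fst y) - snd y"] by (simp add: W_def algebra_simps)
  have thW': "theta_deriv (W' y) = - J (fst y) - snd y + t *\<^sub>R W' y" for y
    using K'(3)[of "- J (fst y) - snd y"] by (simp add: W'_def algebra_simps)
  have half: "a = (1 / 2) *\<^sub>R (a + a)" for a :: circle_L2 by (simp add: scaleR_2[symmetric])
  have AR: "dirac_comp f 0 (R y) - (\<i> * complex_of_real t) *\<^sub>C R y = y" for y
  proof -
    let ?w = "W y" and ?w' = "W' y" and ?a = "fst y" and ?b = "snd y"
    have th1: "theta_deriv (fst (R y)) = (1 / 2) *\<^sub>R (theta_deriv ?w + theta_deriv ?w')"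
      by (simp add: R_def scaleR_H1 theta_deriv_add H1_add WH)
    have th2: "theta_deriv (snd (R y)) = (- (1 / 2)) *\<^sub>R J (theta_deriv ?w - theta_deriv ?w')"
      by (simp add: R_def scaleR_H1 JH theta_deriv_diff H1_diff WH del: scaleR_minus_left)
    have "theta_deriv ?w - theta_deriv ?w' = (J ?a + J ?a) - t *\<^sub>R (?w + ?w')"
      unfolding thW thW' by (simp add: algebra_simps)
    then have 1: "theta_deriv (snd (R y)) - t *\<^sub>R J (fst (R y))
        = (- (1 / 2)) *\<^sub>R J ((J ?a + J ?a) - t *\<^sub>R (?w + ?w')) - t *\<^sub>R J ((1 / 2) *\<^sub>R (?w + ?w'))"
      unfolding th2 by (simp add: R_def)
    also have "\<dots> = (1 / 2) *\<^sub>R (?a + ?a)"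
      by (simp add: J.add J.diff J.scaleR JJ algebra_simps)
    also have "\<dots> = ?a" by (rule half[symmetric])
    finally have 1: "theta_deriv (snd (R y)) - t *\<^sub>R J (fst (R y)) = ?a" .
    have "theta_deriv ?w + theta_deriv ?w' = - (?b + ?b) - t *\<^sub>R (?w - ?w')"
      unfolding thW thW' by (simp add: algebra_simps)
    then have "- theta_deriv (fst (R y)) - t *\<^sub>R J (snd (R y))
        = - ((1 / 2) *\<^sub>R (- (?b + ?b) - t *\<^sub>R (?w - ?w'))) - t *\<^sub>R J ((- (1 / 2)) *\<^sub>R J (?w - ?w'))"
      unfolding th1 by (simp add: R_def)
    also have "\<dots> = (1 / 2) *\<^sub>R (?b + ?b)"
      by (simp add: J.add J.diff J.neg J.scaleR JJ algebra_simps)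
    also have "\<dots> = ?b" by (rule half[symmetric])
    finally have 2: "- theta_deriv (fst (R y)) - t *\<^sub>R J (snd (R y)) = ?b" .
    show ?thesis unfolding D0 1 2 by simp
  qed
  have RA: "R (dirac_comp f 0 x - (\<i> * complex_of_real t) *\<^sub>C x) = x" if "x \<in> H1 \<times> H1" for x
  proof -
    let ?a = "fst x" and ?b = "snd x"
    have ab: "?a \<in> H1" "?b \<in> H1" using that by auto
    let ?y = "(theta_deriv ?b - t *\<^sub>R J ?a, - theta_deriv ?a - t *\<^sub>R J ?b)"
    have "J (fst ?y) - snd ?y = theta_deriv (?a + J ?b) - (- t) *\<^sub>R (?a + J ?b)"
      by (simp add: theta_deriv_add ab JH J.diff J.scaleR JJ algebra_simps)
    then have w: "W ?y = ?a + J ?b"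
      unfolding W_def by (simp only: K(4)[OF H1_add[OF ab(1) JH(1)[OF ab(2)]]])
    have "- J (fst ?y) - snd ?y = theta_deriv (?a - J ?b) - t *\<^sub>R (?a - J ?b)"
      by (simp add: theta_deriv_diff ab JH J.diff J.scaleR JJ algebra_simps)
    then have w': "W' ?y = ?a - J ?b"
      unfolding W'_def by (simp only: K'(4)[OF H1_diff[OF ab(1) JH(1)[OF ab(2)]]])
    have "R ?y = ((1 / 2) *\<^sub>R (?a + ?a), (1 / 2) *\<^sub>R (?b + ?b))"
      unfolding R_def w w' by (simp add: J.add JJ algebra_simps)
    also have "\<dots> = x" by (simp only: half[symmetric] prod.collapse)
    finally show ?thesis unfolding D0 .
  qed
  have Wc: "compact_operator W" "compact_operator W'"
    unfolding W_def W'_def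
    by (rule compact_operator_compose_right[OF K(1)] compact_operator_compose_right[OF K'(1)];
        intro bounded_linear_sub bounded_linear_minus bounded_linear_compose[OF J]
          bounded_linear_fst bounded_linear_snd)+
  have "compact_operator (\<lambda>y. - W' y)"
    by (rule compact_operator_compose_left[OF Wc(2) bounded_linear_minus[OF bounded_linear_ident]])
  from compact_operator_add[OF Wc(1) this] have diff: "compact_operator (\<lambda>y. W y - W' y)" by simp
  have "compact_operator R"
    unfolding R_def
  proof (rule compact_operator_Pair)
    show "compact_operator (\<lambda>y. (1 / 2) *\<^sub>R (W y + W' y))"
      by (rule compact_operator_compose_left[OF compact_operator_add[OF Wc] bounded_linear_scaleR_right])
    show "compact_operator (\<lambda>y. (- (1 / 2)) *\<^sub>R J (W y - W' y))"
      by (rule compact_operator_compose_left[OF compact_operator_compose_left[OF diff J] bounded_linear_scaleR_right])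
  qed
  then show thesis using that RS AR RA by blast
qed

text \<open>With \<open>T\<close> the inverse of the block, the resolvent at \<open>l\<close> is
  \<open>T\<close> after the inverse of \<open>1 - l T\<close>. The bound on
  \<open>cmod l * c\<close> makes \<open>l T\<close> a contraction by 1/2, so the second factor has
  norm at most 2.\<close>

lemma dirac_comp_resolvent:
  assumes "n \<noteq> 0" and c: "\<And>y. norm (dirac_comp_inverse f n y) \<le> c * norm y"
    and l: "cmod l * c \<le> 1 / 2"
  obtains R where "compact_operator R" "\<And>y. R y \<in> H1 \<times> H1"
    "\<And>y. dirac_comp f n (R y) - l *\<^sub>C R y = y"
    "\<And>x. x \<in> H1 \<times> H1 \<Longrightarrow> R (dirac_comp f n x - l *\<^sub>C x) = x"
    "\<And>y. norm (R y) \<le> 2 * \<bar>c\<bar> * norm y"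
proof -
  define T where "T = dirac_comp_inverse f n"
  have T: "compact_operator T" "\<And>y. T y \<in> H1 \<times> H1" "\<And>y. dirac_comp f n (T y) = y"
    "\<And>x. x \<in> H1 \<times> H1 \<Longrightarrow> T (dirac_comp f n x) = x"
    using dirac_comp_inverse_props[OF \<open>n \<noteq> 0\<close>] by (auto simp: T_def)
  have S: "compact_operator (\<lambda>y. l *\<^sub>C T y)"
    by (rule compact_operator_compose_left[OF T(1) bounded_linear_scaleC])
  have half: "norm (l *\<^sub>C T y) \<le> norm y / 2" for y
  proof -
    have "norm (l *\<^sub>C T y) \<le> cmod l * (c * norm y)"
      unfolding norm_scaleC T_def by (intro mult_left_mono c) simp
    also have "\<dots> \<le> 1 / 2 * norm y"
      unfolding mult.assoc[symmetric] by (intro mult_right_mono l) simp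
    finally show ?thesis by simp
  qed
  obtain Q where Q: "bounded_linear Q" "\<And>y. Q y - l *\<^sub>C T (Q y) = y" "\<And>x. Q (x - l *\<^sub>C T x) = x"
    "\<And>y. norm (Q y) \<le> 2 * norm y"
    using compact_contraction_inverse[OF S half] by metis
  show thesis
  proof (rule that[of "\<lambda>y. T (Q y)"])
    show "compact_operator (\<lambda>y. T (Q y))" by (rule compact_operator_compose_right[OF T(1) Q(1)])
    show "T (Q y) \<in> H1 \<times> H1" for y by (rule T)
    show "dirac_comp f n (T (Q y)) - l *\<^sub>C T (Q y) = y" for y by (simp only: T(3) Q(2))
    show "T (Q (dirac_comp f n x - l *\<^sub>C x)) = x" if "x \<in> H1 \<times> H1" for x
      using Q(3)[of "dirac_comp f n x"] by (simp add: T(4)[OF that])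
    show "norm (T (Q y)) \<le> 2 * \<bar>c\<bar> * norm y" for y
    proof -
      have "norm (T (Q y)) \<le> c * norm (Q y)" unfolding T_def by (rule c)
      also have "\<dots> \<le> \<bar>c\<bar> * norm (Q y)" by (intro mult_right_mono) auto
      also have "\<dots> \<le> \<bar>c\<bar> * (2 * norm y)" by (intro mult_left_mono Q) simp
      finally show ?thesis by simp
    qed
  qed
qed

end

section \<open>Compactness of the resolvent\<close>

text \<open>Symmetric intervals of integers are finite and exhaust all integers. This translates
  limits for \<open>\<bar>n\<bar>\<close> tending to infinity into the finiteness conditions of the
  direct sum lemmas.\<close>

lemma eventually_abs_at_top_iff:
  "eventually P (filtercomap (\<lambda>n::int. \<bar>n\<bar>) at_top) \<longleftrightarrow> finite {n. \<not> P n}"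
proof
  assume "eventually P (filtercomap (\<lambda>n::int. \<bar>n\<bar>) at_top)"
  then obtain N :: int where N: "\<And>n. N \<le> \<bar>n\<bar> \<Longrightarrow> P n"
    unfolding eventually_filtercomap eventually_at_top_linorder by metis
  have "{n. \<not> P n} \<subseteq> {- \<bar>N\<bar>..\<bar>N\<bar>}" using N by force
  then show "finite {n. \<not> P n}" using finite_subset by blast
next
  assume "finite {n. \<not> P n}"
  then have "bdd_above (abs ` {n. \<not> P n})" by simp
  then obtain N where N: "\<And>n. \<not> P n \<Longrightarrow> \<bar>n\<bar> \<le> N" unfolding bdd_above_def by auto
  show "eventually P (filtercomap (\<lambda>n::int. \<bar>n\<bar>) at_top)"
    unfolding eventually_filtercomap eventually_at_top_linorder
  proof (intro exI[of _ "\<lambda>m. N < m"] conjI allI impI)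
    show "\<exists>M. \<forall>n\<ge>M. N < n" by (intro exI[of _ "N + 1"]) auto
    show "P n" if "N < \<bar>n\<bar>" for n using N[of n] that by force
  qed
qed

lemma dirac_eq_sum_op: "dirac_domain f = sum_domain (H1 \<times> H1) (dirac_comp f)" "dirac f = sum_op (dirac_comp f)"
  by (auto simp: dirac_domain_def sum_domain_def dirac_def sum_op_def fun_eq_iff)

text \<open>For x the preimage of y under \<open>D\<^sub>n\<close>, the lower bound for
  \<open>D\<^sub>n - l\<close> reads \<open>norm x \<le> e * (norm y + cmod l * norm x)\<close>
  outside a finite set of n. A small \<open>e\<close> absorbs the last term and leaves
  \<open>norm x \<le> 2 * e * norm y\<close>.\<close>

lemma has_compact_resolvent_imp_tendsto:
  assumes f: "circle_diffeo f" and "has_compact_resolvent (dirac_domain f) (dirac f)"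
  shows "((\<lambda>n. onorm (dirac_comp_inverse f n)) \<longlongrightarrow> 0) (filtercomap (\<lambda>n::int. \<bar>n\<bar>) at_top)"
proof (rule tendstoI)
  fix \<epsilon> :: real assume "0 < \<epsilon>"
  have "(0 :: circle_L2 \<times> circle_L2) \<in> H1 \<times> H1" by (simp add: zero_prod_def zero_in_H1)
  from direct_sum_compact_resolventD[OF assms(2)[unfolded dirac_eq_sum_op] this dirac_comp_zero[OF f]]
  obtain l where l: "\<forall>e>0. finite {n. \<exists>x\<in>H1 \<times> H1. e * norm (dirac_comp f n x - l *\<^sub>C x) < norm x}"
    by (elim exE) (rule that)
  \<comment> \<open>The first bound gives \<open>2 * e < \<epsilon>\<close>, the second
    \<open>e * cmod l \<le> 1 / 2\<close>; the \<open>+ 1\<close> covers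
    \<open>l = 0\<close>.\<close>
  define e where "e = min (\<epsilon> / 3) (1 / (2 * (cmod l + 1)))"
  have "0 < e" using \<open>0 < \<epsilon>\<close> by (simp add: e_def add_nonneg_pos)
  have "e * (cmod l + 1) \<le> 1 / (2 * (cmod l + 1)) * (cmod l + 1)"
    by (intro mult_right_mono) (auto simp: e_def)
  also have "\<dots> = 1 / 2" using norm_ge_zero[of l] by (simp add: add_nonneg_eq_0_iff)
  finally have el: "e * cmod l \<le> 1 / 2" using \<open>0 < e\<close> by (simp add: distrib_left)
  define bad where "bad = {n. \<exists>x\<in>H1 \<times> H1. e * norm (dirac_comp f n x - l *\<^sub>C x) < norm x}"
  have lt: "onorm (dirac_comp_inverse f n) < \<epsilon>" if n: "n \<noteq> 0" "n \<notin> bad" for n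
  proof -
    let ?T = "dirac_comp_inverse f n"
    have "onorm ?T \<le> 2 * e"
    proof (rule onorm_bound)
      fix y
      have "norm (?T y) \<le> e * norm (dirac_comp f n (?T y) - l *\<^sub>C ?T y)"
      proof (rule ccontr)
        assume "\<not> norm (?T y) \<le> e * norm (dirac_comp f n (?T y) - l *\<^sub>C ?T y)"
        then have "e * norm (dirac_comp f n (?T y) - l *\<^sub>C ?T y) < norm (?T y)" by (rule not_le_imp_less)
        then have "n \<in> bad"
          unfolding bad_def mem_Collect_eq by (rule bexI[OF _ dirac_comp_inverse_props(2)[OF f n(1)]])
        with n(2) show False by contradiction
      qed
      also have "\<dots> \<le> e * (norm y + cmod l * norm (?T y))"
        unfolding dirac_comp_inverse_props(3)[OF f n(1)] norm_scaleC[symmetric]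
        using \<open>0 < e\<close> by (intro mult_left_mono norm_triangle_ineq4) simp
      also have "\<dots> = e * norm y + (e * cmod l) * norm (?T y)" by (simp add: algebra_simps)
      also have "\<dots> \<le> e * norm y + 1 / 2 * norm (?T y)"
        by (intro add_left_mono mult_right_mono el) simp
      finally show "norm (?T y) \<le> 2 * e * norm y" by simp
    qed (use \<open>0 < e\<close> in simp)
    also have "\<dots> < \<epsilon>" using \<open>0 < \<epsilon>\<close> by (simp add: e_def min_def)
    finally show ?thesis .
  qed
  have nn: "0 \<le> onorm (dirac_comp_inverse f n)" if "n \<noteq> 0" for n
    by (intro onorm_pos_le compact_operator_bounded_linear dirac_comp_inverse_props(1) f that)
  \<comment> \<open>The index 0, where the reduced inverse takes the place of an inverse, is simply
    one more exception.\<close>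
  have "{n. \<not> dist (onorm (dirac_comp_inverse f n)) 0 < \<epsilon>} \<subseteq> insert 0 bad"
  proof (rule subsetI, rule ccontr)
    fix n assume *: "n \<in> {n. \<not> dist (onorm (dirac_comp_inverse f n)) 0 < \<epsilon>}" "n \<notin> insert 0 bad"
    then have "n \<noteq> 0" "n \<notin> bad" by simp_all
    with lt[of n] nn[of n] *(1) show False by (simp add: dist_real_def)
  qed
  moreover have "finite (insert 0 bad)" using l \<open>0 < e\<close> by (simp add: bad_def)
  ultimately show "\<forall>\<^sub>F n in filtercomap (\<lambda>n::int. \<bar>n\<bar>) at_top. dist (onorm (dirac_comp_inverse f n)) 0 < \<epsilon>"
    unfolding eventually_abs_at_top_iff by (rule finite_subset)
qed

text \<open>The resolvent is taken at \<open>\<i> t\<close> with \<open>t > 0\<close> so small that the Neumann series converges in all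
  components with \<open>n \<noteq> 0\<close> simultaneously.\<close>

lemma tendsto_imp_has_compact_resolvent:
  assumes f: "circle_diffeo f"
    and lim: "((\<lambda>n. onorm (dirac_comp_inverse f n)) \<longlongrightarrow> 0) (filtercomap (\<lambda>n::int. \<bar>n\<bar>) at_top)"
  shows "has_compact_resolvent (dirac_domain f) (dirac f)"
proof -
  define c where "c n = onorm (dirac_comp_inverse f n)" for n
  have fin: "finite {n. e \<le> c n}" if "0 < e" for e
    using order_tendstoD(2)[OF lim that] unfolding eventually_abs_at_top_iff by (simp add: c_def not_less)
  \<comment> \<open>A common bound for all \<open>c n\<close>, since only finitely many reach 1.
    \<open>c 0\<close> is carried along as a mere number; block 0 receives its own resolvent
    below.\<close>
  define M where "M = 1 + (\<Sum>n\<in>{n. 1 \<le> c n}. c n)"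
  have nn: "0 \<le> (\<Sum>n\<in>{n. 1 \<le> c n}. c n)" by (intro sum_nonneg) auto
  have cM: "c n \<le> M" for n
  proof (cases "1 \<le> c n")
    case True
    then have "c n \<le> (\<Sum>n\<in>{n. 1 \<le> c n}. c n)" by (intro member_le_sum fin) auto
    then show ?thesis by (simp add: M_def)
  qed (use nn in \<open>simp add: M_def\<close>)
  have "0 < M" using nn by (simp add: M_def)
  define t where "t = 1 / (2 * M)"
  have "0 < t" using \<open>0 < M\<close> by (simp add: t_def)
  define l where "l = \<i> * complex_of_real t"
  have l: "cmod l * c n \<le> 1 / 2" for n
  proof -
    have "cmod l * c n \<le> t * M"
      using \<open>0 < t\<close> by (simp add: l_def norm_mult cM)
    also have "\<dots> = 1 / 2" using \<open>0 < M\<close> by (simp add: t_def)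
    finally show ?thesis .
  qed
  have lin: "bounded_linear (dirac_comp_inverse f n)" if "n \<noteq> 0" for n
    by (rule compact_operator_bounded_linear[OF dirac_comp_inverse_props(1)[OF f that]])
  have c0: "0 \<le> c n" if "n \<noteq> 0" for n
    unfolding c_def by (rule onorm_pos_le[OF lin[OF that]])
  obtain R0 where R0: "compact_operator R0" "\<And>y. R0 y \<in> H1 \<times> H1"
    "\<And>y. dirac_comp f 0 (R0 y) - l *\<^sub>C R0 y = y"
    "\<And>x. x \<in> H1 \<times> H1 \<Longrightarrow> R0 (dirac_comp f 0 x - l *\<^sub>C x) = x"
    using dirac_comp_0_resolvent[OF f \<open>0 < t\<close>] unfolding l_def by metis
  \<comment> \<open>The factor 2 comes from the perturbed inverse. A single block does not affect
    the finiteness condition, so block 0 may enter with whatever norm its resolvent has.\<close>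
  define c' where "c' n = (if n = 0 then onorm R0 else 2 * c n)" for n
  have "\<exists>R. compact_operator R \<and> (\<forall>y. R y \<in> H1 \<times> H1) \<and>
      (\<forall>y. dirac_comp f n (R y) - l *\<^sub>C R y = y) \<and>
      (\<forall>x\<in>H1 \<times> H1. R (dirac_comp f n x - l *\<^sub>C x) = x) \<and> (\<forall>y. norm (R y) \<le> c' n * norm y)" for n
  proof (cases "n = 0")
    case True
    then show ?thesis
      using R0 onorm[OF compact_operator_bounded_linear[OF R0(1)]]
      by (intro exI[of _ R0]) (simp add: c'_def)
  next
    case False
    have "norm (dirac_comp_inverse f n y) \<le> c n * norm y" for y
      unfolding c_def by (rule onorm[OF lin[OF False]])
    from dirac_comp_resolvent[OF f False this l]
    obtain R where "compact_operator R" "\<And>y. R y \<in> H1 \<times> H1"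
      "\<And>y. dirac_comp f n (R y) - l *\<^sub>C R y = y"
      "\<And>x. x \<in> H1 \<times> H1 \<Longrightarrow> R (dirac_comp f n x - l *\<^sub>C x) = x"
      "\<And>y. norm (R y) \<le> 2 * \<bar>c n\<bar> * norm y" by metis
    then show ?thesis using c0[OF False] False by (intro exI[of _ R]) (simp add: c'_def)
  qed
  then obtain R where R: "\<And>n. compact_operator (R n)" "\<And>n y. R n y \<in> H1 \<times> H1"
    "\<And>n y. dirac_comp f n (R n y) - l *\<^sub>C R n y = y"
    "\<And>n x. x \<in> H1 \<times> H1 \<Longrightarrow> R n (dirac_comp f n x - l *\<^sub>C x) = x"
    "\<And>n y. norm (R n y) \<le> c' n * norm y" by metis
  have fin': "finite {n. e \<le> c' n}" if "0 < e" for e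
  proof (rule finite_subset)
    show "{n. e \<le> c' n} \<subseteq> insert 0 {n. e / 2 \<le> c n}" by (auto simp: c'_def)
    show "finite (insert 0 {n. e / 2 \<le> c n})" using fin[of "e / 2"] that by simp
  qed
  show ?thesis
    unfolding dirac_eq_sum_op by (rule direct_sum_has_compact_resolvent[OF R(1,5) fin' R(2,3,4)])
qed

lemma growth_seq_imp_tendsto:
  assumes f: "circle_diffeo f" and "growth_seq f \<in> o(\<lambda>n. real n)"
  shows "((\<lambda>n. onorm (dirac_comp_inverse f n)) \<longlongrightarrow> 0) (filtercomap (\<lambda>n::int. \<bar>n\<bar>) at_top)"
proof (rule tendstoI)
  fix \<epsilon> :: real assume "0 < \<epsilon>"
  then have "\<forall>\<^sub>F n in at_top. norm (growth_seq f n) \<le> \<epsilon> / 2 * norm (real n)"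
    by (intro landau_o.smallD[OF assms(2)]) simp
  then obtain N where N: "\<And>n. N \<le> n \<Longrightarrow> \<bar>growth_seq f n\<bar> \<le> \<epsilon> / 2 * real n"
    unfolding eventually_at_top_linorder by auto
  have "dist (onorm (dirac_comp_inverse f n)) 0 < \<epsilon>" if n: "N \<le> nat \<bar>n\<bar>" "n \<noteq> 0" for n
  proof -
    let ?T = "dirac_comp_inverse f n" and ?g = "growth_seq f (nat \<bar>n\<bar>)"
    have "?g \<le> \<epsilon> / 2 * \<bar>real_of_int n\<bar>" using N[OF n(1)] by simp
    then have "?g / \<bar>real_of_int n\<bar> \<le> \<epsilon> / 2" using n(2) by (simp add: field_simps)
    moreover have "onorm ?T \<le> ?g / \<bar>real_of_int n\<bar>"
    proof (rule onorm_bound)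
      have "0 \<le> cmod (delta f n 1)" by simp
      also have "\<dots> \<le> ?g" by (rule norm_delta_le_growth_seq[OF f]) simp
      finally show "0 \<le> ?g / \<bar>real_of_int n\<bar>" by simp
      show "norm (?T y) \<le> ?g / \<bar>real_of_int n\<bar> * norm y" for y
        by (rule dirac_comp_inverse_props(5)[OF f n(2) norm_delta_le_growth_seq[OF f]])
    qed
    moreover have "0 \<le> onorm ?T"
      by (intro onorm_pos_le compact_operator_bounded_linear dirac_comp_inverse_props(1) f n)
    ultimately show ?thesis using \<open>0 < \<epsilon>\<close> unfolding dist_real_def by linarith
  qed
  note small = this
  \<comment> \<open>The interval always contains 0, so its complement consists of indices with a
    genuine inverse.\<close>
  have "{n. \<not> dist (onorm (dirac_comp_inverse f n)) 0 < \<epsilon>} \<subseteq> {- int N..int N}"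
  proof (rule subsetI, rule ccontr)
    fix n assume *: "n \<in> {n. \<not> dist (onorm (dirac_comp_inverse f n)) 0 < \<epsilon>}" "n \<notin> {- int N..int N}"
    then have "N \<le> nat \<bar>n\<bar>" "n \<noteq> 0" by auto
    with small *(1) show False by simp
  qed
  then show "\<forall>\<^sub>F n in filtercomap (\<lambda>n::int. \<bar>n\<bar>) at_top. dist (onorm (dirac_comp_inverse f n)) 0 < \<epsilon>"
    unfolding eventually_abs_at_top_iff by (rule finite_subset) simp
qed

theorem theorem7p3:
  fixes \<alpha> :: real and f :: "complex \<Rightarrow> complex"
  assumes "0 < \<alpha>" and "\<alpha> < 1 / 2" and "\<alpha> \<notin> \<rat>"
    and "circle_diffeo f" and "orientation_preserving f"
    and "has_rotation_number f (2 * \<alpha>)"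
  shows "(has_compact_resolvent (dirac_domain f) (dirac f) \<longleftrightarrow>
            ((\<lambda>n. onorm (dirac_comp_inverse f n)) \<longlongrightarrow> 0)
              (filtercomap (\<lambda>n::int. \<bar>n\<bar>) at_top)) \<and>
         (growth_seq f \<in> o(\<lambda>n. real n) \<longrightarrow>
            has_compact_resolvent (dirac_domain f) (dirac f))"
  using has_compact_resolvent_imp_tendsto tendsto_imp_has_compact_resolvent growth_seq_imp_tendsto
    assms(4) by blast

end
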